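(* Let $A\equiv1$. For every $\gamma\in H$: - there exists a unique solution $\mu\in H$ of the integral equation $\mu-\mathbf N\mu=-\mathbf M\gamma$; - there exists a unique function $h=(h_1,h_2,\dots,h_m)$, given by $h=\tfrac12[\mathbf M\mu-(\mathbf I-\mathbf N)\gamma]$; such that $f^+=\gamma+h+i\mu$ are the boundary values of the unique solution $f$ of the problem of finding $f$ analytic in $G$ with $f(\infty)=0$, continuous on $G\cup\Gamma$, and satisfying $\operatorname{Re}[f^+]=\gamma+h$ on $\Gamma$.
   Context: $G$ is an unbounded multiply connected region of connectivity $m$ with $\infty\in G$ and $0\in G$. Its boundary is $\Gamma=\Gamma_1\cup\dots\cup\Gamma_m$, consisting of simple, non-intersecting, smooth, clockwise oriented closed curves. Each $\Gamma_k$ is parametrized by a $2\pi$-periodic, twice continuously differentiable function $\eta_k$ with $\dot\eta_k\ne0$. $J$ is the disjoint union of $J_k=[0,2\pi]$, and $\eta=\eta_k$ on $J_k$. $H$ is the space of real functions on $J$ that are Hölder continuous and $2\pi$-periodic on each $J_k$. Functions on $\Gamma$ are identified with functions on $J$ via $\eta$, and $f^+$ is the boundary value from $G$. For real constants $\alpha_1,\dots,\alpha_m$, the notation $(\alpha_1,\dots,\alpha_m)$ denotes the piecewise constant function in $H$ equal to $\alpha_k$ on $J_k$. With $A\equiv1$, the real kernels are given by \[ M(s,t)+iN(s,t):=\frac1\pi\frac{\dot\eta(t)}{\eta(t)-\eta(s)} , \] where $N$ is the Neumann kernel. The operators are $\mathbf N\mu(s)=\int_J N(s,t)\mu(t)\,dt$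 and $\mathbf M\mu(s)=\int_J M(s,t)\mu(t)\,dt$ (principal value). $\mathbf I$ is the identity. *)

theory Defs
  imports "HOL-Complex_Analysis.Complex_Analysis"
begin

definition C2_curve :: "(real \<Rightarrow> complex) \<Rightarrow> bool" where
  "C2_curve g \<longleftrightarrow> (\<exists>g1 g2. (\<forall>t. (g has_vector_derivative g1 t) (at t)) \<and>
                          (\<forall>t. (g1 has_vector_derivative g2 t) (at t)) \<and>
                          continuous_on UNIV g2)"

definition curve_path :: "(nat \<Rightarrow> real \<Rightarrow> complex) \<Rightarrow> nat \<Rightarrow> real \<Rightarrow> complex" where
  "curve_path eta k = (\<lambda>s. eta k (2 * pi * s))"

definition bdry :: "(nat \<Rightarrow> real \<Rightarrow> complex) \<Rightarrow> nat \<Rightarrow> complex set" where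
  "bdry eta m = (\<Union>k\<in>{1..m}. eta k ` {0..2*pi})"

definition admissible_domain ::
  "complex set \<Rightarrow> nat \<Rightarrow> (nat \<Rightarrow> real \<Rightarrow> complex) \<Rightarrow> bool" where
  "admissible_domain G m eta \<longleftrightarrow>
     m \<ge> 1 \<and>
     open G \<and> connected G \<and> bounded (- G) \<and> 0 \<in> G \<and>
     frontier G = bdry eta m \<and>
     (\<forall>k\<in>{1..m}.
        C2_curve (eta k) \<and>
        (\<forall>t. eta k (t + 2 * pi) = eta k t) \<and>
        (\<forall>t. vector_derivative (eta k) (at t) \<noteq> 0) \<and>
        inj_on (eta k) {0..<2*pi} \<and>
        (\<forall>z. z \<notin> path_image (curve_path eta k) \<longrightarrow>
              winding_number (curve_path eta k) z = 0 \<or>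
              winding_number (curve_path eta k) z = -1)) \<and>
     (\<forall>k\<in>{1..m}. \<forall>l\<in>{1..m}. k \<noteq> l \<longrightarrow>
        eta k ` {0..2*pi} \<inter> eta l ` {0..2*pi} = {})"

text \<open>The space H: real functions on J (J_k = [0,2pi], k = 1..m) which are
  Hoelder continuous and 2pi-periodic on each J_k.  A function on J is
  represented as phi k t for k in {1..m}, t in [0,2pi]; other values are irrelevant.\<close>
definition Hspace :: "nat \<Rightarrow> (nat \<Rightarrow> real \<Rightarrow> real) set" where
  "Hspace m = {phi. \<forall>k\<in>{1..m}. phi k 0 = phi k (2*pi) \<and>
       (\<exists>\<alpha> C. 0 < \<alpha> \<and> \<alpha> \<le> 1 \<and>
          (\<forall>s\<in>{0..2*pi}. \<forall>t\<in>{0..2*pi}. \<bar>phi k s - phi k t\<bar> \<le> C * \<bar>s - t\<bar> powr \<alpha>))}"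

definition kerMN :: "(nat \<Rightarrow> real \<Rightarrow> complex) \<Rightarrow> nat \<Rightarrow> real \<Rightarrow> nat \<Rightarrow> real \<Rightarrow> complex" where
  "kerMN eta j s k t = complex_of_real (1 / pi) * vector_derivative (eta k) (at t) / (eta k t - eta j s)"

definition kerN :: "(nat \<Rightarrow> real \<Rightarrow> complex) \<Rightarrow> nat \<Rightarrow> real \<Rightarrow> nat \<Rightarrow> real \<Rightarrow> real" where
  "kerN eta j s k t = Im (kerMN eta j s k t)"

definition kerM :: "(nat \<Rightarrow> real \<Rightarrow> complex) \<Rightarrow> nat \<Rightarrow> real \<Rightarrow> nat \<Rightarrow> real \<Rightarrow> real" where
  "kerM eta j s k t = Re (kerMN eta j s k t)"

definition Nop :: "(nat \<Rightarrow> real \<Rightarrow> complex) \<Rightarrow> nat \<Rightarrow> (nat \<Rightarrow> real \<Rightarrow> real) \<Rightarrow> nat \<Rightarrow> real \<Rightarrow> real" where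
  "Nop eta m mu j s = (\<Sum>k\<in>{1..m}. integral {0..2*pi} (\<lambda>t. kerN eta j s k t * mu k t))"

text \<open>Domain of integration with the symmetric (periodic) eps-neighbourhood of s removed on J_j.\<close>
definition pv_set :: "nat \<Rightarrow> real \<Rightarrow> nat \<Rightarrow> real \<Rightarrow> real set" where
  "pv_set j s k \<epsilon> = (if k = j then {t\<in>{0..2*pi}. \<epsilon> \<le> \<bar>t - s\<bar> \<and> \<epsilon> \<le> 2*pi - \<bar>t - s\<bar>}
                      else {0..2*pi})"

definition Mop :: "(nat \<Rightarrow> real \<Rightarrow> complex) \<Rightarrow> nat \<Rightarrow> (nat \<Rightarrow> real \<Rightarrow> real) \<Rightarrow> nat \<Rightarrow> real \<Rightarrow> real" where
  "Mop eta m mu j s = Lim (at_right 0)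
     (\<lambda>\<epsilon>. \<Sum>k\<in>{1..m}. integral (pv_set j s k \<epsilon>) (\<lambda>t. kerM eta j s k t * mu k t))"

definition ext_problem ::
  "complex set \<Rightarrow> nat \<Rightarrow> (nat \<Rightarrow> real \<Rightarrow> complex) \<Rightarrow> (nat \<Rightarrow> real \<Rightarrow> real) \<Rightarrow> (complex \<Rightarrow> complex) \<Rightarrow> bool" where
  "ext_problem G m eta psi f \<longleftrightarrow>
     f holomorphic_on G \<and> (f \<longlongrightarrow> 0) at_infinity \<and>
     continuous_on (G \<union> bdry eta m) f \<and>
     (\<forall>k\<in>{1..m}. \<forall>t\<in>{0..2*pi}. Re (f (eta k t)) = psi k t)"

end

theory Submission
  imports Defs
begin

text \<open>
  Extend a Hoelder density \<open>\<phi>\<close> on a boundary curve to a Hoelder function \<open>\<psi>\<close> on the plane. The integral of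
  \<open>(\<psi> \<zeta> - \<psi> z) / (\<zeta> - z)\<close> over the curve is then Hoelder continuous in \<open>z\<close> on the whole plane. Off the
  curve it differs from the Cauchy integral of \<open>\<phi>\<close> by \<open>\<psi> z\<close> times the winding number, and on the curve it
  is given by M and N, because \<open>N 1 = -1\<close> on a clockwise curve. So the Cauchy integral \<open>f\<close> of
  \<open>\<gamma> + \<i> \<mu>\<close>, divided by \<open>2 \<pi> \<i>\<close>, has in G the boundary values
  \<open>\<gamma> + h + \<i> \<mu>\<close>, and inside the curves the boundary values \<open>h\<close>, exactly when
  \<open>\<mu> - N \<mu> = - M \<gamma>\<close>. Since \<open>h\<close> is real, \<open>f\<close> is constant inside each curve, and so is \<open>h\<close> on it.

  If a solution in G has constant real part on each boundary curve, the frontier of its image lies in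
  finitely many vertical lines; by the open mapping theorem it vanishes. Hence
  \<open>\<mu> - N \<mu> = 0\<close> has only the trivial solution, and existence follows from the
  Fredholm alternative for the continuous kernel N.
\<close>

section \<open>Holomorphic functions with boundary values on lines\<close>

text \<open>The Fredholm alternative is applied to the continuous functions on \<open>J\<close>,
  whereas the theorem speaks of \<open>H\<close>, whose elements have no common Hoelder exponent.
  Regularity closes the gap: \<open>N\<close> maps continuous functions to Hoelder continuous ones,
  because its kernel is bounded and comes from a Cauchy kernel with a singularity of order one, and
  \<open>M\<close> keeps functions Hoelder continuous at the price of a smaller exponent. So every
  continuous solution lies in \<open>H\<close>; this serves existence as well as the injectivity
  check.

  The identity \<open>N 1 = -1\<close> is the delicate point. It gives the curve winding number -1/2
  at its own points, whereas the hypothesis concerns only points off the curve, with values 0 and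
  -1. A one-sided limit would require knowing which side is the interior. The sum over both sides
  suffices, since an exponential identity excludes the totals in which the two values agree.

  The functions \<open>h\<close> that belong to two densities are not known in advance to agree.
  This is why uniqueness is proved for real parts that are constant on each curve, and not only for
  real part 0.\<close>

text \<open>A bounded open set has a frontier point on every line that it meets. So its frontier
  cannot lie in finitely many parallel lines, unless it is empty.\<close>

lemma frontier_image_line_imp_constant:
  fixes f :: "complex \<Rightarrow> complex"
  assumes hol: "f holomorphic_on D" and "open D" "connected D"
    and bnd: "bounded (f ` D)" and "finite S" "c \<noteq> 0"
    and fr: "frontier (f ` D) \<subseteq> {w. Re (c * w) \<in> S}"
  shows "f constant_on D"
proof (rule ccontr)
  assume nc: "\<not> f constant_on D"
  let ?W = "(\<lambda>w. c * w) ` f ` D"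
  have "D \<noteq> {}"
    using nc by (auto simp: constant_on_def)
  then obtain z0 where "z0 \<in> D" by blast
  have opfD: "open (f ` D)"
    using open_mapping_thm[OF hol \<open>open D\<close> \<open>connected D\<close> \<open>open D\<close> order_refl nc] .
  then obtain e where e: "e > 0" "ball (f z0) e \<subseteq> f ` D"
    using \<open>z0 \<in> D\<close> by (meson imageI open_contains_ball)
  \<comment> \<open>Adding x / c to a point w changes Re (c * w) by exactly x. So a segment inside
    the ball offers infinitely many values, and one of them avoids the finite set
    \<open>S\<close>.\<close>
  let ?p = "\<lambda>x::real. f z0 + of_real x / c"
  have inj: "inj (\<lambda>x. Re (c * ?p x))"
    using \<open>c \<noteq> 0\<close> by (auto simp: inj_def algebra_simps)
  have "infinite {0<..<e * norm c}"
    using e \<open>c \<noteq> 0\<close> by simp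
  then have "infinite ((\<lambda>x. Re (c * ?p x)) ` {0<..<e * norm c})"
    using inj by (meson finite_imageD inj_on_subset subset_UNIV)
  then obtain x where x: "x \<in> {0<..<e * norm c}" "Re (c * ?p x) \<notin> S"
    using \<open>finite S\<close> by (meson finite_subset image_subsetI)
  define w where "w = ?p x"
  have "w \<in> ball (f z0) e"
    using x \<open>c \<noteq> 0\<close> by (simp add: w_def dist_norm norm_divide field_simps)
  then have w: "w \<in> f ` D" using e by blast
  obtain B where B: "\<And>v. v \<in> f ` D \<Longrightarrow> norm v \<le> B"
    using bnd by (auto simp: bounded_iff)
  \<comment> \<open>The line through \<open>w\<close> on which Re (c * v) is constant. It is
    unbounded, so it leaves the image and crosses its frontier, although the constant is not in
    \<open>S\<close>.\<close>
  define L where "L = (\<lambda>y::real. w + \<i> * of_real y / c) ` UNIV"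
  have "connected L"
    unfolding L_def by (intro connected_continuous_image continuous_intros) (use \<open>c \<noteq> 0\<close> in auto)
  moreover have "w \<in> L"
    unfolding L_def by (rule image_eqI[of _ _ 0]) auto
  moreover have "\<exists>v\<in>L. v \<notin> f ` D"
  proof -
    let ?y = "(norm w + \<bar>B\<bar> + 1) * norm c"
    have "norm (\<i> * of_real ?y / c) = norm w + \<bar>B\<bar> + 1"
      using \<open>c \<noteq> 0\<close> by (simp add: norm_mult norm_divide flip: of_real_add)
    then have "norm (w + \<i> * of_real ?y / c) \<ge> \<bar>B\<bar> + 1"
      using norm_triangle_ineq2[of "\<i> * of_real ?y / c" "-w"] by (simp add: add.commute)
    then have "w + \<i> * of_real ?y / c \<notin> f ` D" using B by fastforce
    then show ?thesis unfolding L_def by blast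
  qed
  ultimately have "L \<inter> frontier (f ` D) \<noteq> {}"
    using w by (intro connected_Int_frontier) auto
  then obtain y where "Re (c * (w + \<i> * of_real y / c)) \<in> S"
    using fr unfolding L_def by fastforce
  moreover have "Re (c * (w + \<i> * of_real y / c)) = Re (c * w)"
    using \<open>c \<noteq> 0\<close> by (simp add: distrib_left)
  ultimately show False using x w_def by simp
qed

text \<open>\<open>closure G\<close> need not be compact, but its part in a large disc is, and
  beyond that disc \<open>f\<close> is small. So 0 is the only limit point of the image that may
  fail to be a value on \<open>closure G\<close>.\<close>

lemma closure_image_vanishing_at_infinity:
  fixes f :: "complex \<Rightarrow> complex"
  assumes cont: "continuous_on (closure G) f" and lim: "(f \<longlongrightarrow> 0) at_infinity"
  shows "closure (f ` G) \<subseteq> insert 0 (f ` closure G)" and "bounded (f ` G)"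
proof -
  have *: "\<exists>R. \<forall>z. R \<le> norm z \<longrightarrow> norm (f z) < e" if "e > 0" for e
  proof -
    have "\<forall>\<^sub>F z in at_infinity. norm (f z) < e"
      using lim that by (auto simp: tendsto_iff)
    then show ?thesis by (auto simp: eventually_at_infinity)
  qed
  have comp: "compact (f ` (closure G \<inter> cball 0 R))" for R
    by (intro compact_continuous_image continuous_on_subset[OF cont])
       (auto simp: closed_Int_compact)
  show "closure (f ` G) \<subseteq> insert 0 (f ` closure G)"
  proof
    fix w assume w: "w \<in> closure (f ` G)"
    show "w \<in> insert 0 (f ` closure G)"
    proof (cases "w = 0")
      case False
      then obtain R where R: "\<And>z. R \<le> norm z \<Longrightarrow> norm (f z) < norm w / 2"
        using *[of "norm w / 2"] by auto
      have "f ` G \<subseteq> f ` (closure G \<inter> cball 0 R) \<union> cball 0 (norm w / 2)"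
        using R closure_subset[of G] by (force simp: not_le dest: less_imp_le)
      moreover have "closed (f ` (closure G \<inter> cball 0 R) \<union> cball 0 (norm w / 2))"
        by (intro closed_Un compact_imp_closed comp closed_cball)
      ultimately have "w \<in> f ` (closure G \<inter> cball 0 R) \<union> cball 0 (norm w / 2)"
        using w closure_minimal by blast
      then show ?thesis using False by auto
    qed simp
  qed
  obtain R where R: "\<And>z. R \<le> norm z \<Longrightarrow> norm (f z) < 1"
    using *[of 1] by auto
  have "f ` G \<subseteq> f ` (closure G \<inter> cball 0 R) \<union> cball 0 1"
    using R closure_subset[of G] by (force simp: not_le dest: less_imp_le)
  then show "bounded (f ` G)"
    using comp by (meson bounded_Un bounded_cball bounded_subset compact_imp_bounded)
qed

text \<open>A limit point of the image that is not attained in \<open>G\<close> is a boundary value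
  or 0, the limit at infinity. Hence the frontier of the image lies over the finite set
  \<open>insert 0 S\<close>. The resulting constant is 0 because \<open>G\<close> contains a
  neighbourhood of infinity.\<close>

lemma boundary_in_lines_imp_zero:
  fixes f :: "complex \<Rightarrow> complex"
  assumes hol: "f holomorphic_on G" and G: "open G" "connected G" "bounded (- G)"
    and cont: "continuous_on (closure G) f" and lim: "(f \<longlongrightarrow> 0) at_infinity"
    and fin: "finite S" and S: "\<And>z. z \<in> frontier G \<Longrightarrow> Re (f z) \<in> S" and z: "z \<in> closure G"
  shows "f z = 0"
proof -
  have "frontier (f ` G) \<subseteq> {w. Re (1 * w) \<in> insert 0 S}" if "\<not> f constant_on G"
  proof
    fix w assume w: "w \<in> frontier (f ` G)"
    have "open (f ` G)"
      using open_mapping_thm[OF hol G(1,2,1) order_refl that] .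
    then have "w \<notin> f ` G" "w \<in> closure (f ` G)"
      using w by (auto simp: frontier_def interior_open)
    then have "w = 0 \<or> w \<in> f ` frontier G"
      using closure_image_vanishing_at_infinity(1)[OF cont lim] G(1)
      by (auto simp: frontier_def interior_open)
    then show "w \<in> {w. Re (1 * w) \<in> insert 0 S}"
      using S by auto
  qed
  then have "f constant_on G"
    using frontier_image_line_imp_constant[OF hol G(1,2) closure_image_vanishing_at_infinity(2)[OF cont lim], of "insert 0 S" 1] fin
    by auto
  then obtain c where c: "\<And>z. z \<in> G \<Longrightarrow> f z = c"
    by (auto simp: constant_on_def)
  have "c = 0"
  proof (rule tendsto_unique[OF _ _ lim])
    obtain B where "\<And>z. z \<in> - G \<Longrightarrow> norm z \<le> B"
      using G(3) by (auto simp: bounded_iff)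
    then have "\<forall>\<^sub>F z in at_infinity. f z = c"
      unfolding eventually_at_infinity using c by (metis ComplI not_less_eq_eq not_le less_add_one order_less_le_trans)
    then show "(f \<longlongrightarrow> c) at_infinity"
      by (simp add: tendsto_eventually)
  qed (rule trivial_limit_at_infinity)
  then show ?thesis
    using continuous_constant_on_closure[OF cont _ z, of 0] c by auto
qed

text \<open>Multiplication by \<open>\<i>\<close> turns the condition on the imaginary part into a
  single vertical line. Applied inside each curve, this is what makes \<open>h\<close> constant
  there.\<close>

lemma real_boundary_imp_constant:
  fixes g :: "complex \<Rightarrow> complex"
  assumes hol: "g holomorphic_on D" and D: "open D" "connected D" "bounded D" "D \<noteq> {}"
    and cont: "continuous_on (closure D) g"
    and S: "\<And>z. z \<in> frontier D \<Longrightarrow> Im (g z) = 0"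
  obtains c :: real where "\<And>z. z \<in> closure D \<Longrightarrow> g z = of_real c"
proof -
  have comp: "compact (g ` closure D)"
    using D(3) by (intro compact_continuous_image cont) (auto simp: compact_eq_bounded_closed)
  have "frontier (g ` D) \<subseteq> {w. Re (\<i> * w) \<in> {0}}" if "\<not> g constant_on D"
  proof
    fix w assume w: "w \<in> frontier (g ` D)"
    have "open (g ` D)"
      using open_mapping_thm[OF hol D(1,2,1) order_refl that] .
    then have "w \<notin> g ` D" "w \<in> closure (g ` D)"
      using w by (auto simp: frontier_def interior_open)
    moreover have "closure (g ` D) \<subseteq> g ` closure D"
      using comp closure_subset by (intro closure_minimal compact_imp_closed) auto
    ultimately have "w \<in> g ` frontier D"
      using D(1) unfolding frontier_def interior_open[OF D(1)] by blast
    then show "w \<in> {w. Re (\<i> * w) \<in> {0}}"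
      using S by auto
  qed
  moreover have "bounded (g ` D)"
    using comp closure_subset by (meson bounded_subset compact_imp_bounded image_mono)
  ultimately have "g constant_on D"
    using frontier_image_line_imp_constant[OF hol D(1,2), of "{0}" \<i>] by auto
  then obtain c where c: "\<And>z. z \<in> D \<Longrightarrow> g z = c"
    by (auto simp: constant_on_def)
  then have cl: "\<And>z. z \<in> closure D \<Longrightarrow> g z = c"
    using continuous_constant_on_closure[OF cont] by blast
  have "frontier D \<noteq> {}"
    using D frontier_not_empty not_bounded_UNIV by blast
  then have "Im c = 0"
    using cl S by (auto simp: frontier_def)
  then show ?thesis
    using that[of "Re c"] cl by (simp add: complex_eq_iff)
qed


section \<open>The Fredholm alternative for continuous kernels\<close>

text \<open>A dimension count. \<open>B\<close> may be dependent, so it is thinned to a basis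
  \<open>B'\<close>. The image of \<open>B'\<close> is independent with the same number of elements,
  and a vector outside its span would give too many independent vectors in
  \<open>span B'\<close>.\<close>

lemma linear_inj_on_span_imp_surj:
  fixes L :: "'a::real_vector \<Rightarrow> 'a"
  assumes L: "linear L" and "finite B" and LV: "L ` span B \<subseteq> span B"
    and inj: "\<And>x. x \<in> span B \<Longrightarrow> L x = 0 \<Longrightarrow> x = 0"
  shows "span B \<subseteq> L ` span B"
proof -
  obtain B' where B': "B' \<subseteq> B" "independent B'" "span B' = span B"
    using maximal_independent_subset[of B] by (metis span_eq span_superset span_mono subset_antisym span_minimal subspace_span)
  have fin: "finite B'" using B' \<open>finite B\<close> finite_subset by blast
  have injB: "inj_on L (span B')"
    using inj B' linear_injective_on_subspace_0[OF L subspace_span, of B] by simp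
  have ind: "independent (L ` B')"
    using linear_independent_injective_image[OF L B'(2)] injB by blast
  have card: "card (L ` B') = card B'"
    using injB by (meson card_image inj_on_subset span_superset)
  have sub: "L ` B' \<subseteq> span B'"
    using LV B' span_superset by blast
  have "span B' \<subseteq> span (L ` B')"
  proof
    fix x assume x: "x \<in> span B'"
    show "x \<in> span (L ` B')"
    proof (rule ccontr)
      assume nx: "x \<notin> span (L ` B')"
      then have "independent (insert x (L ` B'))"
        using ind by (simp add: independent_insert)
      moreover have "insert x (L ` B') \<subseteq> span B'"
        using x sub by simp
      ultimately have "card (insert x (L ` B')) \<le> card B'"
        using independent_span_bound[OF fin] by blast
      moreover have "x \<notin> L ` B'" using nx span_base by metis
      ultimately show False using card fin by simp
    qed
  qed
  then show ?thesis
    using B' linear_span_image[OF L, of B'] by simp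
qed

lemma contraction_imp_bij_id_minus:
  fixes E :: "'a::{real_normed_vector,complete_space} \<Rightarrow> 'a"
  assumes E: "linear E" and c: "0 \<le> c" "c < 1" "\<And>x. norm (E x) \<le> c * norm x"
  shows "\<exists>!x. x - E x = y"
proof -
  have "\<exists>!x. E x + y = x"
  proof (rule banach_fix_type[OF c(1,2)], intro allI)
    fix u v show "dist (E u + y) (E v + y) \<le> c * dist u v"
      using c(3)[of "u - v"] by (simp add: dist_norm linear_diff[OF E])
  qed
  then show ?thesis by (metis add_diff_cancel_left' diff_add_cancel add.commute)
qed

text \<open>Let E = T - F and let S be the inverse of I - E, which exists by contraction. Then I - T
  = (I - E) (I - S F), and S F has its range in the span of a finite set, on which injectivity
  implies surjectivity.\<close>

lemma fredholm_finite_rank_perturbation: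
  fixes T F :: "'a::{real_normed_vector,complete_space} \<Rightarrow> 'a"
  assumes T: "linear T" and F: "linear F" and c: "0 \<le> c" "c < 1"
    and close: "\<And>x. norm (T x - F x) \<le> c * norm x"
    and fin: "finite B" and rng: "\<And>x. F x \<in> span B"
    and inj: "\<And>x. x = T x \<Longrightarrow> x = 0"
  shows "\<exists>x. x - T x = y"
proof -
  define E where "E x = T x - F x" for x
  have E: "linear E"
    unfolding E_def by (intro linear_compose_sub T F)
  have ex1: "\<exists>!x. x - E x = y" for y
    using contraction_imp_bij_id_minus[OF E c(1,2)] close by (simp add: E_def)
  define S where "S y = (THE x. x - E x = y)" for y
  have S: "S y - E (S y) = y" for y
    unfolding S_def using theI'[OF ex1] by blast
  have S_eq: "S y = x" if "x - E x = y" for x y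
    using ex1 S that by blast
  have linS: "linear S"
    by (rule linearI; rule S_eq)
       (use S in \<open>simp_all add: linear_add[OF E] linear_scale[OF E] flip: scaleR_diff_right\<close>,
        metis (no_types) S add_diff_add)
  define L where "L x = x - S (F x)" for x
  have linSF: "linear (\<lambda>x. S (F x))"
    using linear_compose[OF F linS] by (simp add: o_def)
  have L: "linear L"
    unfolding L_def by (intro linear_compose_sub linSF linear_ident)
  have SFV: "S (F x) \<in> span (S ` B)" for x
    using rng linear_span_image[OF linS, of B] by blast
  have "span (S ` B) \<subseteq> L ` span (S ` B)"
  proof (rule linear_inj_on_span_imp_surj[OF L])
    show "finite (S ` B)" using fin by simp
    show "L ` span (S ` B) \<subseteq> span (S ` B)"
      unfolding L_def using SFV by (auto intro: span_diff)
    fix x assume "L x = 0"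
    then have "x = S (F x)" by (simp add: L_def)
    then have "x - E x = F x" using S by metis
    then show "x = 0" using inj by (simp add: E_def)
  qed
  \<comment> \<open>The equation x - S (F x) = S y is solved by x = S y + v with v in the
    finite-dimensional span; this is what remains for v.\<close>
  then obtain v where v: "L v = S (F (S y))"
    using SFV by (metis imageE subsetD)
  have "S (F (S y + v)) = v"
    using v by (simp add: L_def linear_add[OF F] linear_add[OF linS] algebra_simps)
  then have "v - E v = F (S y + v)"
    using S by metis
  then have "(S y + v) - T (S y + v) = y"
    using S[of y] by (simp add: E_def linear_add[OF F] linear_add[OF T] algebra_simps)
        (metis add.assoc add.commute)
  then show ?thesis by blast
qed

text \<open>Degenerate kernels, that is, finite sums of products of a function of each variable. The
  inductive form lets closure under products, continuity and finite rank be proved by rule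
  induction.\<close>

inductive_set separable_kernels :: "'a::t2_space set \<Rightarrow> ('a \<times> 'a \<Rightarrow> real) set" for S where
  product: "continuous_on S a \<Longrightarrow> continuous_on S b \<Longrightarrow> (\<lambda>p. a (fst p) * b (snd p)) \<in> separable_kernels S"
| add: "f \<in> separable_kernels S \<Longrightarrow> g \<in> separable_kernels S \<Longrightarrow> (\<lambda>p. f p + g p) \<in> separable_kernels S"

lemma separable_kernels_mult:
  assumes "f \<in> separable_kernels S" "g \<in> separable_kernels S"
  shows "(\<lambda>p. f p * g p) \<in> separable_kernels S"
  using assms(1)
proof induction
  case (product a b)
  show ?case using assms(2)
  proof induction
    case (product a' b')
    have "(\<lambda>p. (a (fst p) * a' (fst p)) * (b (snd p) * b' (snd p))) \<in> separable_kernels S"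
      by (intro separable_kernels.product[where a = "\<lambda>x. a x * a' x" and b = "\<lambda>x. b x * b' x"]
          continuous_intros product \<open>continuous_on S a\<close> \<open>continuous_on S b\<close>)
    then show ?case by (simp add: mult_ac)
  next
    case (add f g)
    then show ?case using separable_kernels.add by (fastforce simp: distrib_left)
  qed
next
  case (add f g)
  then show ?case using separable_kernels.add by (fastforce simp: distrib_right)
qed

text \<open>Stone-Weierstrass on \<open>S \<times> S\<close>. Two pairs differ in some coordinate,
  and a product whose other factor is 1 separates them.\<close>

lemma separable_kernels_dense:
  fixes n :: "'a::t2_space \<times> 'a \<Rightarrow> real"
  assumes S: "compact S" and n: "continuous_on (S \<times> S) n" and "e > 0"
    and sep: "\<And>x y. x \<noteq> y \<Longrightarrow> \<exists>f :: 'a \<Rightarrow> real. continuous_on S f \<and> f x \<noteq> f y"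
  obtains k where "k \<in> separable_kernels S" "\<And>p. p \<in> S \<times> S \<Longrightarrow> \<bar>n p - k p\<bar> < e"
proof -
  interpret function_ring_on "separable_kernels S" "S \<times> S"
  proof
    show "compact (S \<times> S)" using S by (simp add: compact_Times)
    show "continuous_on (S \<times> S) f" if "f \<in> separable_kernels S" for f
      using that
    proof induction
      case (product a b)
      then show ?case
        by (auto intro!: continuous_on_mult continuous_on_compose2[of S a] continuous_on_compose2[of S b]
            continuous_on_fst continuous_on_snd continuous_on_id)
    qed (auto intro: continuous_intros)
    show "(\<lambda>_. c) \<in> separable_kernels S" for c
      using separable_kernels.product[of S "\<lambda>_. c" "\<lambda>_. 1"] by (simp add: continuous_intros)
    show "\<exists>f\<in>separable_kernels S. f x \<noteq> f y" if "x \<noteq> y" for x y :: "'a \<times> 'a"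
    proof (cases "fst x = fst y")
      case True
      then have "snd x \<noteq> snd y" using that by (simp add: prod_eq_iff)
      then obtain f :: "'a \<Rightarrow> real" where f: "continuous_on S f" "f (snd x) \<noteq> f (snd y)"
        using sep by blast
      then have "(\<lambda>p. 1 * f (snd p)) \<in> separable_kernels S"
        by (intro separable_kernels.product[where a = "\<lambda>_. 1" and b = f] continuous_on_const)
      then show ?thesis using f by (intro bexI) auto
    next
      case False
      then obtain f :: "'a \<Rightarrow> real" where f: "continuous_on S f" "f (fst x) \<noteq> f (fst y)"
        using sep by blast
      then have "(\<lambda>p. f (fst p) * 1) \<in> separable_kernels S"
        by (intro separable_kernels.product[where b = "\<lambda>_. 1" and a = f] continuous_on_const)
      then show ?thesis using f by (intro bexI) auto
    qed
  qed (auto intro: separable_kernels.add separable_kernels_mult)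
  show ?thesis
    using Stone_Weierstrass_basic[OF n \<open>e > 0\<close>] that by blast
qed

section \<open>Continuous functions and integrals on the parameter domain\<close>

definition J_set :: "nat \<Rightarrow> (nat \<times> real) set" where
  "J_set m = {1..m} \<times> {0..2*pi}"

definition J_integral :: "nat \<Rightarrow> (nat \<times> real \<Rightarrow> real) \<Rightarrow> real" where
  "J_integral m \<phi> = (\<Sum>k\<in>{1..m}. integral {0..2*pi} (\<lambda>t. \<phi> (k, t)))"

lemma compact_J_set: "compact (J_set m)"
  unfolding J_set_def by (intro compact_Times) (auto simp: finite_imp_compact)

lemma J_slice_integrable:
  fixes \<phi> :: "nat \<times> real \<Rightarrow> real"
  assumes "continuous_on (J_set m) \<phi>" "k \<in> {1..m}"
  shows "(\<lambda>t. \<phi> (k, t)) integrable_on {0..2*pi}"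
  by (intro integrable_continuous_interval continuous_on_compose2[OF assms(1)] continuous_intros)
     (use assms(2) in \<open>auto simp: J_set_def\<close>)

lemma J_integral_add:
  "continuous_on (J_set m) \<phi> \<Longrightarrow> continuous_on (J_set m) \<psi> \<Longrightarrow>
    J_integral m (\<lambda>x. \<phi> x + \<psi> x) = J_integral m \<phi> + J_integral m \<psi>"
  unfolding J_integral_def
  by (simp add: integral_add J_slice_integrable sum.distrib)

lemma J_integral_diff:
  "continuous_on (J_set m) \<phi> \<Longrightarrow> continuous_on (J_set m) \<psi> \<Longrightarrow>
    J_integral m (\<lambda>x. \<phi> x - \<psi> x) = J_integral m \<phi> - J_integral m \<psi>"
  unfolding J_integral_def
  by (simp add: integral_diff J_slice_integrable sum_subtractf)

lemma J_integral_cmult: "J_integral m (\<lambda>x. c * \<phi> x) = c * J_integral m \<phi>"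
  unfolding J_integral_def by (simp add: sum_distrib_left)

lemma J_integral_cong:
  "(\<And>x. x \<in> J_set m \<Longrightarrow> \<phi> x = \<psi> x) \<Longrightarrow> J_integral m \<phi> = J_integral m \<psi>"
  unfolding J_integral_def J_set_def by (intro sum.cong integral_cong) auto

lemma J_integral_bound:
  assumes "continuous_on (J_set m) \<phi>" "\<And>x. x \<in> J_set m \<Longrightarrow> \<bar>\<phi> x\<bar> \<le> B"
  shows "\<bar>J_integral m \<phi>\<bar> \<le> real m * (2 * pi * B)"
proof -
  have "\<bar>integral {0..2*pi} (\<lambda>t. \<phi> (k, t))\<bar> \<le> B * (2 * pi - 0)" if "k \<in> {1..m}" for k
    using assms that
    by (intro integral_bound[where 'a = real, simplified real_norm_def] continuous_on_compose2[OF assms(1)] continuous_intros)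
       (auto simp: J_set_def)
  then have "\<bar>J_integral m \<phi>\<bar> \<le> (\<Sum>k\<in>{1..m}. B * (2 * pi))"
    unfolding J_integral_def by (intro order_trans[OF sum_abs] sum_mono) auto
  then show ?thesis by (simp add: mult_ac)
qed

text \<open>Approximating \<open>n\<close> uniformly by a degenerate kernel brings the integral
  operator within norm 1/2 of one with finite rank; the abstract alternative then applies.\<close>

theorem fredholm_alternative_J:
  fixes n :: "(nat \<times> real) \<times> (nat \<times> real) \<Rightarrow> real"
  assumes m: "m \<ge> 1" and n: "continuous_on (J_set m \<times> J_set m) n"
    and inj: "\<And>\<phi>. continuous_on (J_set m) \<phi> \<Longrightarrow>
       (\<And>x. x \<in> J_set m \<Longrightarrow> \<phi> x = J_integral m (\<lambda>y. n (x, y) * \<phi> y)) \<Longrightarrow>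
       (\<And>x. x \<in> J_set m \<Longrightarrow> \<phi> x = 0)"
    and b: "continuous_on (J_set m) b"
  shows "\<exists>\<phi>. continuous_on (J_set m) \<phi> \<and>
            (\<forall>x\<in>J_set m. \<phi> x - J_integral m (\<lambda>y. n (x, y) * \<phi> y) = b x)"
proof -
  let ?S = "J_set m"
  \<comment> \<open>The type of bounded continuous functions is complete only over a metric space, which the type
    \<open>nat\<close> is not. Therefore functions on J are extended to the plane, by linear interpolation in the curve index.\<close>
  define clamp where "clamp s = max 0 (min s (2*pi))" for s :: real
  define ext where "ext f x = (\<Sum>i\<in>{1..m}. max 0 (1 - \<bar>fst x - real i\<bar>) * f (i, clamp (snd x)))"
    for f :: "nat \<times> real \<Rightarrow> real" and x :: "real \<times> real"
  define emb where "emb y = (real (fst y), snd y)" for y :: "nat \<times> real"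
  have clamp_S: "i \<in> {1..m} \<Longrightarrow> (i, clamp s) \<in> ?S" for i s
    by (auto simp: clamp_def J_set_def)
  have clamp_cont: "continuous_on A clamp" for A
    unfolding clamp_def by (intro continuous_intros)
  have ext_cont: "continuous_on UNIV (ext f)" if f: "continuous_on ?S f" for f
    unfolding ext_def
    by (intro continuous_intros continuous_on_compose2[OF f] continuous_on_compose2[OF clamp_cont[of UNIV]])
       (auto simp: clamp_S)
  have ext_bound: "\<bar>ext f x\<bar> \<le> real m * B" if B: "\<And>y. y \<in> ?S \<Longrightarrow> \<bar>f y\<bar> \<le> B" for f x B
  proof -
    have "\<bar>max 0 (1 - \<bar>fst x - real i\<bar>) * f (i, clamp (snd x))\<bar> \<le> 1 * B" if "i \<in> {1..m}" for i
      unfolding abs_mult using B[OF clamp_S[OF that]] by (intro mult_mono) auto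
    then have "\<bar>ext f x\<bar> \<le> (\<Sum>i\<in>{1..m}. 1 * B)"
      unfolding ext_def by (intro order_trans[OF sum_abs] sum_mono) auto
    then show ?thesis by simp
  qed
  have ext_emb: "ext f (emb y) = f y" if y: "y \<in> ?S" for f y
  proof -
    have "ext f (emb y) = (\<Sum>i\<in>{1..m}. if i = fst y then f y else 0)"
      unfolding ext_def
    proof (rule sum.cong)
      fix i
      have "1 \<le> \<bar>real (fst y) - real i\<bar>" if "i \<noteq> fst y"
        using that by linarith
      then show "max 0 (1 - \<bar>fst (emb y) - real i\<bar>) * f (i, clamp (snd (emb y)))
          = (if i = fst y then f y else 0)"
        using y by (auto simp: emb_def clamp_def J_set_def)
    qed simp
    then show ?thesis using y by (auto simp: J_set_def)
  qed
  have ext_add: "ext (\<lambda>y. f y + g y) x = ext f x + ext g x" for f g x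
    by (simp add: ext_def distrib_left sum.distrib)
  have ext_diff: "ext (\<lambda>y. f y - g y) x = ext f x - ext g x" for f g x
    by (simp add: ext_def right_diff_distrib sum_subtractf)
  have ext_cmult: "ext (\<lambda>y. c * f y) x = c * ext f x" for c f x
    by (simp add: ext_def sum_distrib_left mult_ac)
  have ext_multr: "ext (\<lambda>y. f y * c) x = c * ext f x" for c f x
    by (simp add: ext_def sum_distrib_left mult_ac)
  have ext_cong: "ext f x = ext g x" if "\<And>y. y \<in> ?S \<Longrightarrow> f y = g y" for f g x
    unfolding ext_def using that clamp_S by (intro sum.cong) auto
  have ext_bcontfun: "ext f \<in> bcontfun" if f: "continuous_on ?S f" for f
  proof -
    have "bounded (f ` ?S)"
      using compact_continuous_image[OF f compact_J_set] compact_imp_bounded by blast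
    then obtain B where "\<And>y. y \<in> ?S \<Longrightarrow> \<bar>f y\<bar> \<le> B"
      by (auto simp: bounded_iff)
    then have "bounded (range (ext f))"
      using ext_bound[of f B] by (auto simp: bounded_iff)
    then show ?thesis using ext_cont[OF f] by (simp add: bcontfun_def)
  qed
  have "continuous_on UNIV real"
    by (simp add: continuous_on_open_vimage open_discrete)
  from continuous_on_compose2[OF this continuous_on_fst[OF continuous_on_id] subset_UNIV]
  have real_fst_cont: "continuous_on A (\<lambda>x. real (fst x))" for A :: "(nat \<times> real) set" .
  then have emb_cont: "continuous_on A emb" for A
    unfolding emb_def by (intro continuous_intros)
  have bc_cont: "continuous_on A (\<lambda>y. apply_bcontfun \<phi> (emb y))" for A and \<phi> :: "(real \<times> real) \<Rightarrow>\<^sub>C real"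
    by (rule continuous_on_compose2[OF continuous_on_apply_bcontfun emb_cont subset_UNIV])
  have prod_cont: "continuous_on ?S (\<lambda>y. k (x, y) * \<phi> y)"
    if "continuous_on (?S \<times> ?S) k" "continuous_on ?S \<phi>" "x \<in> ?S" for k x and \<phi> :: "nat \<times> real \<Rightarrow> real"
    using that by (intro continuous_intros continuous_on_compose2[OF that(1)]) auto
  have J_cont: "continuous_on ?S (\<lambda>x. J_integral m (\<lambda>y. k (x, y) * \<phi> y))"
    if k: "continuous_on (?S \<times> ?S) k" and \<phi>: "continuous_on ?S \<phi>" for k and \<phi> :: "nat \<times> real \<Rightarrow> real"
    unfolding J_integral_def
  proof (rule continuous_on_sum)
    fix i assume i: "i \<in> {1..m}"
    have "continuous_on (?S \<times> cbox 0 (2*pi)) (\<lambda>(x, t). k (x, (i, t)) * \<phi> (i, t))"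
      unfolding split_beta using i
      by (intro continuous_intros continuous_on_compose2[OF k] continuous_on_compose2[OF \<phi>])
         (auto simp: J_set_def)
    from integral_continuous_on_param[OF this]
    show "continuous_on ?S (\<lambda>x. integral {0..2*pi} (\<lambda>t. k (x, i, t) * \<phi> (i, t)))"
      by simp
  qed
  define T where "T k \<phi> = Bcontfun (ext (\<lambda>x. J_integral m (\<lambda>y. k (x, y) * apply_bcontfun \<phi> (emb y))))"
    for k and \<phi> :: "(real \<times> real) \<Rightarrow>\<^sub>C real"
  have T_apply: "apply_bcontfun (T k \<phi>) = ext (\<lambda>x. J_integral m (\<lambda>y. k (x, y) * apply_bcontfun \<phi> (emb y)))"
    if "continuous_on (?S \<times> ?S) k" for k \<phi>
    unfolding T_def using ext_bcontfun[OF J_cont[OF that bc_cont]]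
    by (subst Bcontfun_inverse) auto
  have T_linear: "linear (T k)" if k: "continuous_on (?S \<times> ?S) k" for k
  proof
    fix \<phi> \<psi> :: "(real \<times> real) \<Rightarrow>\<^sub>C real" and c :: real
    show "T k (\<phi> + \<psi>) = T k \<phi> + T k \<psi>"
    proof (rule bcontfun_eqI)
      fix x
      have "ext (\<lambda>x. J_integral m (\<lambda>y. k (x, y) * apply_bcontfun (\<phi> + \<psi>) (emb y))) x =
         ext (\<lambda>x. J_integral m (\<lambda>y. k (x, y) * apply_bcontfun \<phi> (emb y))
                + J_integral m (\<lambda>y. k (x, y) * apply_bcontfun \<psi> (emb y))) x"
        by (rule ext_cong) (simp add: distrib_left J_integral_add prod_cont[OF k bc_cont])
      then show "apply_bcontfun (T k (\<phi> + \<psi>)) x = apply_bcontfun (T k \<phi> + T k \<psi>) x"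
        by (simp add: T_apply k ext_add)
    qed
    show "T k (c *\<^sub>R \<phi>) = c *\<^sub>R T k \<phi>"
      by (rule bcontfun_eqI)
         (simp add: T_apply k mult.left_commute[of _ c] J_integral_cmult ext_cmult)
  qed
  \<comment> \<open>One factor m * 2 * pi comes from integrating over \<open>J\<close>, the other
    factor m from the sum of m hat functions in \<open>ext\<close>; \<open>e\<close> makes the total
    bound 1/2.\<close>
  define e where "e = 1 / (real m * (real m * (2 * pi) * 2))"
  have e: "e > 0" "real m * (real m * (2 * pi * e)) = 1 / 2"
    using m by (auto simp: e_def)
  have sep: "\<exists>f :: nat \<times> real \<Rightarrow> real. continuous_on ?S f \<and> f x \<noteq> f y" if "x \<noteq> y" for x y
  proof (cases "fst x = fst y")
    case True
    then show ?thesis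
      using that by (intro exI[of _ snd]) (auto intro: continuous_intros simp: prod_eq_iff)
  next
    case False
    have "continuous_on ?S (\<lambda>x. real (fst x))" by (rule real_fst_cont)
    then show ?thesis using False by (intro exI[of _ "\<lambda>x. real (fst x)"]) auto
  qed
  obtain k where k: "k \<in> separable_kernels ?S" "\<And>p. p \<in> ?S \<times> ?S \<Longrightarrow> \<bar>n p - k p\<bar> < e"
    using separable_kernels_dense[OF compact_J_set n e(1) sep] by blast
  have fin_rank: "continuous_on (?S \<times> ?S) k \<and> (\<exists>B. finite B \<and> (\<forall>\<phi>. T k \<phi> \<in> span B))"
    using k(1)
  proof induction
    case (product a b)
    have cont: "continuous_on (?S \<times> ?S) (\<lambda>p. a (fst p) * b (snd p))"
      using product
      by (auto intro!: continuous_on_mult continuous_on_compose2[of ?S a] continuous_on_compose2[of ?S b]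
            continuous_on_fst continuous_on_snd continuous_on_id)
    let ?v = "Bcontfun (ext a)"
    have "T (\<lambda>p. a (fst p) * b (snd p)) \<phi> = J_integral m (\<lambda>y. b y * apply_bcontfun \<phi> (emb y)) *\<^sub>R ?v" for \<phi>
      by (rule bcontfun_eqI)
         (simp add: T_apply[OF cont] Bcontfun_inverse ext_bcontfun product mult.assoc J_integral_cmult
            ext_multr)
    then have "\<forall>\<phi>. T (\<lambda>p. a (fst p) * b (snd p)) \<phi> \<in> span {?v}"
      by (auto intro: span_mul span_base)
    then show ?case using cont by blast
  next
    case (add f g)
    then obtain B C where BC: "finite B" "finite C" "\<And>\<phi>. T f \<phi> \<in> span B" "\<And>\<phi>. T g \<phi> \<in> span C"
      by blast
    have cont: "continuous_on (?S \<times> ?S) (\<lambda>p. f p + g p)"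
      using add by (intro continuous_intros) auto
    have "T (\<lambda>p. f p + g p) \<phi> = T f \<phi> + T g \<phi>" for \<phi>
    proof (rule bcontfun_eqI)
      fix x
      have "ext (\<lambda>x. J_integral m (\<lambda>y. (f (x, y) + g (x, y)) * apply_bcontfun \<phi> (emb y))) x =
         ext (\<lambda>x. J_integral m (\<lambda>y. f (x, y) * apply_bcontfun \<phi> (emb y))
                + J_integral m (\<lambda>y. g (x, y) * apply_bcontfun \<phi> (emb y))) x"
        using add by (intro ext_cong) (simp add: distrib_right J_integral_add prod_cont[OF _ bc_cont])
      then show "apply_bcontfun (T (\<lambda>p. f p + g p) \<phi>) x = apply_bcontfun (T f \<phi> + T g \<phi>) x"
        using add by (simp add: T_apply[OF cont] T_apply ext_add)
    qed
    moreover have "T f \<phi> \<in> span (B \<union> C)" "T g \<phi> \<in> span (B \<union> C)" for \<phi>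
      using BC span_mono[of B "B \<union> C"] span_mono[of C "B \<union> C"] by auto
    ultimately have "\<forall>\<phi>. T (\<lambda>p. f p + g p) \<phi> \<in> span (B \<union> C)"
      by (simp add: span_add)
    then show ?case using cont BC by blast
  qed
  then obtain B where B: "finite B" "\<And>\<phi>. T k \<phi> \<in> span B" and k_cont: "continuous_on (?S \<times> ?S) k"
    by blast
  have close: "norm (T n \<phi> - T k \<phi>) \<le> 1 / 2 * norm \<phi>" for \<phi>
  proof (rule norm_bound)
    fix z
    let ?d = "\<lambda>x. J_integral m (\<lambda>y. n (x, y) * apply_bcontfun \<phi> (emb y)) - J_integral m (\<lambda>y. k (x, y) * apply_bcontfun \<phi> (emb y))"
    have "\<bar>?d x\<bar> \<le> real m * (2 * pi * (e * norm \<phi>))" if x: "x \<in> ?S" for x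
    proof -
      have "\<bar>J_integral m (\<lambda>y. n (x, y) * apply_bcontfun \<phi> (emb y) - k (x, y) * apply_bcontfun \<phi> (emb y))\<bar>
          \<le> real m * (2 * pi * (e * norm \<phi>))"
      proof (rule J_integral_bound)
        show "continuous_on ?S (\<lambda>y. n (x, y) * apply_bcontfun \<phi> (emb y) - k (x, y) * apply_bcontfun \<phi> (emb y))"
          by (intro continuous_intros prod_cont n k_cont bc_cont x)
        fix y assume y: "y \<in> ?S"
        have "\<bar>n (x, y) * apply_bcontfun \<phi> (emb y) - k (x, y) * apply_bcontfun \<phi> (emb y)\<bar>
            = \<bar>n (x, y) - k (x, y)\<bar> * norm (apply_bcontfun \<phi> (emb y))"
          by (simp add: abs_mult flip: left_diff_distrib)
        also have "\<dots> \<le> e * norm \<phi>"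
          using k(2)[of "(x, y)"] x y e(1) by (intro mult_mono norm_bounded) (auto intro: less_imp_le)
        finally show "\<bar>n (x, y) * apply_bcontfun \<phi> (emb y) - k (x, y) * apply_bcontfun \<phi> (emb y)\<bar> \<le> e * norm \<phi>" .
      qed
      then show ?thesis
        by (simp add: J_integral_diff prod_cont[OF n bc_cont x] prod_cont[OF k_cont bc_cont x])
    qed
    then have "\<bar>ext ?d z\<bar> \<le> real m * (real m * (2 * pi * (e * norm \<phi>)))"
      by (rule ext_bound)
    also have "\<dots> = real m * (real m * (2 * pi * e)) * norm \<phi>" by (simp add: mult_ac)
    finally show "norm (apply_bcontfun (T n \<phi> - T k \<phi>) z) \<le> 1 / 2 * norm \<phi>"
      by (simp only: e(2)) (simp add: T_apply n k_cont ext_diff)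
  qed
  \<comment> \<open>\<open>T n \<phi>\<close> depends only on the values of \<phi> on the embedded
    copy of \<open>J\<close>. These vanish by the injectivity hypothesis, and then \<phi> =
    \<open>T n \<phi>\<close> vanishes on the whole plane.\<close>
  have inj': "\<phi> = 0" if eq: "\<phi> = T n \<phi>" for \<phi>
  proof -
    have val: "apply_bcontfun \<phi> = ext (\<lambda>x. J_integral m (\<lambda>y. n (x, y) * apply_bcontfun \<phi> (emb y)))"
      using eq T_apply[OF n] by metis
    have z: "apply_bcontfun \<phi> (emb x) = 0" if "x \<in> ?S" for x
      by (rule inj[OF bc_cont _ that]) (rule trans[OF fun_cong[OF val] ext_emb])
    have "J_integral m (\<lambda>y. n (x, y) * apply_bcontfun \<phi> (emb y)) = J_integral m (\<lambda>_. 0)" for x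
      by (rule J_integral_cong) (simp add: z)
    then have J0: "J_integral m (\<lambda>y. n (x, y) * apply_bcontfun \<phi> (emb y)) = 0" for x
      by (simp add: J_integral_def)
    have "apply_bcontfun \<phi> x = ext (\<lambda>_. 0) x" for x
      by (rule trans[OF fun_cong[OF val] ext_cong]) (rule J0)
    then have "apply_bcontfun \<phi> x = 0" for x
      by (simp add: ext_def)
    then show ?thesis by (intro bcontfun_eqI) simp
  qed
  have "\<exists>\<phi>. \<phi> - T n \<phi> = Bcontfun (ext b)"
    by (rule fredholm_finite_rank_perturbation[OF T_linear[OF n] T_linear[OF k_cont] _ _ close B inj']) auto
  then obtain \<phi> where \<phi>: "\<phi> - T n \<phi> = Bcontfun (ext b)"
    by blast
  have "apply_bcontfun \<phi> (emb x) - J_integral m (\<lambda>y. n (x, y) * apply_bcontfun \<phi> (emb y)) = b x"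
    if "x \<in> ?S" for x
  proof -
    have "apply_bcontfun (\<phi> - T n \<phi>) (emb x) = b x"
      using \<phi> by (simp add: Bcontfun_inverse ext_bcontfun b ext_emb that)
    then show ?thesis
      by (simp add: T_apply n ext_emb that)
  qed
  then show ?thesis using bc_cont by blast
qed

section \<open>Smooth closed curves\<close>

locale smooth_loop =
  fixes g g1 g2 :: "real \<Rightarrow> complex"
  assumes d1: "\<And>t. (g has_vector_derivative g1 t) (at t)"
    and d2: "\<And>t. (g1 has_vector_derivative g2 t) (at t)"
    and g2_cont: "continuous_on UNIV g2"
    and per: "\<And>t. g (t + 2 * pi) = g t"
    and nz: "\<And>t. g1 t \<noteq> 0"
    and inj: "inj_on g {0..<2*pi}"
begin

lemma g_cont: "continuous_on S g" and g1_cont: "continuous_on S g1"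
  by (meson continuous_at_imp_continuous_on d1 d2 has_vector_derivative_continuous)+

lemma g1_per: "g1 (t + 2 * pi) = g1 t"
proof -
  have "((\<lambda>t. t + 2 * pi) has_vector_derivative 1) (at t)"
    by (auto intro!: derivative_eq_intros)
  from vector_diff_chain_at[OF this d1]
  have "(g has_vector_derivative g1 (t + 2 * pi)) (at t)"
    by (simp add: o_def per)
  then show ?thesis
    using d1 vector_derivative_unique_at by blast
qed

lemma g_per_int: "g (t + 2 * pi * of_int n) = g t"
proof -
  interpret periodic_fun_simple g "2 * pi"
    by unfold_locales (rule per)
  show ?thesis using plus_of_int[of t n] by (simp add: mult.commute)
qed

lemma g1_per_int: "g1 (t + 2 * pi * of_int n) = g1 t"
proof -
  interpret periodic_fun_simple g1 "2 * pi"
    by unfold_locales (rule g1_per)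
  show ?thesis using plus_of_int[of t n] by (simp add: mult.commute)
qed

lemma g_eq_imp:
  assumes "g s = g t"
  obtains n :: int where "t = s + 2 * pi * of_int n"
proof -
  define red where "red x = x + 2 * pi * of_int (- \<lfloor>x / (2 * pi)\<rfloor>)" for x :: real
  have red: "red x \<in> {0..<2*pi}" for x
  proof -
    have "of_int \<lfloor>x / (2 * pi)\<rfloor> * (2 * pi) \<le> x" "x < (of_int \<lfloor>x / (2 * pi)\<rfloor> + 1) * (2 * pi)"
      by (rule floor_divide_lower floor_divide_upper; simp)+
    then show ?thesis by (simp add: red_def algebra_simps)
  qed
  have "g (red s) = g (red t)"
    unfolding red_def using assms by (metis g_per_int)
  then have "red s = red t"
    using inj red by (meson inj_onD)
  then have "t = s + 2 * pi * of_int (\<lfloor>t / (2 * pi)\<rfloor> - \<lfloor>s / (2 * pi)\<rfloor>)"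
    by (simp add: red_def algebra_simps)
  then show ?thesis using that by blast
qed

text \<open>Periodicity carries injectivity over from one half-open period to windows placed
  anywhere. Arcs that cross the parameter 0 can thus be treated like all others.\<close>

lemma g_eq_near: "g s = g t \<Longrightarrow> \<bar>t - s\<bar> < 2 * pi \<Longrightarrow> s = t"
proof -
  assume eq: "g s = g t" and lt: "\<bar>t - s\<bar> < 2 * pi"
  obtain n :: int where n: "t = s + 2 * pi * of_int n"
    using g_eq_imp[OF eq] .
  then have "2 * pi * \<bar>of_int n\<bar> < 2 * pi * 1"
    using lt by (simp add: abs_mult)
  then have "\<bar>real_of_int n\<bar> < 1"
    by (simp only: mult_less_cancel_left_pos pi_gt_zero zero_less_numeral mult_pos_pos)
  then have "n = 0" by linarith
  then show ?thesis using n by simp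
qed

text \<open>Hadamard's lemma: \<open>g t - g s = (t - s) secant s t\<close> and \<open>g1 t = secant s t + (t - s) secant_rem s t\<close>,
  so that the singular part of the Cauchy kernel \<open>g1 t / (g t - g s)\<close> is the real number \<open>1 / (t - s)\<close>.\<close>

definition secant :: "real \<Rightarrow> real \<Rightarrow> complex" where
  "secant s t = integral {0..1} (\<lambda>x. g1 (s + x * (t - s)))"

definition secant_rem :: "real \<Rightarrow> real \<Rightarrow> complex" where
  "secant_rem s t = integral {0..1} (\<lambda>x. x *\<^sub>R g2 (s + x * (t - s)))"

lemma line_derivative: "((\<lambda>x. s + x * (t - s)) has_vector_derivative (t - s)) (at x)"
  by (auto intro!: derivative_eq_intros simp: has_real_derivative_iff_has_vector_derivative[symmetric])

lemma secant_integrable: "(\<lambda>x. g1 (s + x * (t - s))) integrable_on {0..1}"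
  by (intro integrable_continuous_interval continuous_on_compose2[OF g1_cont[of UNIV]] continuous_intros) auto

lemma secant_rem_integrable: "(\<lambda>x. x *\<^sub>R g2 (s + x * (t - s))) integrable_on {0..1}"
  by (intro integrable_continuous_interval continuous_intros continuous_on_compose2[OF g2_cont]) auto

lemma secant_eq: "g t - g s = (t - s) *\<^sub>R secant s t"
proof -
  have "((\<lambda>x. g (s + x * (t - s))) has_vector_derivative (t - s) *\<^sub>R g1 (s + x * (t - s))) (at x)" for x
    using vector_diff_chain_at[OF line_derivative d1] by (simp add: o_def)
  then have "((\<lambda>x. (t - s) *\<^sub>R g1 (s + x * (t - s))) has_integral (g (s + 1 * (t - s)) - g (s + 0 * (t - s)))) {0..1}"
    by (intro fundamental_theorem_of_calculus) (auto intro: has_vector_derivative_at_within)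
  then show ?thesis
    using secant_integrable unfolding secant_def by (simp add: integral_unique flip: integral_cmul)
qed

lemma secant_rem_eq: "g1 t = secant s t + (t - s) *\<^sub>R secant_rem s t"
proof -
  have D: "((\<lambda>x. x *\<^sub>R g1 (s + x * (t - s))) has_vector_derivative
        g1 (s + x * (t - s)) + (t - s) *\<^sub>R (x *\<^sub>R g2 (s + x * (t - s)))) (at x)" for x
  proof -
    have "((\<lambda>x. g1 (s + x * (t - s))) has_vector_derivative (t - s) *\<^sub>R g2 (s + x * (t - s))) (at x)"
      using vector_diff_chain_at[OF line_derivative d2] by (simp add: o_def)
    from has_vector_derivative_scaleR[OF DERIV_ident this]
    show ?thesis by (simp add: add.commute mult.commute)
  qed
  have 1: "((\<lambda>x. g1 (s + x * (t - s)) + (t - s) *\<^sub>R (x *\<^sub>R g2 (s + x * (t - s)))) has_integral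
        (1 *\<^sub>R g1 (s + 1 * (t - s)) - 0 *\<^sub>R g1 (s + 0 * (t - s)))) {0..1}"
    by (intro fundamental_theorem_of_calculus has_vector_derivative_at_within[OF D]) simp
  have 2: "((\<lambda>x. g1 (s + x * (t - s)) + (t - s) *\<^sub>R (x *\<^sub>R g2 (s + x * (t - s)))) has_integral
        (secant s t + (t - s) *\<^sub>R secant_rem s t)) {0..1}"
    unfolding secant_def secant_rem_def
    by (intro has_integral_add has_integral_cmul integrable_integral secant_integrable secant_rem_integrable)
  show ?thesis
    using has_integral_unique[OF 1 2] by simp
qed

lemma secant_diag: "secant s s = g1 s"
  by (simp add: secant_def)

text \<open>On the diagonal the secant is the derivative, elsewhere it is a nonzero chord divided by
  \<open>t - s\<close>. So it may be a denominator on the whole strip.\<close>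

lemma secant_nonzero: "\<bar>t - s\<bar> < 2 * pi \<Longrightarrow> secant s t \<noteq> 0"
  using secant_eq[of t s] g_eq_near[of s t] secant_diag nz by (cases "s = t") auto

lemma secant_cont: "continuous_on U (\<lambda>p. secant (fst p) (snd p))"
proof -
  have "continuous_on (U \<times> cbox 0 1) (\<lambda>(p, x). g1 (fst p + x * (snd p - fst p)))"
    unfolding split_beta
    by (intro continuous_intros continuous_on_compose2[OF g1_cont[of UNIV]]) auto
  from integral_continuous_on_param[OF this] show ?thesis
    unfolding secant_def by simp
qed

lemma secant_rem_cont: "continuous_on U (\<lambda>p. secant_rem (fst p) (snd p))"
proof -
  have "continuous_on (U \<times> cbox 0 1) (\<lambda>(p, x). x *\<^sub>R g2 (fst p + x * (snd p - fst p)))"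
    unfolding split_beta
    by (intro continuous_intros continuous_on_compose2[OF g2_cont]) auto
  from integral_continuous_on_param[OF this] show ?thesis
    unfolding secant_rem_def by simp
qed

lemma cauchy_kernel_eq:
  assumes "s \<noteq> t" "\<bar>t - s\<bar> < 2 * pi"
  shows "g1 t / (g t - g s) = of_real (1 / (t - s)) + secant_rem s t / secant s t"
  using assms secant_nonzero[OF assms(2)] unfolding secant_eq secant_rem_eq[of t s]
  by (simp add: scaleR_conv_of_real field_simps)

text \<open>This is pi times the kernel \<open>N\<close> with its removable singularity filled in;
  the diagonal value equals Im (g2 s / (2 * g1 s)). Points are compared instead of parameters, since
  parameters that differ by a period are singular as well.\<close>

definition neumann_kernel :: "real \<Rightarrow> real \<Rightarrow> real" where
  "neumann_kernel s t = (if g s = g t then Im (secant_rem s s / secant s s) else Im (g1 t / (g t - g s)))"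

lemma neumann_kernel_window:
  assumes "\<bar>t - 2 * pi * of_int n - s\<bar> < 2 * pi"
  shows "neumann_kernel s t = Im (secant_rem s (t - 2 * pi * of_int n) / secant s (t - 2 * pi * of_int n))"
proof -
  define t' where "t' = t - 2 * pi * of_int n"
  have t: "g t = g t'" "g1 t = g1 t'"
    using g_per_int[of t "-n"] g1_per_int[of t "-n"] by (simp_all add: t'_def)
  show ?thesis
  proof (cases "s = t'")
    case True
    then show ?thesis using t by (simp add: neumann_kernel_def t'_def)
  next
    case False
    then have "g s \<noteq> g t'" using g_eq_near assms t'_def by blast
    then have "neumann_kernel s t = Im (g1 t' / (g t' - g s))"
      by (simp add: neumann_kernel_def t)
    then show ?thesis
      using cauchy_kernel_eq[of s t'] False assms unfolding t'_def[symmetric] by simp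
  qed
qed

text \<open>The open strips \<open>Wn n\<close> cover the plane, and on each of them, after a shift
  by n periods, the kernel is the imaginary part of a quotient of continuous functions with nonzero
  denominator.\<close>

lemma neumann_kernel_cont: "continuous_on UNIV (\<lambda>p. neumann_kernel (fst p) (snd p))"
proof -
  define Wn where "Wn n = {p :: real \<times> real. \<bar>snd p - 2 * pi * of_int n - fst p\<bar> < 2 * pi}" for n :: int
  have op: "open (Wn n)" for n
    unfolding Wn_def by (intro open_Collect_less continuous_intros)
  have "continuous_on (Wn n) (\<lambda>p. neumann_kernel (fst p) (snd p))" for n
  proof -
    define \<tau> where "\<tau> p = (fst p, snd p - 2 * pi * of_int n)" for p :: "real \<times> real"
    have \<tau>: "continuous_on (Wn n) \<tau>" unfolding \<tau>_def by (intro continuous_intros)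
    have "continuous_on (Wn n) (\<lambda>p. Im (secant_rem (fst (\<tau> p)) (snd (\<tau> p)) / secant (fst (\<tau> p)) (snd (\<tau> p))))"
      by (intro continuous_intros continuous_on_compose2[OF secant_cont[of UNIV] \<tau>]
            continuous_on_compose2[OF secant_rem_cont[of UNIV] \<tau>])
         (auto simp: \<tau>_def Wn_def intro!: secant_nonzero)
    then show ?thesis
      by (rule continuous_on_eq) (auto simp: \<tau>_def Wn_def neumann_kernel_window)
  qed
  then have "continuous_on (\<Union>n. Wn n) (\<lambda>p. neumann_kernel (fst p) (snd p))"
    using op by (intro continuous_on_open_UN) auto
  moreover have "(\<Union>n. Wn n) = UNIV"
  proof -
    have "p \<in> Wn \<lfloor>(snd p - fst p) / (2 * pi)\<rfloor>" for p
    proof -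
      define x where "x = snd p - fst p"
      have "of_int \<lfloor>x / (2 * pi)\<rfloor> * (2 * pi) \<le> x" "x < (of_int \<lfloor>x / (2 * pi)\<rfloor> + 1) * (2 * pi)"
        by (rule floor_divide_lower floor_divide_upper; simp)+
      then show ?thesis by (auto simp: Wn_def x_def algebra_simps abs_less_iff)
    qed
    then show ?thesis by blast
  qed
  ultimately show ?thesis by simp
qed

lemma neumann_kernel_bounded: "\<exists>C>0. \<forall>s\<in>{0..2*pi}. \<forall>t\<in>{0..2*pi}. \<bar>neumann_kernel s t\<bar> \<le> C"
proof -
  have "compact ((\<lambda>p. neumann_kernel (fst p) (snd p)) ` ({0..2*pi} \<times> {0..2*pi}))"
    by (intro compact_continuous_image continuous_on_subset[OF neumann_kernel_cont] compact_Times) auto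
  then obtain C where "\<And>p. p \<in> {0..2*pi} \<times> {0..2*pi} \<Longrightarrow> \<bar>neumann_kernel (fst p) (snd p)\<bar> \<le> C"
    by (force simp: bounded_iff dest: compact_imp_bounded)
  then show ?thesis
    by (intro exI[of _ "max C 1"]) (force simp: le_max_iff_disj)
qed

lemma Im_kernel_bounded:
  "\<exists>C>0. \<forall>s\<in>{0..2*pi}. \<forall>t\<in>{0..2*pi}. \<bar>Im (g1 t / (g t - g s))\<bar> \<le> C"
proof -
  obtain C where C: "C > 0" "\<And>s t. s\<in>{0..2*pi} \<Longrightarrow> t\<in>{0..2*pi} \<Longrightarrow> \<bar>neumann_kernel s t\<bar> \<le> C"
    using neumann_kernel_bounded by blast
  have "\<bar>Im (g1 t / (g t - g s))\<bar> \<le> C" if "s\<in>{0..2*pi}" "t\<in>{0..2*pi}" for s t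
    using C(1) C(2)[OF that] by (cases "g s = g t") (auto simp: neumann_kernel_def)
  then show ?thesis using C(1) by blast
qed

lemma g1_bounded: "\<exists>C>0. \<forall>t\<in>{0..2*pi}. norm (g1 t) \<le> C"
proof -
  have "bounded (g1 ` {0..2*pi})"
    by (intro compact_imp_bounded compact_continuous_image g1_cont) auto
  then show ?thesis by (auto simp: bounded_pos)
qed

text \<open>The constant is the minimum of the modulus of the secant over a compact set on which it
  has no zero. Increments up to pi reach every point of the curve and stay away from a full
  period.\<close>

lemma chord_arc_window:
  "\<exists>c>0. \<forall>s\<in>{0..2*pi}. \<forall>u\<in>{-pi..pi}. c * \<bar>u\<bar> \<le> norm (g (s + u) - g s)"
proof -
  let ?P = "{0..2*pi} \<times> {-pi..pi}"
  have "\<exists>p\<in>?P. \<forall>q\<in>?P. norm (secant (fst p) (fst p + snd p)) \<le> norm (secant (fst q) (fst q + snd q))"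
  proof (rule continuous_attains_inf)
    have "continuous_on ?P (\<lambda>p. (fst p, fst p + snd p) :: real \<times> real)"
      by (intro continuous_intros)
    from continuous_on_compose2[OF secant_cont[of UNIV] this]
    show "continuous_on ?P (\<lambda>p. norm (secant (fst p) (fst p + snd p)))"
      by (intro continuous_on_norm) auto
  qed (auto intro!: compact_Times)
  then obtain p where p: "p \<in> ?P" "\<And>q. q \<in> ?P \<Longrightarrow> norm (secant (fst p) (fst p + snd p)) \<le> norm (secant (fst q) (fst q + snd q))"
    by blast
  let ?c = "norm (secant (fst p) (fst p + snd p))"
  have "?c > 0"
    using p(1) pi_gt_zero by (auto intro!: secant_nonzero simp: abs_less_iff simp del: pi_gt_zero)
  moreover have "?c * \<bar>u\<bar> \<le> norm (g (s + u) - g s)" if "s \<in> {0..2*pi}" "u \<in> {-pi..pi}" for s u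
    using p(2)[of "(s, u)"] that unfolding secant_eq by (simp add: mult.commute[of _ "\<bar>u\<bar>"] mult_left_mono)
  ultimately show ?thesis by blast
qed

text \<open>The triple minimum is the distance of the parameters on the circle of length 2 * pi. One
  of the three shifted differences lies in the window of the preceding estimate.\<close>

lemma chord_arc:
  obtains c where "c > 0" "\<And>s t. s \<in> {0..2*pi} \<Longrightarrow> t \<in> {0..2*pi} \<Longrightarrow>
     c * min \<bar>t - s\<bar> (min \<bar>t - s + 2*pi\<bar> \<bar>t - s - 2*pi\<bar>) \<le> norm (g t - g s)"
proof -
  obtain c where c: "c > 0" "\<And>s u. s\<in>{0..2*pi} \<Longrightarrow> u\<in>{-pi..pi} \<Longrightarrow> c * \<bar>u\<bar> \<le> norm (g (s + u) - g s)"
    using chord_arc_window by blast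
  have "c * min \<bar>t - s\<bar> (min \<bar>t - s + 2*pi\<bar> \<bar>t - s - 2*pi\<bar>) \<le> norm (g t - g s)"
    if "s \<in> {0..2*pi}" "t \<in> {0..2*pi}" for s t
  proof -
    have "\<exists>u\<in>{-pi..pi}. g (s + u) = g t \<and> (u = t - s \<or> u = t - s + 2*pi \<or> u = t - s - 2*pi)"
    proof -
      consider "\<bar>t - s\<bar> \<le> pi" | "t - s < - pi" | "t - s > pi" by linarith
      then show ?thesis
      proof cases
        case 2
        then show ?thesis
          using that per[of t] by (intro bexI[of _ "t - s + 2*pi"]) auto
      next
        case 3
        then show ?thesis
          using that per[of "t - 2*pi"] by (intro bexI[of _ "t - s - 2*pi"]) auto
      qed (intro bexI[of _ "t - s"], auto)
    qed
    then obtain u where u: "u \<in> {-pi..pi}" "g (s + u) = g t"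
        "u = t - s \<or> u = t - s + 2*pi \<or> u = t - s - 2*pi" by blast
    have "c * min \<bar>t - s\<bar> (min \<bar>t - s + 2*pi\<bar> \<bar>t - s - 2*pi\<bar>) \<le> c * \<bar>u\<bar>"
      using u(3) c(1) by (intro mult_left_mono) auto
    then show ?thesis using c(2)[OF that(1) u(1)] u(2) by simp
  qed
  then show ?thesis using that c(1) by blast
qed

end

section \<open>Hoelder functions and weakly singular integrals\<close>

lemma powr_add_le_add_powr:
  fixes x y a :: real
  assumes "0 \<le> x" "0 \<le> y" "0 < a" "a \<le> 1"
  shows "(x + y) powr a \<le> x powr a + y powr a"
proof (cases "x + y = 0")
  case False
  then have pos: "x + y > 0" using assms by linarith
  have *: "u / (x + y) \<le> (u / (x + y)) powr a" if "0 \<le> u" "u \<le> x + y" for u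
  proof (cases "u = 0")
    case False
    then have "0 < u / (x + y)" "u / (x + y) \<le> 1"
      using that pos by auto
    then show ?thesis
      using powr_mono'[of a 1 "u / (x + y)"] assms that by simp
  qed simp
  have "1 = x / (x + y) + y / (x + y)"
    using pos by (simp flip: add_divide_distrib)
  also have "\<dots> \<le> (x / (x + y)) powr a + (y / (x + y)) powr a"
    using assms by (intro add_mono *) auto
  finally have "1 * (x + y) powr a \<le> ((x / (x + y)) powr a + (y / (x + y)) powr a) * (x + y) powr a"
    using pos by (intro mult_right_mono) auto
  then show ?thesis
    using assms pos by (simp add: powr_divide distrib_right)
qed (use assms in auto)

text \<open>McShane's extension. It works for Hoelder functions because a power of the distance with
  exponent at most 1 still satisfies the triangle inequality.\<close>

lemma holder_extension:
  fixes \<phi> :: "'b \<Rightarrow> real" and g :: "'b \<Rightarrow> 'a::real_normed_vector"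
  assumes "0 < \<alpha>" "\<alpha> \<le> 1" "0 \<le> C" "T \<noteq> {}"
    and hol: "\<And>s t. s \<in> T \<Longrightarrow> t \<in> T \<Longrightarrow> \<bar>\<phi> s - \<phi> t\<bar> \<le> C * norm (g s - g t) powr \<alpha>"
  obtains \<psi> :: "'a \<Rightarrow> real" where "\<And>t. t \<in> T \<Longrightarrow> \<psi> (g t) = \<phi> t"
    "\<And>z w. \<bar>\<psi> z - \<psi> w\<bar> \<le> C * norm (z - w) powr \<alpha>"
proof -
  define \<psi> where "\<psi> z = (INF t\<in>T. \<phi> t + C * norm (g t - z) powr \<alpha>)" for z
  have tri: "C * norm (x - z) powr \<alpha> \<le> C * norm (x - y) powr \<alpha> + C * norm (y - z) powr \<alpha>" for x y z :: 'a
  proof -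
    have "norm (x - z) powr \<alpha> \<le> (norm (x - y) + norm (y - z)) powr \<alpha>"
      using assms norm_triangle_ineq[of "x - y" "y - z"] by (intro powr_mono2) auto
    also have "\<dots> \<le> norm (x - y) powr \<alpha> + norm (y - z) powr \<alpha>"
      using assms by (intro powr_add_le_add_powr) auto
    finally show ?thesis
      using assms(3) by (simp add: mult_left_mono flip: distrib_left)
  qed
  obtain t0 where t0: "t0 \<in> T" using assms by blast
  have bdd: "bdd_below ((\<lambda>t. \<phi> t + C * norm (g t - z) powr \<alpha>) ` T)" for z
  proof (rule bdd_belowI2)
    fix t assume "t \<in> T"
    then show "\<phi> t0 - C * norm (g t0 - z) powr \<alpha> \<le> \<phi> t + C * norm (g t - z) powr \<alpha>"
      using hol[OF t0, of t] tri[where x = "g t0" and y = z and z = "g t"] by (simp add: norm_minus_commute)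
  qed
  have le: "\<psi> z \<le> \<psi> w + C * norm (z - w) powr \<alpha>" for z w
  proof -
    have "\<psi> z - C * norm (z - w) powr \<alpha> \<le> \<psi> w"
      unfolding \<psi>_def[of w]
    proof (rule cINF_greatest)
      fix t assume "t \<in> T"
      then have "\<psi> z \<le> \<phi> t + C * norm (g t - z) powr \<alpha>"
        unfolding \<psi>_def by (intro cINF_lower bdd)
      then show "\<psi> z - C * norm (z - w) powr \<alpha> \<le> \<phi> t + C * norm (g t - w) powr \<alpha>"
        using tri[of "g t" z w] by (simp add: norm_minus_commute)
    qed (use t0 in auto)
    then show ?thesis by simp
  qed
  show ?thesis
  proof (rule that)
    fix t assume t: "t \<in> T"
    show "\<psi> (g t) = \<phi> t"
    proof (rule antisym)
      show "\<psi> (g t) \<le> \<phi> t"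
        unfolding \<psi>_def using cINF_lower[OF bdd t, of "g t"] by simp
      show "\<phi> t \<le> \<psi> (g t)"
        unfolding \<psi>_def using hol[OF t] t0 by (intro cINF_greatest) (fastforce simp: norm_minus_commute)+
    qed
  next
    fix z w show "\<bar>\<psi> z - \<psi> w\<bar> \<le> C * norm (z - w) powr \<alpha>"
      using le[of z w] le[of w z] by (simp add: norm_minus_commute abs_le_iff)
  qed
qed

text \<open>Meant for a = g t - z and b = g t - w, with x and y the corresponding differences of a
  Hoelder function. Half of the exponent becomes a power of \<open>d\<close>; the other half keeps
  the remaining singularities integrable along the curve.\<close>

lemma holder_quotient_difference:
  fixes a b :: complex and x y C d \<alpha> :: real
  assumes "0 < \<alpha>" "\<alpha> \<le> 1" "0 \<le> C" and d: "d = norm (a - b)"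
    and x: "\<bar>x\<bar> \<le> C * norm a powr \<alpha>" and y: "\<bar>y\<bar> \<le> C * norm b powr \<alpha>"
    and xy: "\<bar>x - y\<bar> \<le> C * d powr \<alpha>"
  shows "norm (of_real x / a - of_real y / b)
      \<le> 2 * C * d powr (\<alpha>/2) * (norm a powr (\<alpha>/2 - 1) + norm b powr (\<alpha>/2 - 1))"
  using d x y xy
proof (induction "norm b" "norm a" arbitrary: a b x y rule: linorder_wlog)
  case sym
  show ?case
    using sym(1)[of a b y x] sym(2-5) by (simp add: norm_minus_commute abs_minus_commute add.commute)
next
  case (le a b x y)
  have bound: "norm (of_real u / v) \<le> C * d powr (\<alpha>/2) * norm v powr (\<alpha>/2 - 1)"
    if "\<bar>u\<bar> \<le> C * norm v powr \<alpha>" "norm v \<le> d" for u :: real and v :: complex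
  proof (cases "v = 0")
    case False
    have "norm (of_real u / v) \<le> C * norm v powr \<alpha> / norm v"
      using that(1) by (simp add: norm_divide divide_right_mono)
    also have "\<dots> = C * norm v powr (\<alpha>/2) * norm v powr (\<alpha>/2 - 1)"
      using False by (simp add: powr_diff flip: powr_add)
    also have "\<dots> \<le> C * d powr (\<alpha>/2) * norm v powr (\<alpha>/2 - 1)"
      using assms that(2) by (intro mult_right_mono mult_left_mono powr_mono2) auto
    finally show ?thesis .
  qed (use assms in simp)
  have nonneg: "0 \<le> C * d powr (\<alpha>/2) * norm v powr (\<alpha>/2 - 1)" for v :: complex
    using assms by simp
  show ?case
  \<comment> \<open>Here \<open>a\<close> is the longer vector. If even it is at most
    \<open>d\<close>, each quotient is small enough by itself; otherwise the cancellation in the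
    difference has to be used.\<close>
  proof (cases "norm a \<le> d")
    case True
    have "norm (of_real x / a - of_real y / b) \<le> norm (of_real x / a) + norm (of_real y / b)"
      by (rule norm_triangle_ineq4)
    then show ?thesis
      using bound[OF le(3) True] bound[OF le(4)] True le(1) nonneg[of a] nonneg[of b]
      by (simp add: distrib_left)
  next
    case False
    then have a: "a \<noteq> 0" using le(2) by auto
    have d0: "0 \<le> d" using le(2) by simp
    show ?thesis
    proof (cases "b = 0")
      case True
      then show ?thesis using False le(2) by simp
    next
      case b: False
      have eq: "of_real x / a - of_real y / b = of_real (x - y) / a + of_real y * (b - a) / (a * b)"
        using a b by (simp add: field_simps)
      have "d powr \<alpha> = d powr (\<alpha>/2) * d powr (\<alpha>/2)"
        by (simp flip: powr_add)
      also have "\<dots> \<le> d powr (\<alpha>/2) * norm a powr (\<alpha>/2)"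
        using False d0 assms(1) by (intro mult_left_mono powr_mono2) auto
      finally have "d powr \<alpha> / norm a \<le> d powr (\<alpha>/2) * norm a powr (\<alpha>/2) / norm a"
        by (intro divide_right_mono) auto
      also have "\<dots> = d powr (\<alpha>/2) * norm a powr (\<alpha>/2 - 1)"
        using a by (simp add: powr_diff)
      finally have 1: "C * d powr \<alpha> / norm a \<le> C * (d powr (\<alpha>/2) * norm a powr (\<alpha>/2 - 1))"
        using assms(3) by (metis mult_left_mono times_divide_eq_right)
      have "d = d powr (\<alpha>/2) * d powr (1 - \<alpha>/2)"
        using d0 by (cases "d = 0") (auto simp flip: powr_add)
      also have "\<dots> \<le> d powr (\<alpha>/2) * norm a powr (1 - \<alpha>/2)"
        using False d0 assms by (intro mult_left_mono powr_mono2) auto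
      finally have "norm b powr \<alpha> * d / (norm a * norm b)
          \<le> norm b powr \<alpha> * (d powr (\<alpha>/2) * norm a powr (1 - \<alpha>/2)) / (norm a * norm b)"
        by (intro divide_right_mono mult_left_mono) auto
      also have "\<dots> = d powr (\<alpha>/2) * norm b powr (\<alpha> - 1) * norm a powr (- (\<alpha>/2))"
      proof -
        have "norm a powr (1 - \<alpha>/2) = norm a * norm a powr (- (\<alpha>/2))"
          using a powr_add[of "norm a" 1 "- (\<alpha>/2)"] by simp
        moreover have "norm b powr \<alpha> = norm b * norm b powr (\<alpha> - 1)"
          using b powr_add[of "norm b" 1 "\<alpha> - 1"] by simp
        ultimately show ?thesis using a b by simp
      qed
      also have "\<dots> \<le> d powr (\<alpha>/2) * norm b powr (\<alpha> - 1) * norm b powr (- (\<alpha>/2))"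
        using le(1) a b assms by (intro mult_left_mono powr_mono2') auto
      also have "\<dots> = d powr (\<alpha>/2) * norm b powr (\<alpha>/2 - 1)"
        by (simp add: mult.assoc flip: powr_add)
      finally have 2: "C * (norm b powr \<alpha> * d / (norm a * norm b)) \<le> C * (d powr (\<alpha>/2) * norm b powr (\<alpha>/2 - 1))"
        using assms(3) by (intro mult_left_mono)
      have "norm (of_real x / a - of_real y / b)
          \<le> norm (of_real (x - y) / a) + norm (of_real y * (b - a) / (a * b))"
        unfolding eq by (rule norm_triangle_ineq)
      also have "\<dots> = \<bar>x - y\<bar> / norm a + \<bar>y\<bar> * d / (norm a * norm b)"
        using le(2) by (simp add: norm_divide norm_mult norm_minus_commute flip: of_real_diff)
      also have "\<dots> \<le> C * d powr \<alpha> / norm a + C * norm b powr \<alpha> * d / (norm a * norm b)"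
        using le d0 by (intro add_mono divide_right_mono mult_right_mono) auto
      also have "\<dots> \<le> C * (d powr (\<alpha>/2) * norm a powr (\<alpha>/2 - 1)) + C * (d powr (\<alpha>/2) * norm b powr (\<alpha>/2 - 1))"
        using 1 2 by (simp add: mult.assoc)
      finally show ?thesis
        using nonneg[of a] nonneg[of b] by (simp add: distrib_left mult.assoc)
    qed
  qed
qed

lemma abs_powr_integrable:
  fixes p :: real
  assumes "p < 1" "0 \<le> L"
  shows "(\<lambda>u. \<bar>u\<bar> powr (-p)) integrable_on {-L..L}"
proof -
  have 1: "(\<lambda>u. \<bar>u\<bar> powr (-p)) integrable_on {0..L}"
    using integrable_on_powr_from_0[of "-p" L] assms
    by (auto elim!: integrable_eq)
  have "(\<lambda>u. \<bar>-u\<bar> powr (-p)) integrable_on {-L..-0}"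
    by (rule iffD2[OF Henstock_Kurzweil_Integration.integrable_reflect_real 1])
  then have 2: "(\<lambda>u. \<bar>u\<bar> powr (-p)) integrable_on {-L..0}"
    by simp
  show ?thesis
    using Henstock_Kurzweil_Integration.integrable_combine[OF _ _ 2 1] assms by simp
qed

lemma abs_powr_shift_bound:
  fixes p :: real
  assumes "p < 1" "{a..a+l} \<subseteq> {-L..L}" "0 \<le> L"
  shows "(\<lambda>t. \<bar>t + a\<bar> powr (-p)) integrable_on {0..l}"
    "integral {0..l} (\<lambda>t. \<bar>t + a\<bar> powr (-p)) \<le> integral {-L..L} (\<lambda>u. \<bar>u\<bar> powr (-p))"
proof -
  have int: "(\<lambda>u. \<bar>u\<bar> powr (-p)) integrable_on {a..a+l}"
    using abs_powr_integrable[OF assms(1,3)] assms(2) integrable_on_subinterval by blast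
  show "(\<lambda>t. \<bar>t + a\<bar> powr (-p)) integrable_on {0..l}"
    using integrable_shift_real_ivl[OF int, of a] by simp
  have "integral {0..l} (\<lambda>t. \<bar>t + a\<bar> powr (-p)) = integral {a..a+l} (\<lambda>u. \<bar>u\<bar> powr (-p))"
    using integral_shift_real_ivl[of a a "a + l" "\<lambda>u. \<bar>u\<bar> powr (-p)"] by simp
  also have "\<dots> \<le> integral {-L..L} (\<lambda>u. \<bar>u\<bar> powr (-p))"
    using int abs_powr_integrable[OF assms(1,3)] assms(2) by (intro integral_subset_le) auto
  finally show "integral {0..l} (\<lambda>t. \<bar>t + a\<bar> powr (-p)) \<le> integral {-L..L} (\<lambda>u. \<bar>u\<bar> powr (-p))" .
qed

context smooth_loop
begin

lemma g_measurable: "g \<in> borel_measurable (lebesgue_on {0..2*pi})"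
  and g1_measurable: "g1 \<in> borel_measurable (lebesgue_on {0..2*pi})"
  by (intro continuous_imp_measurable_on_sets_lebesgue g_cont g1_cont; simp)+

text \<open>The distance from \<open>z\<close> to \<open>g t\<close> is at least half the distance from \<open>g t\<close> to
  a point \<open>g s\<close> of the curve nearest to \<open>z\<close>, so the chord-arc estimate applies uniformly in \<open>z\<close>.\<close>

lemma riesz_potential_bounded:
  assumes p: "0 \<le> p" "p < 1"
  shows "\<exists>W>0. \<forall>z. (\<lambda>t. norm (g t - z) powr (-p)) integrable_on {0..2*pi} \<and>
    integral {0..2*pi} (\<lambda>t. norm (g t - z) powr (-p)) \<le> W"
proof -
  obtain c where c: "c > 0" "\<And>s t. s \<in> {0..2*pi} \<Longrightarrow> t \<in> {0..2*pi} \<Longrightarrow>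
     c * min \<bar>t - s\<bar> (min \<bar>t - s + 2*pi\<bar> \<bar>t - s - 2*pi\<bar>) \<le> norm (g t - g s)"
    using chord_arc by blast
  \<comment> \<open>The intervals of length 2 * pi that arise from the shifts below all lie in
    [-4 * pi, 4 * pi], so a single integral bounds them independently of \<open>s\<close>.\<close>
  define I where "I = integral {-4*pi..4*pi} (\<lambda>u. \<bar>u\<bar> powr (-p))"
  define k where "k = (c / 2) powr (-p)"
  define W where "W = \<bar>k * (3 * I)\<bar> + 1"
  have main: "(\<lambda>t. norm (g t - z) powr (-p)) integrable_on {0..2*pi} \<and>
      integral {0..2*pi} (\<lambda>t. norm (g t - z) powr (-p)) \<le> W" for z
  proof -
    have "\<exists>s\<in>{0..2*pi}. \<forall>t\<in>{0..2*pi}. norm (g s - z) \<le> norm (g t - z)"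
      by (intro continuous_attains_inf continuous_intros g_cont) auto
    then obtain s where s: "s \<in> {0..2*pi}" "\<And>t. t \<in> {0..2*pi} \<Longrightarrow> norm (g s - z) \<le> norm (g t - z)"
      by blast
    define b where "b t = k * (\<bar>t + (-s)\<bar> powr (-p) + \<bar>t + (-s + 2*pi)\<bar> powr (-p) + \<bar>t + (-s - 2*pi)\<bar> powr (-p))" for t
    define E where "E = {s, s - 2*pi, s + 2*pi}"
    \<comment> \<open>At a point of \<open>E\<close> one summand of \<open>b\<close> is 0 powr (-p),
      which has the value 0, so that \<open>b\<close> may fail to dominate. There the integrand
      itself is taken, which changes \<open>b\<close> only at finitely many points.\<close>
    define b' where "b' t = (if t \<in> E then norm (g t - z) powr (-p) else b t)" for t
    have int: "(\<lambda>t. \<bar>t + a\<bar> powr (-p)) integrable_on {0..2*pi}"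
        "integral {0..2*pi} (\<lambda>t. \<bar>t + a\<bar> powr (-p)) \<le> I"
      if "a \<in> {-4*pi..2*pi}" for a
      using that abs_powr_shift_bound[OF p(2), of a "2*pi" "4*pi"] unfolding I_def by (auto simp: subset_iff)
    have sa: "- s \<in> {-4*pi..2*pi}" "- s + 2*pi \<in> {-4*pi..2*pi}" "- s - 2*pi \<in> {-4*pi..2*pi}"
      using s(1) by auto
    have b_int: "b integrable_on {0..2*pi}"
      unfolding b_def by (intro integrable_on_cmult_left[where 'b = real, simplified] integrable_add int sa)
    have "integral {0..2*pi} b = k * (integral {0..2*pi} (\<lambda>t. \<bar>t + (-s)\<bar> powr (-p))
          + integral {0..2*pi} (\<lambda>t. \<bar>t + (-s + 2*pi)\<bar> powr (-p))
          + integral {0..2*pi} (\<lambda>t. \<bar>t + (-s - 2*pi)\<bar> powr (-p)))"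
      unfolding b_def integral_mult_right
      by (subst integral_add; (intro integrable_add int sa)?)+ simp
    also have "\<dots> \<le> k * (I + I + I)"
      unfolding k_def by (intro mult_left_mono add_mono int(2) sa) auto
    also have "\<dots> \<le> W" unfolding W_def by simp
    finally have b_W: "integral {0..2*pi} b \<le> W" .
    have b'_int: "b' integrable_on {0..2*pi}"
      by (rule integrable_spike_finite[OF _ _ b_int, of E]) (auto simp: b'_def E_def)
    have b'_eq: "integral {0..2*pi} b' = integral {0..2*pi} b"
      by (rule integral_spike[of E]) (auto simp: b'_def E_def)
    have le: "norm (g t - z) powr (-p) \<le> b' t" if t: "t \<in> {0..2*pi}" for t
    proof (cases "t \<in> E")
      case False
      define \<delta> where "\<delta> = min \<bar>t - s\<bar> (min \<bar>t - s + 2*pi\<bar> \<bar>t - s - 2*pi\<bar>)"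
      have \<delta>: "\<delta> > 0" using False by (auto simp: \<delta>_def E_def)
      have "norm (g t - g s) \<le> norm (g t - z) + norm (g s - z)"
        using norm_triangle_ineq4[of "g t - z" "g s - z"] by simp
      then have "c / 2 * \<delta> \<le> norm (g t - z)"
        using c(2)[OF s(1) t] s(2)[OF t] unfolding \<delta>_def by linarith
      then have "norm (g t - z) powr (-p) \<le> (c / 2 * \<delta>) powr (-p)"
        using p c(1) \<delta> by (intro powr_mono2') auto
      also have "\<dots> = k * \<delta> powr (-p)"
        using c(1) \<delta> powr_mult[of "c / 2" \<delta> "- p"] by (simp add: k_def)
      also have "\<dots> \<le> b t"
        unfolding b_def k_def by (intro mult_left_mono) (auto simp: \<delta>_def min_def algebra_simps)
      finally show ?thesis using False by (simp add: b'_def)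
    qed (simp add: b'_def)
    have meas: "(\<lambda>t. norm (g t - z) powr (-p)) \<in> borel_measurable (lebesgue_on {0..2*pi})"
      using g_measurable by measurable
    have "(\<lambda>t. norm (g t - z) powr (-p)) integrable_on {0..2*pi}"
      by (rule measurable_bounded_by_integrable_imp_integrable[OF meas b'_int]) (use le in auto)
    moreover from this have "integral {0..2*pi} (\<lambda>t. norm (g t - z) powr (-p)) \<le> integral {0..2*pi} b'"
      by (rule integral_le[OF _ b'_int le])
    ultimately show ?thesis using b'_eq b_W by simp
  qed
  show ?thesis
    by (intro exI[of _ W] conjI allI) (use main in \<open>auto simp: W_def\<close>)
qed

lemma integrable_by_potential:
  fixes f :: "real \<Rightarrow> 'c::euclidean_space"
  assumes "f \<in> borel_measurable (lebesgue_on {0..2*pi})" "0 \<le> p" "p < 1"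
    and "\<And>t. t \<in> {0..2*pi} \<Longrightarrow> norm (f t) \<le> C * norm (g t - z) powr (-p)"
  shows "f absolutely_integrable_on {0..2*pi}"
proof -
  have W: "(\<lambda>t. norm (g t - z) powr (-p)) integrable_on {0..2*pi}"
    using riesz_potential_bounded[OF assms(2,3)] by blast
  have "(\<lambda>t. C * norm (g t - z) powr (-p)) integrable_on {0..2*pi}"
    using integrable_on_cmult_left[OF W, of C] by simp
  then show ?thesis
    using measurable_bounded_by_integrable_imp_absolutely_integrable[OF assms(1) _ _ assms(4)] by auto
qed

text \<open>Parameters close to 0 and to 2 * pi give neighbouring points of the curve. For them the
  comparison runs through the common end value, and this costs the factor 2.\<close>

lemma holder_on_curve:
  assumes "0 < \<alpha>" "\<alpha> \<le> 1" and per: "\<phi> 0 = \<phi> (2*pi)"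
    and hol: "\<And>s t. s \<in> {0..2*pi} \<Longrightarrow> t \<in> {0..2*pi} \<Longrightarrow> \<bar>\<phi> s - \<phi> t\<bar> \<le> C * \<bar>s - t\<bar> powr \<alpha>"
  obtains C' where "0 \<le> C'"
    "\<And>s t. s \<in> {0..2*pi} \<Longrightarrow> t \<in> {0..2*pi} \<Longrightarrow> \<bar>\<phi> s - \<phi> t\<bar> \<le> C' * norm (g s - g t) powr \<alpha>"
proof -
  obtain c where c: "c > 0" "\<And>s t. s \<in> {0..2*pi} \<Longrightarrow> t \<in> {0..2*pi} \<Longrightarrow>
     c * min \<bar>t - s\<bar> (min \<bar>t - s + 2*pi\<bar> \<bar>t - s - 2*pi\<bar>) \<le> norm (g t - g s)"
    using chord_arc by blast
  have hol': "\<bar>\<phi> s - \<phi> t\<bar> \<le> \<bar>C\<bar> * \<delta> powr \<alpha>" if "s \<in> {0..2*pi}" "t \<in> {0..2*pi}" "\<bar>s - t\<bar> \<le> \<delta>" for s t \<delta>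
  proof -
    have "\<bar>\<phi> s - \<phi> t\<bar> \<le> C * \<bar>s - t\<bar> powr \<alpha>" using hol that by blast
    also have "\<dots> \<le> \<bar>C\<bar> * \<delta> powr \<alpha>"
      using that assms by (intro mult_mono powr_mono2) auto
    finally show ?thesis .
  qed
  have circ: "\<bar>\<phi> s - \<phi> t\<bar> \<le> 2 * \<bar>C\<bar> * (min \<bar>t - s\<bar> (min \<bar>t - s + 2*pi\<bar> \<bar>t - s - 2*pi\<bar>)) powr \<alpha>"
    if st: "s \<in> {0..2*pi}" "t \<in> {0..2*pi}" for s t
  proof -
    define \<delta> where "\<delta> = min \<bar>t - s\<bar> (min \<bar>t - s + 2*pi\<bar> \<bar>t - s - 2*pi\<bar>)"
    have pos: "0 \<le> \<bar>C\<bar> * \<delta> powr \<alpha>" by simp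
    have "\<delta> = \<bar>t - s\<bar> \<or> \<delta> = \<bar>t - s + 2*pi\<bar> \<or> \<delta> = \<bar>t - s - 2*pi\<bar>"
      unfolding \<delta>_def min_def by presburger
    then consider "\<delta> = \<bar>t - s\<bar>" | "\<delta> = \<bar>t - s + 2*pi\<bar>" | "\<delta> = \<bar>t - s - 2*pi\<bar>"
      by blast
    then have "\<bar>\<phi> s - \<phi> t\<bar> \<le> \<bar>C\<bar> * \<delta> powr \<alpha> + \<bar>C\<bar> * \<delta> powr \<alpha>"
    proof cases
      case 1
      then show ?thesis using hol'[OF st, of \<delta>] pos by (simp add: abs_minus_commute)
    next
      case 2
      then have "\<bar>s - 2*pi\<bar> \<le> \<delta>" "\<bar>0 - t\<bar> \<le> \<delta>" using st by auto
      then show ?thesis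
        using hol'[OF st(1), of "2*pi" \<delta>] hol'[OF _ st(2), of 0 \<delta>] per by simp
    next
      case 3
      then have "\<bar>s - 0\<bar> \<le> \<delta>" "\<bar>2*pi - t\<bar> \<le> \<delta>" using st by auto
      then show ?thesis
        using hol'[OF st(1), of 0 \<delta>] hol'[OF _ st(2), of "2*pi" \<delta>] per by simp
    qed
    then show ?thesis by (simp add: \<delta>_def)
  qed
  show ?thesis
  proof (rule that[of "2 * \<bar>C\<bar> * (1 / c) powr \<alpha>"])
    fix s t :: real assume st: "s \<in> {0..2*pi}" "t \<in> {0..2*pi}"
    let ?\<delta> = "min \<bar>t - s\<bar> (min \<bar>t - s + 2*pi\<bar> \<bar>t - s - 2*pi\<bar>)"
    have "?\<delta> \<le> 1 / c * norm (g s - g t)"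
      using c(2)[OF st] c(1) by (simp add: field_simps norm_minus_commute)
    then have "?\<delta> powr \<alpha> \<le> (1 / c * norm (g s - g t)) powr \<alpha>"
      using assms by (intro powr_mono2) auto
    then have "2 * \<bar>C\<bar> * ?\<delta> powr \<alpha> \<le> 2 * \<bar>C\<bar> * ((1 / c) powr \<alpha> * norm (g s - g t) powr \<alpha>)"
      using c(1) powr_mult[of "1 / c" "norm (g s - g t)" \<alpha>] by (intro mult_left_mono) auto
    then show "\<bar>\<phi> s - \<phi> t\<bar> \<le> 2 * \<bar>C\<bar> * (1 / c) powr \<alpha> * norm (g s - g t) powr \<alpha>"
      using circ[OF st] by (simp add: mult.assoc)
  qed simp
qed

end

section \<open>Cauchy integrals of Hoelder densities\<close>

definition holder_fun :: "real \<Rightarrow> (complex \<Rightarrow> real) \<Rightarrow> bool" where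
  "holder_fun \<alpha> \<psi> \<longleftrightarrow> 0 < \<alpha> \<and> \<alpha> \<le> 1 \<and> (\<exists>C\<ge>0. \<forall>z w. \<bar>\<psi> z - \<psi> w\<bar> \<le> C * norm (z - w) powr \<alpha>)"

lemma holder_imp_continuous:
  fixes f :: "complex \<Rightarrow> 'b::real_normed_vector"
  assumes "0 < \<alpha>" and le: "\<And>z w. norm (f z - f w) \<le> C * norm (z - w) powr \<alpha>"
  shows "continuous_on S f"
proof -
  have "isCont f w" for w
    unfolding isCont_def
  proof (rule LIM_zero_cancel)
    show "((\<lambda>z. f z - f w) \<longlongrightarrow> 0) (at w)"
    proof (rule Lim_null_comparison)
      show "\<forall>\<^sub>F z in at w. norm (f z - f w) \<le> C * norm (z - w) powr \<alpha>"
        using le by simp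
      have "((\<lambda>z. C * norm (z - w) powr \<alpha>) \<longlongrightarrow> C * (norm (w - w) powr \<alpha>)) (at w)"
        using assms(1) by (intro tendsto_intros) auto
      then show "((\<lambda>z. C * norm (z - w) powr \<alpha>) \<longlongrightarrow> 0) (at w)" by simp
    qed
  qed
  then show ?thesis by (simp add: continuous_at_imp_continuous_on)
qed

lemma holder_fun_continuous: "holder_fun \<alpha> \<psi> \<Longrightarrow> continuous_on S \<psi>"
  unfolding holder_fun_def using holder_imp_continuous[of \<alpha> \<psi>] by (metis real_norm_def)

context smooth_loop
begin

text \<open>Because \<open>\<psi> z\<close> is subtracted, the integral converges absolutely for every \<open>z\<close>, on the curve or off it.
  Its Hoelder continuity in \<open>z\<close> contains both the Plemelj formulas and Privalov's theorem.\<close>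

definition cauchy_diff :: "(complex \<Rightarrow> real) \<Rightarrow> complex \<Rightarrow> complex" where
  "cauchy_diff \<psi> z = integral {0..2*pi} (\<lambda>t. of_real (\<psi> (g t) - \<psi> z) / (g t - z) * g1 t)"

lemma psi_g_measurable:
  assumes "holder_fun \<alpha> \<psi>"
  shows "(\<lambda>t. \<psi> (g t)) \<in> borel_measurable (lebesgue_on {0..2*pi})"
  by (intro continuous_imp_measurable_on_sets_lebesgue
      continuous_on_compose2[OF holder_fun_continuous[OF assms, of UNIV] g_cont]) auto

lemma cauchy_diff_integrand_measurable:
  assumes "holder_fun \<alpha> \<psi>"
  shows "(\<lambda>t. of_real (\<psi> (g t) - \<psi> z) / (g t - z) * g1 t) \<in> borel_measurable (lebesgue_on {0..2*pi})"
  using psi_g_measurable[OF assms] g_measurable g1_measurable by measurable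

lemma cauchy_diff_integrand_absolutely_integrable:
  assumes "holder_fun \<alpha> \<psi>"
  shows "(\<lambda>t. of_real (\<psi> (g t) - \<psi> z) / (g t - z) * g1 t) absolutely_integrable_on {0..2*pi}"
proof -
  obtain C where \<alpha>: "0 < \<alpha>" "\<alpha> \<le> 1" and C: "C \<ge> 0" "\<And>z w. \<bar>\<psi> z - \<psi> w\<bar> \<le> C * norm (z - w) powr \<alpha>"
    using assms unfolding holder_fun_def by blast
  obtain K where K: "K > 0" "\<And>t. t \<in> {0..2*pi} \<Longrightarrow> norm (g1 t) \<le> K"
    using g1_bounded by blast
  show ?thesis
  proof (rule integrable_by_potential[OF cauchy_diff_integrand_measurable[OF assms]])
    fix t assume t: "t \<in> {0..2*pi}"
    show "norm (of_real (\<psi> (g t) - \<psi> z) / (g t - z) * g1 t) \<le> C * K * norm (g t - z) powr (-(1 - \<alpha>))"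
    proof (cases "g t = z")
      case False
      have "norm (of_real (\<psi> (g t) - \<psi> z) / (g t - z) * g1 t) = \<bar>\<psi> (g t) - \<psi> z\<bar> / norm (g t - z) * norm (g1 t)"
        by (simp only: norm_mult norm_divide norm_of_real)
      also have "\<dots> \<le> C * norm (g t - z) powr \<alpha> / norm (g t - z) * K"
        using C K(2)[OF t] K(1) by (intro mult_mono divide_right_mono) auto
      also have "\<dots> = C * K * norm (g t - z) powr (-(1 - \<alpha>))"
        using False by (simp add: powr_diff)
      finally show ?thesis .
    qed simp
  qed (use \<alpha> in auto)
qed

text \<open>The quotient estimate bounds the difference of the integrands by a power of |z - w|
  times two Riesz kernels of order 1 - \<alpha>/2 < 1, whose integrals are bounded uniformly in
  \<open>z\<close>. Halving the exponent is harmless, as no exponent is fixed in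
  \<open>H\<close>.\<close>

lemma cauchy_diff_holder:
  assumes "holder_fun \<alpha> \<psi>"
  shows "\<exists>C\<ge>0. \<forall>z w. norm (cauchy_diff \<psi> z - cauchy_diff \<psi> w) \<le> C * norm (z - w) powr (\<alpha>/2)"
proof -
  obtain C where \<alpha>: "0 < \<alpha>" "\<alpha> \<le> 1" and C: "C \<ge> 0" "\<And>z w. \<bar>\<psi> z - \<psi> w\<bar> \<le> C * norm (z - w) powr \<alpha>"
    using assms unfolding holder_fun_def by blast
  obtain K where K: "K > 0" "\<And>t. t \<in> {0..2*pi} \<Longrightarrow> norm (g1 t) \<le> K"
    using g1_bounded by blast
  let ?r = "\<lambda>z t. norm (g t - z) powr (-(1 - \<alpha>/2))"
  obtain W where W: "W > 0" "\<And>z. ?r z integrable_on {0..2*pi}" "\<And>z. integral {0..2*pi} (?r z) \<le> W"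
    using riesz_potential_bounded[of "1 - \<alpha>/2"] \<alpha> by auto
  have "norm (cauchy_diff \<psi> z - cauchy_diff \<psi> w) \<le> (2 * C * K * (W + W)) * norm (z - w) powr (\<alpha>/2)" for z w
  proof -
    let ?f = "\<lambda>z t. of_real (\<psi> (g t) - \<psi> z) / (g t - z) * g1 t"
    let ?D = "2 * C * norm (z - w) powr (\<alpha>/2) * K"
    have int: "?f z integrable_on {0..2*pi}" for z
      using cauchy_diff_integrand_absolutely_integrable[OF assms] absolutely_integrable_on_def by blast
    have eq: "cauchy_diff \<psi> z - cauchy_diff \<psi> w = integral {0..2*pi} (\<lambda>t. ?f z t - ?f w t)"
      unfolding cauchy_diff_def by (rule integral_diff[OF int int, symmetric])
    have "norm (cauchy_diff \<psi> z - cauchy_diff \<psi> w) \<le> integral {0..2*pi} (\<lambda>t. ?D * (?r z t + ?r w t))"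
      unfolding eq
    proof (rule integral_norm_bound_integral)
      show "(\<lambda>t. ?f z t - ?f w t) integrable_on {0..2*pi}"
        by (intro integrable_diff int)
      show "(\<lambda>t. ?D * (?r z t + ?r w t)) integrable_on {0..2*pi}"
        by (intro integrable_on_cmult_left[where 'b = real, simplified] integrable_add W)
      fix t assume t: "t \<in> {0..2*pi}"
      have "norm (of_real (\<psi> (g t) - \<psi> z) / (g t - z) - of_real (\<psi> (g t) - \<psi> w) / (g t - w))
          \<le> 2 * C * norm (z - w) powr (\<alpha>/2) * (norm (g t - z) powr (\<alpha>/2 - 1) + norm (g t - w) powr (\<alpha>/2 - 1))"
      proof (rule holder_quotient_difference[OF \<alpha> C(1)])
        show "norm (z - w) = norm (g t - z - (g t - w))"
          by (simp add: norm_minus_commute)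
        show "\<bar>\<psi> (g t) - \<psi> z - (\<psi> (g t) - \<psi> w)\<bar> \<le> C * norm (z - w) powr \<alpha>"
          using C(2)[of w z] by (simp add: norm_minus_commute)
      qed (use C(2) in auto)
      then have "norm (of_real (\<psi> (g t) - \<psi> z) / (g t - z) - of_real (\<psi> (g t) - \<psi> w) / (g t - w)) * norm (g1 t)
          \<le> (2 * C * norm (z - w) powr (\<alpha>/2) * (norm (g t - z) powr (\<alpha>/2 - 1) + norm (g t - w) powr (\<alpha>/2 - 1))) * K"
        using K(2)[OF t] C(1) by (intro mult_mono) auto
      then have "norm (?f z t - ?f w t)
          \<le> (2 * C * norm (z - w) powr (\<alpha>/2) * (norm (g t - z) powr (\<alpha>/2 - 1) + norm (g t - w) powr (\<alpha>/2 - 1))) * K"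
        by (simp only: norm_mult left_diff_distrib[symmetric])
      then show "norm (?f z t - ?f w t) \<le> ?D * (?r z t + ?r w t)"
        by (simp add: mult_ac)
    qed
    also have "\<dots> = ?D * (integral {0..2*pi} (?r z) + integral {0..2*pi} (?r w))"
      unfolding integral_mult_right integral_add[OF W(2) W(2)] ..
    also have "\<dots> \<le> ?D * (W + W)"
      by (rule mult_left_mono[OF add_mono[OF W(3) W(3)]]) (use C(1) K(1) in simp)
    also have "?D * (W + W) = (2 * C * K * (W + W)) * norm (z - w) powr (\<alpha>/2)"
      by simp
    finally show ?thesis .
  qed
  then show ?thesis using C(1) K(1) W(1) by (intro exI[of _ "2 * C * K * (W + W)"]) auto
qed

lemma cauchy_diff_continuous: "holder_fun \<alpha> \<psi> \<Longrightarrow> continuous_on S (cauchy_diff \<psi>)"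
  using cauchy_diff_holder[of \<alpha> \<psi>] holder_imp_continuous[of "\<alpha>/2" "cauchy_diff \<psi>"] unfolding holder_fun_def by fastforce

lemma off_curve_integrand_continuous:
  assumes "z \<notin> g ` T"
  shows "continuous_on T (\<lambda>t. g1 t / (g t - z))"
  using assms by (intro continuous_intros g1_cont g_cont) auto

lemma cauchy_diff_off_curve:
  assumes \<psi>: "holder_fun \<alpha> \<psi>" and z: "z \<notin> g ` {0..2*pi}"
  shows "cauchy_diff \<psi> z = integral {0..2*pi} (\<lambda>t. of_real (\<psi> (g t)) * g1 t / (g t - z))
        - of_real (\<psi> z) * integral {0..2*pi} (\<lambda>t. g1 t / (g t - z))"
proof -
  have 1: "(\<lambda>t. of_real (\<psi> (g t)) * g1 t / (g t - z)) integrable_on {0..2*pi}"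
    using z by (intro integrable_continuous_interval continuous_intros g1_cont g_cont
       continuous_on_compose2[OF holder_fun_continuous[OF \<psi>, of UNIV] g_cont]) auto
  have 2: "(\<lambda>t. of_real (\<psi> z) * (g1 t / (g t - z))) integrable_on {0..2*pi}"
    by (intro integrable_continuous_interval continuous_intros off_curve_integrand_continuous z)
  have "cauchy_diff \<psi> z = integral {0..2*pi} (\<lambda>t. of_real (\<psi> (g t)) * g1 t / (g t - z) - of_real (\<psi> z) * (g1 t / (g t - z)))"
    unfolding cauchy_diff_def by (rule integral_cong) (simp add: left_diff_distrib diff_divide_distrib)
  then show ?thesis
    by (simp only: integral_diff[OF 1 2] integral_mult_right)
qed

section \<open>Logarithmic primitives and winding numbers\<close>

lemma vd_g: "vector_derivative g (at t) = g1 t"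
  by (rule vector_derivative_at[OF d1])

lemma g_C1: "g C1_differentiable_on T"
  unfolding C1_differentiable_on_def using d1 g1_cont by (intro exI[of _ g1]) auto

text \<open>The integral is the increment of a continuous logarithm of \<open>g t - z\<close> along
  the arc; the exponential removes the choice of a branch.\<close>

lemma exp_integral:
  assumes "a \<le> b" "z \<notin> g ` {a..b}"
  shows "exp (integral {a..b} (\<lambda>t. g1 t / (g t - z))) = (g b - z) / (g a - z)"
proof -
  have "g piecewise_C1_differentiable_on {a..b}"
    by (intro C1_differentiable_imp_piecewise g_C1)
  from winding_number_exp_integral(2)[OF this assms]
  have "exp (- (integral {a..b} (\<lambda>t. g1 t / (g t - z)))) * (g b - z) = g a - z"
    by (simp only: vd_g)
  moreover have "g a - z \<noteq> 0" using assms by auto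
  ultimately show ?thesis
    by (simp add: exp_minus field_simps)
qed

text \<open>Unlike the argument, the logarithm of the modulus is single-valued, so the real part of
  the kernel has a primitive on the whole arc.\<close>

lemma Re_kernel_integral:
  assumes "a \<le> b" "z \<notin> g ` {a..b}"
  shows "((\<lambda>t. Re (g1 t / (g t - z))) has_integral ln (norm (g b - z)) - ln (norm (g a - z))) {a..b}"
proof -
  have int: "(\<lambda>t. g1 t / (g t - z)) integrable_on {a..b}"
    by (intro integrable_continuous_interval off_curve_integrand_continuous assms)
  have ne: "g a \<noteq> z" "g b \<noteq> z" using assms by auto
  have "exp (Re (integral {a..b} (\<lambda>t. g1 t / (g t - z)))) = norm (g b - z) / norm (g a - z)"
    using arg_cong[OF exp_integral[OF assms], of norm] by (simp add: norm_divide)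
  then have "Re (integral {a..b} (\<lambda>t. g1 t / (g t - z))) = ln (norm (g b - z) / norm (g a - z))"
    by (metis ln_exp)
  then have "Re (integral {a..b} (\<lambda>t. g1 t / (g t - z))) = ln (norm (g b - z)) - ln (norm (g a - z))"
    using ne by (simp add: ln_div)
  then show ?thesis
    using has_integral_Re[OF integrable_integral[OF int]] by simp
qed

lemma winding_number_integral:
  assumes z: "z \<notin> g ` {0..2*pi}"
  shows "integral {0..2*pi} (\<lambda>t. g1 t / (g t - z)) = 2 * pi * \<i> * winding_number (\<lambda>s. g (2 * pi * s)) z"
proof -
  let ?p = "\<lambda>s. g (2 * pi * s)"
  have D: "(?p has_vector_derivative (2*pi) *\<^sub>R g1 (2 * pi * s)) (at s)" for s
  proof -
    have "((\<lambda>s. 2 * pi * s) has_vector_derivative 2*pi) (at s)"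
      by (auto intro!: derivative_eq_intros simp: has_real_derivative_iff_has_vector_derivative[symmetric])
    from vector_diff_chain_at[OF this d1] show ?thesis by (simp add: o_def)
  qed
  have "?p C1_differentiable_on {0..1}"
    unfolding C1_differentiable_on_def using D
    by (intro exI[of _ "\<lambda>s. (2*pi) *\<^sub>R g1 (2 * pi * s)"])
       (auto intro!: continuous_intros continuous_on_compose2[OF g1_cont[of UNIV]])
  then have vp: "valid_path ?p"
    by (simp add: valid_path_def C1_differentiable_imp_piecewise)
  have zp: "z \<notin> path_image ?p"
    using z by (auto simp: path_image_def)
  have "((\<lambda>x. (2*pi) *\<^sub>R (g1 (2*pi*x) / (g (2*pi*x) - z))) has_integral
      integral {2*pi*0..2*pi*1} (\<lambda>t. g1 t / (g t - z))) {0..1}"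
    by (rule has_integral_substitution[where c = 0 and d = "2*pi"])
       (use z in \<open>auto intro!: derivative_eq_intros off_curve_integrand_continuous\<close>)
  then have "contour_integral ?p (\<lambda>w. 1 / (w - z)) = integral {0..2*pi} (\<lambda>t. g1 t / (g t - z))"
    unfolding contour_integral_integral vector_derivative_at[OF D]
    by (simp add: scaleR_conv_of_real integral_unique)
  then show ?thesis
    using winding_number_valid_path[OF vp zp] by simp
qed

lemma Im_kernel_measurable: "(\<lambda>t. Im (g1 t / (g t - z))) \<in> borel_measurable (lebesgue_on {0..2*pi})"
  using g_measurable g1_measurable by measurable

lemma Im_kernel_mult_integrable:
  assumes "f \<in> borel_measurable (lebesgue_on {0..2*pi})" "\<And>t. t \<in> {0..2*pi} \<Longrightarrow> \<bar>f t\<bar> \<le> Q" "s \<in> {0..2*pi}"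
  shows "(\<lambda>t. Im (g1 t / (g t - g s)) * f t) integrable_on {0..2*pi}"
proof -
  obtain C where C: "C > 0" "\<And>s t. s\<in>{0..2*pi} \<Longrightarrow> t\<in>{0..2*pi} \<Longrightarrow> \<bar>Im (g1 t / (g t - g s))\<bar> \<le> C"
    using Im_kernel_bounded by blast
  show ?thesis
  proof (rule measurable_bounded_by_integrable_imp_integrable)
    show "(\<lambda>t. Im (g1 t / (g t - g s)) * f t) \<in> borel_measurable (lebesgue_on {0..2*pi})"
      by (intro borel_measurable_times Im_kernel_measurable assms)
    show "(\<lambda>t. C * Q) integrable_on {0..2*pi}" by (rule integrable_const_ivl)
    show "norm (Im (g1 t / (g t - g s)) * f t) \<le> C * Q" if "t \<in> {0..2*pi}" for t
      unfolding real_norm_def abs_mult using C(1) C(2)[OF assms(3) that] assms(2)[OF that]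
      by (intro mult_mono) auto
  qed simp
qed

text \<open>On the curve the imaginary part of the Cauchy kernel is bounded, so the subtracted term
  can be split off without a principal value.\<close>

lemma Im_cauchy_diff_on_curve:
  assumes \<psi>: "holder_fun \<alpha> \<psi>" and s: "s \<in> {0..2*pi}"
  shows "integral {0..2*pi} (\<lambda>t. Im (g1 t / (g t - g s)) * \<psi> (g t))
       = Im (cauchy_diff \<psi> (g s)) + \<psi> (g s) * integral {0..2*pi} (\<lambda>t. Im (g1 t / (g t - g s)))"
proof -
  have "bounded ((\<lambda>t. \<psi> (g t)) ` {0..2*pi})"
    by (intro compact_imp_bounded compact_continuous_image
      continuous_on_compose2[OF holder_fun_continuous[OF \<psi>, of UNIV] g_cont]) auto
  then obtain Q where Q: "\<And>t. t \<in> {0..2*pi} \<Longrightarrow> \<bar>\<psi> (g t)\<bar> \<le> Q"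
    unfolding bounded_iff by fastforce
  have 1: "(\<lambda>t. Im (g1 t / (g t - g s)) * \<psi> (g t)) integrable_on {0..2*pi}"
    by (rule Im_kernel_mult_integrable[OF psi_g_measurable[OF \<psi>] Q s])
  have 2: "(\<lambda>t. Im (g1 t / (g t - g s))) integrable_on {0..2*pi}"
    using Im_kernel_mult_integrable[of "\<lambda>_. 1" 1 s] s by simp
  have "(\<lambda>t. of_real (\<psi> (g t) - \<psi> (g s)) / (g t - g s) * g1 t) integrable_on {0..2*pi}"
    using cauchy_diff_integrand_absolutely_integrable[OF \<psi>] absolutely_integrable_on_def by blast
  then have "((\<lambda>t. Im (of_real (\<psi> (g t) - \<psi> (g s)) / (g t - g s) * g1 t)) has_integral Im (cauchy_diff \<psi> (g s))) {0..2*pi}"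
    unfolding cauchy_diff_def by (intro has_integral_Im integrable_integral)
  moreover have "Im (of_real (\<psi> (g t) - \<psi> (g s)) / (g t - g s) * g1 t)
      = Im (g1 t / (g t - g s)) * \<psi> (g t) - \<psi> (g s) * Im (g1 t / (g t - g s))" for t
  proof -
    have "of_real (\<psi> (g t) - \<psi> (g s)) / (g t - g s) * g1 t = of_real (\<psi> (g t) - \<psi> (g s)) * (g1 t / (g t - g s))"
      by simp
    then show ?thesis by (simp only: scaleR_conv_of_real[symmetric] scaleR_complex.sel) (simp add: algebra_simps)
  qed
  ultimately have "Im (cauchy_diff \<psi> (g s)) = integral {0..2*pi} (\<lambda>t. Im (g1 t / (g t - g s)) * \<psi> (g t) - \<psi> (g s) * Im (g1 t / (g t - g s)))"
    by (simp add: integral_unique)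
  also have "\<dots> = integral {0..2*pi} (\<lambda>t. Im (g1 t / (g t - g s)) * \<psi> (g t)) - \<psi> (g s) * integral {0..2*pi} (\<lambda>t. Im (g1 t / (g t - g s)))"
    using 1 integrable_on_cmult_left[OF 2, of "\<psi> (g s)"] by (subst integral_diff) simp_all
  finally show ?thesis by simp
qed

end

text \<open>For an antiderivative P of \<open>h\<close> the difference P (x + T) - P x has
  derivative 0. The interval from \<open>l\<close> to \<open>u\<close> contains both 0 and
  \<open>a\<close>.\<close>

lemma periodic_integral_shift:
  fixes h :: "real \<Rightarrow> 'a::euclidean_space"
  assumes cont: "continuous_on UNIV h" and per: "\<And>t. h (t + T) = h t" and "T \<ge> 0"
  shows "integral {a..a + T} h = integral {0..T} h"
proof -
  define l u where "l = min a 0" and "u = max a 0"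
  obtain P where P: "\<And>x. x \<in> {l..u + T} \<Longrightarrow> (P has_vector_derivative h x) (at x within {l..u + T})"
    using antiderivative_continuous[of l "u + T" h] continuous_on_subset[OF cont subset_UNIV] by blast
  have int: "integral {x..x + T} h = P (x + T) - P x" if "x \<in> {l..u}" for x
    using that \<open>T \<ge> 0\<close>
    by (intro integral_unique fundamental_theorem_of_calculus has_vector_derivative_within_subset[OF P]) auto
  have "((\<lambda>x. P (x + T) - P x) has_vector_derivative 0) (at x within {l..u})" if x: "x \<in> {l..u}" for x
  proof -
    have "((\<lambda>x. x + T) has_vector_derivative 1) (at x within {l..u})"
      by (auto intro!: derivative_eq_intros)
    moreover have "(P has_vector_derivative h (x + T)) (at (x + T) within (\<lambda>x. x + T) ` {l..u})"
      using x \<open>T \<ge> 0\<close> by (intro has_vector_derivative_within_subset[OF P]) auto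
    ultimately have "(P \<circ> (\<lambda>x. x + T) has_vector_derivative 1 *\<^sub>R h (x + T)) (at x within {l..u})"
      by (rule vector_diff_chain_within)
    moreover have "(P has_vector_derivative h x) (at x within {l..u})"
      using x \<open>T \<ge> 0\<close> by (intro has_vector_derivative_within_subset[OF P]) auto
    ultimately show ?thesis
      using has_vector_derivative_diff[of "P \<circ> (\<lambda>x. x + T)" "h (x + T)"] by (fastforce simp: per o_def)
  qed
  then obtain c where c: "\<And>x. x \<in> {l..u} \<Longrightarrow> P (x + T) - P x = c"
    using has_vector_derivative_zero_constant[of "{l..u}" "\<lambda>x. P (x + T) - P x"] by auto
  then show ?thesis
    using int[of a] int[of 0] c[of a] c[of 0] by (simp add: l_def u_def)
qed

context smooth_loop
begin

section \<open>Principal values on a single curve\<close>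

definition pv_dom :: "real \<Rightarrow> real \<Rightarrow> real set" where
  "pv_dom s \<epsilon> = {t\<in>{0..2*pi}. \<epsilon> \<le> \<bar>t - s\<bar> \<and> \<epsilon> \<le> 2*pi - \<bar>t - s\<bar>}"

lemma pv_dom_closed: "closed (pv_dom s \<epsilon>)"
proof -
  have "pv_dom s \<epsilon> = {0..2*pi} \<inter> ({t. \<epsilon> \<le> \<bar>t - s\<bar>} \<inter> {t. \<epsilon> \<le> 2*pi - \<bar>t - s\<bar>})"
    by (auto simp: pv_dom_def)
  moreover have "closed {t. \<epsilon> \<le> \<bar>t - s\<bar>}" "closed {t. \<epsilon> \<le> 2*pi - \<bar>t - s\<bar>}"
    by (intro closed_Collect_le continuous_intros)+
  ultimately show ?thesis by (auto intro!: closed_Int)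
qed

lemma pv_dom_avoids: "\<epsilon> > 0 \<Longrightarrow> t \<in> pv_dom s \<epsilon> \<Longrightarrow> g t \<noteq> g s"
  using g_eq_near[of s t] by (auto simp: pv_dom_def)

lemma kernel_continuous_pv_dom: "\<epsilon> > 0 \<Longrightarrow> continuous_on (pv_dom s \<epsilon>) (\<lambda>t. g1 t / (g t - g s))"
  using pv_dom_avoids by (intro off_curve_integrand_continuous) force

lemma pv_dom_integrable:
  fixes f :: "real \<Rightarrow> real"
  assumes "continuous_on (pv_dom s \<epsilon>) f"
  shows "f integrable_on pv_dom s \<epsilon>"
proof -
  have "compact (pv_dom s \<epsilon>)"
    using pv_dom_closed by (auto simp: compact_eq_bounded_closed pv_dom_def intro: bounded_subset[of "{0..2*pi}"])
  then have "set_integrable lborel (pv_dom s \<epsilon>) f"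
    unfolding set_integrable_def using borel_integrable_compact[OF _ assms] by blast
  then show ?thesis by (rule set_borel_integral_eq_integral(1))
qed

text \<open>The primitive ln |g t - g s| is evaluated at the ends of the truncated domain. For
  \<open>s\<close> inside the parameter interval there are two pieces, and the terms at 0 and 2 * pi
  cancel because the curve is closed. For \<open>s\<close> at an end there is only one
  piece.\<close>

lemma pv_Re_kernel_integral:
  assumes s: "s \<in> {0..2*pi}" and \<epsilon>: "0 < \<epsilon>" "\<epsilon> < pi" "s = 0 \<or> s = 2*pi \<or> \<epsilon> < s \<and> \<epsilon> < 2*pi - s"
  shows "integral (pv_dom s \<epsilon>) (\<lambda>t. Re (g1 t / (g t - g s)))
       = ln (norm (g (s - \<epsilon>) - g s)) - ln (norm (g (s + \<epsilon>) - g s))"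
proof -
  have av: "g s \<notin> g ` S" if "S \<subseteq> pv_dom s \<epsilon>" for S
    using that pv_dom_avoids[OF \<epsilon>(1)] by force
  have g0: "g (2*pi) = g 0" using per[of 0] by simp
  show ?thesis
  proof (cases "s = 0 \<or> s = 2*pi")
    case True
    then have eq: "pv_dom s \<epsilon> = {\<epsilon>..2*pi - \<epsilon>}"
      using \<epsilon> by (auto simp: pv_dom_def)
    have ends: "g (2*pi - \<epsilon>) = g (s - \<epsilon>)" "g \<epsilon> = g (s + \<epsilon>)"
      using True per[of "-\<epsilon>"] per[of \<epsilon>] by (auto simp: add.commute)
    show ?thesis
      using Re_kernel_integral[of \<epsilon> "2*pi - \<epsilon>" "g s"] av[of "{\<epsilon>..2*pi - \<epsilon>}"] \<epsilon> eq ends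
      by (simp add: integral_unique)
  next
    case False
    then have \<epsilon>': "\<epsilon> < s" "\<epsilon> < 2*pi - s" using \<epsilon>(3) by auto
    then have eq: "pv_dom s \<epsilon> = {0..s - \<epsilon>} \<union> {s + \<epsilon>..2*pi}"
      using \<epsilon>(1) by (auto simp: pv_dom_def)
    have "((\<lambda>t. Re (g1 t / (g t - g s))) has_integral
        (ln (norm (g (s - \<epsilon>) - g s)) - ln (norm (g 0 - g s)))
        + (ln (norm (g (2*pi) - g s)) - ln (norm (g (s + \<epsilon>) - g s)))) (pv_dom s \<epsilon>)"
      unfolding eq
    proof (rule has_integral_Un)
      have "{0..s - \<epsilon>} \<inter> {s + \<epsilon>..2*pi} = {}" using \<epsilon> by auto
      then show "negligible ({0..s - \<epsilon>} \<inter> {s + \<epsilon>..2*pi})" by simp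
    qed (intro Re_kernel_integral av; use \<epsilon>' eq in auto)+
    then show ?thesis by (simp add: integral_unique g0)
  qed
qed

text \<open>Both remaining chords are \<epsilon> times a secant in length. As the truncation is
  symmetric, ln \<epsilon> cancels, and both secants tend to \<open>g1 s\<close>.\<close>

lemma pv_Re_kernel_tendsto:
  assumes s: "s \<in> {0..2*pi}"
  shows "((\<lambda>\<epsilon>. integral (pv_dom s \<epsilon>) (\<lambda>t. Re (g1 t / (g t - g s)))) \<longlongrightarrow> 0) (at_right 0)"
proof -
  have lim: "((\<lambda>\<epsilon>. ln (norm (secant s (s + c * \<epsilon>)))) \<longlongrightarrow> ln (norm (g1 s))) (at_right 0)" for c
  proof -
    have "continuous_on UNIV (\<lambda>\<epsilon>. secant s (s + c * \<epsilon>))"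
    proof -
      have "continuous_on UNIV (\<lambda>\<epsilon>. (s, s + c * \<epsilon>))" by (intro continuous_intros)
      from continuous_on_compose2[OF secant_cont[of UNIV] this] show ?thesis by simp
    qed
    then have "((\<lambda>\<epsilon>. secant s (s + c * \<epsilon>)) \<longlongrightarrow> secant s (s + c * 0)) (at_right 0)"
      by (metis UNIV_I continuous_on_eq_continuous_at filterlim_at_split isCont_def open_UNIV)
    then show ?thesis
      using nz by (intro tendsto_intros) (auto simp: secant_diag)
  qed
  have "((\<lambda>\<epsilon>. ln (norm (secant s (s + (-1) * \<epsilon>))) - ln (norm (secant s (s + 1 * \<epsilon>)))) \<longlongrightarrow> ln (norm (g1 s)) - ln (norm (g1 s))) (at_right 0)"
    by (intro tendsto_diff lim)
  then have "((\<lambda>\<epsilon>. ln (norm (secant s (s - \<epsilon>))) - ln (norm (secant s (s + \<epsilon>)))) \<longlongrightarrow> 0) (at_right 0)"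
    by simp
  moreover have "\<forall>\<^sub>F \<epsilon> in at_right 0. ln (norm (secant s (s - \<epsilon>))) - ln (norm (secant s (s + \<epsilon>)))
      = integral (pv_dom s \<epsilon>) (\<lambda>t. Re (g1 t / (g t - g s)))"
  proof -
    \<comment> \<open>Below this bound the truncated domain has one of the two shapes treated in
      \<open>pv_Re_kernel_integral\<close>.\<close>
    define e0 where "e0 = (if s = 0 \<or> s = 2*pi then pi else min pi (min s (2*pi - s)))"
    have e0: "e0 > 0" using s by (auto simp: e0_def)
    have "ln (norm (secant s (s - \<epsilon>))) - ln (norm (secant s (s + \<epsilon>)))
      = integral (pv_dom s \<epsilon>) (\<lambda>t. Re (g1 t / (g t - g s)))" if \<epsilon>: "0 < \<epsilon>" "\<epsilon> < e0" for \<epsilon>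
    proof -
      have small: "\<epsilon> < pi" "s = 0 \<or> s = 2*pi \<or> \<epsilon> < s \<and> \<epsilon> < 2*pi - s"
        using \<epsilon>(2) by (auto simp: e0_def split: if_splits)
      have "secant s (s - \<epsilon>) \<noteq> 0" "secant s (s + \<epsilon>) \<noteq> 0"
        using \<epsilon> small by (auto intro!: secant_nonzero)
      then show ?thesis
        unfolding pv_Re_kernel_integral[OF s \<epsilon>(1) small]
        unfolding secant_eq
        using \<epsilon>(1) by (simp add: ln_mult)
    qed
    then show ?thesis
      using e0 by (auto simp: eventually_at_right_field)
  qed
  ultimately show ?thesis
    by (rule Lim_transform_eventually)
qed

text \<open>The density is split into its value at \<open>g s\<close>, whose principal value is 0,
  and a difference that makes the integrand absolutely integrable; for the latter, truncation
  converges by dominated convergence.\<close>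

lemma Re_cauchy_diff_on_curve:
  assumes \<psi>: "holder_fun \<alpha> \<psi>" and s: "s \<in> {0..2*pi}"
  shows "((\<lambda>\<epsilon>. integral (pv_dom s \<epsilon>) (\<lambda>t. Re (g1 t / (g t - g s)) * \<psi> (g t))) \<longlongrightarrow> Re (cauchy_diff \<psi> (g s))) (at_right 0)"
proof -
  define f where "f t = Re (of_real (\<psi> (g t) - \<psi> (g s)) / (g t - g s) * g1 t)" for t
  have f_eq: "f t = (\<psi> (g t) - \<psi> (g s)) * Re (g1 t / (g t - g s))" for t
  proof -
    have "of_real (\<psi> (g t) - \<psi> (g s)) / (g t - g s) * g1 t = of_real (\<psi> (g t) - \<psi> (g s)) * (g1 t / (g t - g s))"
      by simp
    then show ?thesis unfolding f_def by (simp only: scaleR_conv_of_real[symmetric] scaleR_complex.sel)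
  qed
  have "bounded_linear Re" by (rule bounded_linear_Re)
  from absolutely_integrable_linear[OF cauchy_diff_integrand_absolutely_integrable[OF \<psi>, of "g s"] this]
  have abs: "f absolutely_integrable_on {0..2*pi}"
    by (simp add: o_def f_def[abs_def])
  have f_int: "f integrable_on {0..2*pi}" and f_abs: "(\<lambda>t. norm (f t)) integrable_on {0..2*pi}"
    using abs by (simp_all add: absolutely_integrable_on_def)
  have cauchy_diff: "integral {0..2*pi} f = Re (cauchy_diff \<psi> (g s))"
    using has_integral_Re[OF integrable_integral[OF set_lebesgue_integral_eq_integral(1)[OF cauchy_diff_integrand_absolutely_integrable[OF \<psi>, of "g s"]]]]
    unfolding cauchy_diff_def f_def[abs_def] by (rule integral_unique)
  have sub: "pv_dom s \<epsilon> \<subseteq> {0..2*pi}" for \<epsilon> by (auto simp: pv_dom_def)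
  have f_pv: "f integrable_on pv_dom s \<epsilon>" for \<epsilon>
    using set_integrable_subset[OF abs _ sub] pv_dom_closed
    by (auto simp: absolutely_integrable_on_def)
  have lim: "((\<lambda>\<epsilon>. integral (pv_dom s \<epsilon>) f) \<longlongrightarrow> Re (cauchy_diff \<psi> (g s))) (at_right 0)"
  proof (rule tendsto_at_right_sequentially[of 0 1])
    fix S :: "nat \<Rightarrow> real" assume S: "\<And>n. 0 < S n" "S \<longlonglongrightarrow> 0"
    let ?fk = "\<lambda>k t. if t \<in> pv_dom s (S k) then f t else 0"
    have "(\<lambda>k. integral {0..2*pi} (?fk k)) \<longlonglongrightarrow> integral {0..2*pi} f"
    proof (rule dominated_convergence(2)[OF _ f_abs])
      show "?fk k integrable_on {0..2*pi}" for k
        using f_pv by (simp add: integrable_restrict_Int Int_absorb2[OF sub])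
      show "norm (?fk k t) \<le> norm (f t)" for k t by simp
      fix t assume t: "t \<in> {0..2*pi}"
      show "(\<lambda>k. ?fk k t) \<longlonglongrightarrow> f t"
      proof (cases "g t = g s")
        case True
        then have "f t = 0" by (simp add: f_eq)
        then show ?thesis by (simp cong: if_cong)
      next
        case False
        have "t \<noteq> s" using False by auto
        moreover have "\<bar>t - s\<bar> \<noteq> 2*pi"
        proof
          assume "\<bar>t - s\<bar> = 2*pi"
          then have "t = s + 2*pi \<or> s = t + 2*pi" by linarith
          then show False using False per by metis
        qed
        moreover have "\<bar>t - s\<bar> \<le> 2*pi" using t s by auto
        ultimately have "0 < min \<bar>t - s\<bar> (2*pi - \<bar>t - s\<bar>)" by auto
        then have "\<forall>\<^sub>F k in sequentially. S k < min \<bar>t - s\<bar> (2*pi - \<bar>t - s\<bar>)"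
          by (rule order_tendstoD(2)[OF S(2)])
        then have "\<forall>\<^sub>F k in sequentially. f t = ?fk k t"
          by eventually_elim (use t in \<open>auto simp: pv_dom_def\<close>)
        then show ?thesis by (rule Lim_transform_eventually[OF tendsto_const])
      qed
    qed
    then show "(\<lambda>n. integral (pv_dom s (S n)) f) \<longlonglongrightarrow> Re (cauchy_diff \<psi> (g s))"
      unfolding cauchy_diff by (simp add: integral_restrict_Int Int_absorb2[OF sub])
  qed simp
  have "((\<lambda>\<epsilon>. integral (pv_dom s \<epsilon>) f + \<psi> (g s) * integral (pv_dom s \<epsilon>) (\<lambda>t. Re (g1 t / (g t - g s)))) \<longlongrightarrow>
      Re (cauchy_diff \<psi> (g s)) + \<psi> (g s) * 0) (at_right 0)"
    by (intro tendsto_intros lim pv_Re_kernel_tendsto s)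
  moreover have "integral (pv_dom s \<epsilon>) f + \<psi> (g s) * integral (pv_dom s \<epsilon>) (\<lambda>t. Re (g1 t / (g t - g s)))
      = integral (pv_dom s \<epsilon>) (\<lambda>t. Re (g1 t / (g t - g s)) * \<psi> (g t))" if "\<epsilon> > 0" for \<epsilon>
  proof -
    have int: "(\<lambda>t. Re (g1 t / (g t - g s))) integrable_on pv_dom s \<epsilon>"
      by (intro pv_dom_integrable continuous_on_Re kernel_continuous_pv_dom that)
    have "integral (pv_dom s \<epsilon>) (\<lambda>t. f t + \<psi> (g s) * Re (g1 t / (g t - g s)))
        = integral (pv_dom s \<epsilon>) f + \<psi> (g s) * integral (pv_dom s \<epsilon>) (\<lambda>t. Re (g1 t / (g t - g s)))"
      using integrable_on_cmult_left[OF int, of "\<psi> (g s)"] f_pv by (subst integral_add) simp_all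
    moreover have "(\<lambda>t. f t + \<psi> (g s) * Re (g1 t / (g t - g s))) = (\<lambda>t. Re (g1 t / (g t - g s)) * \<psi> (g t))"
      by (auto simp: f_eq algebra_simps)
    ultimately show ?thesis by simp
  qed
  then have "\<forall>\<^sub>F \<epsilon> in at_right 0. integral (pv_dom s \<epsilon>) f + \<psi> (g s) * integral (pv_dom s \<epsilon>) (\<lambda>t. Re (g1 t / (g t - g s)))
      = integral (pv_dom s \<epsilon>) (\<lambda>t. Re (g1 t / (g t - g s)) * \<psi> (g t))"
    by (auto simp: eventually_at_right_field intro: exI[of _ 1])
  ultimately show ?thesis
    using Lim_transform_eventually by fastforce
qed

end

section \<open>The principal value of a constant density\<close>

locale clockwise_loop = smooth_loop +
  assumes wind: "\<And>z. z \<notin> g ` {0..2*pi} \<Longrightarrow>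
    winding_number (\<lambda>s. g (2 * pi * s)) z = 0 \<or> winding_number (\<lambda>s. g (2 * pi * s)) z = -1"
begin

lemma range_window: "range g = g ` {x..x + 2*pi}"
proof -
  have "g t \<in> g ` {x..x + 2*pi}" for t
  proof -
    define n where "n = \<lfloor>(t - x) / (2*pi)\<rfloor>"
    have "of_int n * (2*pi) \<le> t - x" "t - x < (of_int n + 1) * (2*pi)"
      unfolding n_def by (rule floor_divide_lower floor_divide_upper; simp)+
    then have "t + 2*pi * of_int (-n) \<in> {x..x + 2*pi}"
      by (auto simp: algebra_simps)
    then show ?thesis by (metis g_per_int imageI)
  qed
  then show ?thesis by blast
qed

lemma winding_integral_values:
  assumes "z \<notin> range g"
  shows "integral {x..x + 2*pi} (\<lambda>t. g1 t / (g t - z)) = 0 \<or>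
    integral {x..x + 2*pi} (\<lambda>t. g1 t / (g t - z)) = - 2 * pi * \<i>"
proof -
  have shift: "integral {x..x + 2*pi} (\<lambda>t. g1 t / (g t - z)) = integral {0..2*pi} (\<lambda>t. g1 t / (g t - z))"
    by (rule periodic_integral_shift[OF off_curve_integrand_continuous[OF assms]])
       (simp_all only: per g1_per, simp)
  have zn: "z \<notin> g ` {0..2*pi}" using assms by blast
  from shift have "integral {x..x + 2*pi} (\<lambda>t. g1 t / (g t - z)) = 2 * pi * \<i> * winding_number (\<lambda>s. g (2 * pi * s)) z"
    using winding_number_integral[OF zn] by (rule trans)
  then show ?thesis
    using wind[OF zn] by (elim disjE) simp_all
qed

text \<open>The winding numbers at the two points \<open>g s \<plusminus> \<i> \<delta> g1 s\<close> add up to twice the principal value at \<open>g s\<close>,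
  because on a short arc around \<open>s\<close> the sum of the two Cauchy kernels has the single-valued
  primitive \<open>Ln (((g t - g s) / g1 s)\<^sup>2 + \<delta>\<^sup>2)\<close>.\<close>

lemma principal_value_constant:
  assumes \<epsilon>: "0 < \<epsilon>" "\<epsilon> < pi"
    and xi: "\<And>t. xi t = (g t - g s) / g1 s"
    and Re2: "\<And>t. \<bar>t - s\<bar> \<le> \<epsilon> \<Longrightarrow> t \<noteq> s \<Longrightarrow> Re ((xi t)\<^sup>2) > 0"
    and Rep: "Re (xi (s + \<epsilon>)) > 0" and Rem: "Re (xi (s - \<epsilon>)) < 0"
  shows "Ln ((xi (s + \<epsilon>))\<^sup>2) - Ln ((xi (s - \<epsilon>))\<^sup>2)
      + 2 * integral {s + \<epsilon>..s - \<epsilon> + 2*pi} (\<lambda>t. g1 t / (g t - g s)) = - 2 * pi * \<i>"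
proof -
  define arc where "arc = {s + \<epsilon>..s - \<epsilon> + 2*pi}"
  define zp where "zp \<delta> = g s + \<i> * of_real \<delta> * g1 s" for \<delta> :: real
  have "\<exists>t\<in>arc. \<forall>u\<in>arc. norm (g t - g s) \<le> norm (g u - g s)"
    unfolding arc_def using \<epsilon> by (intro continuous_attains_inf continuous_intros g_cont) auto
  then obtain t0 where t0: "t0 \<in> arc" "\<And>u. u \<in> arc \<Longrightarrow> norm (g t0 - g s) \<le> norm (g u - g s)"
    by blast
  have "g t0 \<noteq> g s"
    using g_eq_near[of s t0] t0(1) \<epsilon> by (auto simp: arc_def)
  then have m: "0 < norm (g t0 - g s)" by simp
  \<comment> \<open>Half the distance from \<open>g s\<close> to the long arc, measured in units of
    |g1 s|, so that the points \<open>zp \<delta>\<close> with |\<delta>| up to this bound stay off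
    that arc.\<close>
  define \<delta>1 where "\<delta>1 = norm (g t0 - g s) / (2 * norm (g1 s))"
  have \<delta>1: "\<delta>1 > 0" using m nz by (simp add: \<delta>1_def)
  have arc_avoid: "g t \<noteq> zp \<delta>" if "t \<in> arc" "\<bar>\<delta>\<bar> \<le> \<delta>1" for t \<delta>
  proof
    assume "g t = zp \<delta>"
    then have "norm (g t - g s) = \<bar>\<delta>\<bar> * norm (g1 s)"
      by (simp add: zp_def norm_mult)
    also have "\<dots> \<le> \<delta>1 * norm (g1 s)"
      using that(2) by (intro mult_right_mono) auto
    also have "\<dots> < norm (g t0 - g s)"
      using m nz[of s] by (simp add: \<delta>1_def)
    finally show False using t0(2)[OF that(1)] by simp
  qed
  have Re2': "Re ((xi t)\<^sup>2) \<ge> 0" if "\<bar>t - s\<bar> \<le> \<epsilon>" for t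
    using Re2[OF that] by (cases "t = s") (auto simp: xi)
  \<comment> \<open>In the coordinate \<open>xi\<close> the point \<open>zp \<delta>\<close> is
    \<open>\<i> * \<delta>\<close>, whose square is negative, whereas the short arc stays where the
    square has nonnegative real part.\<close>
  have inner_avoid: "g t \<noteq> zp \<delta>" if "\<bar>t - s\<bar> \<le> \<epsilon>" "\<delta> \<noteq> 0" for t \<delta>
  proof
    assume "g t = zp \<delta>"
    then have "xi t = \<i> * of_real \<delta>"
      using nz[of s] by (simp add: xi zp_def)
    then have "Re ((xi t)\<^sup>2) = - \<delta>\<^sup>2"
      by (simp add: power2_eq_square)
    then show False using Re2'[OF that(1)] that(2) by (simp add: not_le)
  qed
  have avoid: "zp \<delta> \<notin> range g" if "\<bar>\<delta>\<bar> \<le> \<delta>1" "\<delta> \<noteq> 0" for \<delta>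
  proof -
    have "g t \<noteq> zp \<delta>" if t: "t \<in> {s - \<epsilon>..s - \<epsilon> + 2*pi}" for t
    proof (cases "t \<le> s + \<epsilon>")
      case True
      then show ?thesis using t \<open>\<delta> \<noteq> 0\<close> by (intro inner_avoid) auto
    next
      case False
      then show ?thesis using t \<open>\<bar>\<delta>\<bar> \<le> \<delta>1\<close> by (intro arc_avoid) (auto simp: arc_def)
    qed
    then show ?thesis unfolding range_window[of "s - \<epsilon>"] by force
  qed
  let ?K = "\<lambda>\<delta> t. g1 t / (g t - zp \<delta>)"
  \<comment> \<open>The possible sums of two winding integrals, each being 0 or - 2 * pi *
    \<open>\<i>\<close>.\<close>
  define V where "V = {0, - 2 * pi * \<i>, - 4 * pi * \<i>}"
  \<comment> \<open>For \<delta> > 0 this is the sum of the winding integrals at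
    \<open>zp \<delta>\<close> and \<open>zp (- \<delta>)\<close>, with the short arc evaluated
    through its primitive. In this form it also makes sense at \<delta> = 0.\<close>
  define L where "L \<delta> = Ln ((xi (s + \<epsilon>))\<^sup>2 + (of_real \<delta>)\<^sup>2) - Ln ((xi (s - \<epsilon>))\<^sup>2 + (of_real \<delta>)\<^sup>2)
      + (integral arc (?K \<delta>) + integral arc (?K (- \<delta>)))" for \<delta> :: real
  have L_V: "L \<delta> \<in> V" if \<delta>: "0 < \<delta>" "\<delta> \<le> \<delta>1" for \<delta>
  proof -
    have av: "zp \<delta> \<notin> range g" "zp (-\<delta>) \<notin> range g"
      using avoid[of \<delta>] avoid[of "-\<delta>"] \<delta> by simp_all
    have int: "?K \<delta>' integrable_on {a..b}" if "zp \<delta>' \<notin> range g" for \<delta>' a b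
      using that by (intro integrable_continuous_interval off_curve_integrand_continuous) auto
    have "((\<lambda>t. ?K \<delta> t + ?K (-\<delta>) t) has_integral
        Ln ((xi (s + \<epsilon>))\<^sup>2 + (of_real \<delta>)\<^sup>2) - Ln ((xi (s - \<epsilon>))\<^sup>2 + (of_real \<delta>)\<^sup>2)) {s - \<epsilon>..s + \<epsilon>}"
    proof (rule fundamental_theorem_of_calculus[where f = "\<lambda>t. Ln ((xi t)\<^sup>2 + (of_real \<delta>)\<^sup>2)"])
      fix t assume t: "t \<in> {s - \<epsilon>..s + \<epsilon>}"
      define h where "h w = Ln (((w - g s) / g1 s)\<^sup>2 + (of_real \<delta>)\<^sup>2)" for w
      have Re: "Re (((g t - g s) / g1 s)\<^sup>2 + (of_real \<delta>)\<^sup>2) > 0"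
      proof -
        have "0 \<le> Re (((g t - g s) / g1 s)\<^sup>2)"
          using Re2'[of t] t by (auto simp: xi abs_le_iff)
        moreover have "0 < Re ((of_real \<delta>)\<^sup>2)"
          using \<delta>(1) by (simp add: power2_eq_square)
        ultimately show ?thesis unfolding plus_complex.sel by linarith
      qed
      then have nr: "((g t - g s) / g1 s)\<^sup>2 + (of_real \<delta>)\<^sup>2 \<notin> \<real>\<^sub>\<le>\<^sub>0"
        by (auto simp: complex_nonpos_Reals_iff)
      have h: "(h has_field_derivative (2 * ((g t - g s) / g1 s) / g1 s) / (((g t - g s) / g1 s)\<^sup>2 + (of_real \<delta>)\<^sup>2)) (at (g t))"
      proof -
        have dv: "((\<lambda>w. (w - g s) / g1 s) has_field_derivative 1 / g1 s) (at (g t))"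
          using nz[of s] by (auto intro!: derivative_eq_intros)
        have "((\<lambda>w. ((w - g s) / g1 s)\<^sup>2 + (of_real \<delta>)\<^sup>2) has_field_derivative 2 * ((g t - g s) / g1 s) / g1 s) (at (g t))"
          using DERIV_add[OF DERIV_power[OF dv, of 2] DERIV_const[of "(of_real \<delta>)\<^sup>2"]] by simp
        from DERIV_chain2[OF has_field_derivative_Ln[OF nr] this]
        show ?thesis unfolding h_def by (simp add: field_simps)
      qed
      have alg: "(2 * ((g t - g s) / g1 s) / g1 s) / (((g t - g s) / g1 s)\<^sup>2 + (of_real \<delta>)\<^sup>2)
          = 1 / (g t - zp \<delta>) + 1 / (g t - zp (-\<delta>))"
      proof -
        define u c where "u = g t - g s" and "c = g1 s"
        have c: "c \<noteq> 0" using nz by (simp add: c_def)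
        have ne: "u - \<i> * of_real \<delta> * c \<noteq> 0" "u + \<i> * of_real \<delta> * c \<noteq> 0"
          using av[THEN contrapos_nn, of "g t = zp \<delta>"] av(1,2) by (auto simp: u_def c_def zp_def image_iff algebra_simps dest: spec[of _ t])
        have eq: "(u - \<i> * of_real \<delta> * c) * (u + \<i> * of_real \<delta> * c) = ((u / c)\<^sup>2 + (of_real \<delta>)\<^sup>2) * c\<^sup>2"
          using c by (simp add: power2_eq_square field_simps)
        have "1 / (u - \<i> * of_real \<delta> * c) + 1 / (u + \<i> * of_real \<delta> * c)
            = 2 * u / ((u - \<i> * of_real \<delta> * c) * (u + \<i> * of_real \<delta> * c))"
          using ne by (simp add: field_simps)
        also have "\<dots> = (2 * (u / c) / c) / ((u / c)\<^sup>2 + (of_real \<delta>)\<^sup>2)"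
          unfolding eq using c by (simp add: power2_eq_square)
        finally show ?thesis
          by (simp add: u_def c_def zp_def algebra_simps)
      qed
      have eqh: "h \<circ> g = (\<lambda>t. Ln ((xi t)\<^sup>2 + (of_real \<delta>)\<^sup>2))"
        unfolding h_def xi o_def ..
      have eqK: "g1 t * (1 / (g t - zp \<delta>) + 1 / (g t - zp (-\<delta>))) = ?K \<delta> t + ?K (-\<delta>) t"
        unfolding distrib_left by simp
      have "((\<lambda>t. Ln ((xi t)\<^sup>2 + (of_real \<delta>)\<^sup>2)) has_vector_derivative (?K \<delta> t + ?K (-\<delta>) t)) (at t)"
        using field_vector_diff_chain_at[OF d1 h] unfolding alg eqh eqK .
      then show "((\<lambda>t. Ln ((xi t)\<^sup>2 + (of_real \<delta>)\<^sup>2)) has_vector_derivative (?K \<delta> t + ?K (-\<delta>) t)) (at t within {s - \<epsilon>..s + \<epsilon>})"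
        by (rule has_vector_derivative_at_within)
    qed (use \<epsilon> in simp)
    then have inner: "integral {s - \<epsilon>..s + \<epsilon>} (\<lambda>t. ?K \<delta> t + ?K (-\<delta>) t)
        = Ln ((xi (s + \<epsilon>))\<^sup>2 + (of_real \<delta>)\<^sup>2) - Ln ((xi (s - \<epsilon>))\<^sup>2 + (of_real \<delta>)\<^sup>2)"
      by (rule integral_unique)
    have comb: "integral {s - \<epsilon>..s - \<epsilon> + 2*pi} (?K \<delta>') = integral {s - \<epsilon>..s + \<epsilon>} (?K \<delta>') + integral arc (?K \<delta>')"
      if "zp \<delta>' \<notin> range g" for \<delta>'
      unfolding arc_def
      by (rule Henstock_Kurzweil_Integration.integral_combine[symmetric]) (use \<epsilon> int[OF that] in auto)
    have "L \<delta> = integral {s - \<epsilon>..s - \<epsilon> + 2*pi} (?K \<delta>) + integral {s - \<epsilon>..s - \<epsilon> + 2*pi} (?K (-\<delta>))"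
      unfolding L_def inner[symmetric] comb[OF av(1)] comb[OF av(2)]
      by (subst integral_add[OF int[OF av(1)] int[OF av(2)]]) simp
    then show ?thesis
      using winding_integral_values[OF av(1), of "s - \<epsilon>"] winding_integral_values[OF av(2), of "s - \<epsilon>"]
      by (auto simp: V_def)
  qed
  \<comment> \<open>The finite set \<open>V\<close> is closed, and \<open>L\<close> is continuous
    down to \<delta> = 0 because only the long arc, which avoids \<open>g s\<close>, is still
    integrated over.\<close>
  have "L 0 \<in> V"
  proof (rule Lim_in_closed_set)
    show "closed V" by (simp add: V_def)
    define d where "d n = \<delta>1 / real (Suc n)" for n
    have d: "d n \<in> {0<..\<delta>1}" for n
      using \<delta>1 by (auto simp: d_def field_simps)
    have d_lim: "d \<longlonglongrightarrow> 0"
      unfolding d_def using LIMSEQ_Suc[OF lim_const_over_n[of \<delta>1]] by simp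
    show "\<forall>\<^sub>F n in sequentially. L (d n) \<in> V"
      using d by (auto intro!: L_V always_eventually)
    have c_int: "continuous_on {-\<delta>1..\<delta>1} (\<lambda>\<delta>. integral arc (?K \<delta>))"
    proof -
      have "continuous_on ({-\<delta>1..\<delta>1} \<times> cbox (s + \<epsilon>) (s - \<epsilon> + 2*pi)) (\<lambda>(\<delta>, t). ?K \<delta> t)"
        unfolding split_beta zp_def
        by (intro continuous_intros continuous_on_compose2[OF g_cont[of UNIV]] continuous_on_compose2[OF g1_cont[of UNIV]])
           (use arc_avoid in \<open>auto simp: arc_def zp_def abs_le_iff\<close>)
      from integral_continuous_on_param[OF this] show ?thesis by (simp add: arc_def)
    qed
    have lim1: "(\<lambda>n. integral arc (?K (d n))) \<longlonglongrightarrow> integral arc (?K 0)"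
      by (rule continuous_on_tendsto_compose[OF c_int d_lim]) (use \<delta>1 d in \<open>auto intro!: always_eventually simp: less_imp_le order.trans[of _ 0]\<close>)
    have lim2: "(\<lambda>n. integral arc (?K (- d n))) \<longlonglongrightarrow> integral arc (?K (-0))"
      using tendsto_minus[OF d_lim]
      by (intro continuous_on_tendsto_compose[OF c_int]) (use \<delta>1 d in \<open>auto intro!: always_eventually simp: less_imp_le order.trans[of _ 0]\<close>)
    have lim3: "(\<lambda>n. Ln (w + (of_real (d n))\<^sup>2)) \<longlonglongrightarrow> Ln (w + (of_real 0)\<^sup>2)" if "Re w > 0" for w
      using that by (intro tendsto_Ln tendsto_intros d_lim) (auto simp: complex_nonpos_Reals_iff)
    show "(\<lambda>n. L (d n)) \<longlonglongrightarrow> L 0"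
      unfolding L_def using \<epsilon>(1) lim1 lim2
      by (intro tendsto_add tendsto_diff lim3 Re2) auto
  qed simp
  \<comment> \<open>Half of Ln (w^2) is a logarithm of w if Re w > 0. At
    \<open>s - \<epsilon>\<close> it is therefore a logarithm of - xi, and this sign produces -1. It
    excludes the totals 0 and - 4 * pi * \<open>\<i>\<close>, so nothing has to be decided about
    which of the two points lies inside.\<close>
  moreover have "exp (L 0 / 2) = -1"
  proof -
    have half: "exp (Ln (w\<^sup>2) / 2) = w" if "Re w > 0" for w
    proof -
      have "w \<noteq> 0" using that by auto
      then show ?thesis
        using csqrt_square[of w] csqrt_exp_Ln[of "w\<^sup>2"] that by simp
    qed
    have av0: "g s \<notin> g ` arc"
      using arc_avoid[of _ 0] \<delta>1 unfolding zp_def by force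
    have "exp (integral arc (?K 0)) = (g (s - \<epsilon> + 2*pi) - g s) / (g (s + \<epsilon>) - g s)"
      unfolding arc_def zp_def
      using exp_integral[of "s + \<epsilon>" "s - \<epsilon> + 2*pi" "g s"] av0 \<epsilon> by (simp add: arc_def)
    also have "\<dots> = xi (s - \<epsilon>) / xi (s + \<epsilon>)"
      using nz[of s] by (simp add: xi per)
    finally have e1: "exp (integral arc (?K 0)) = xi (s - \<epsilon>) / xi (s + \<epsilon>)" .
    have e2: "exp (Ln ((xi (s - \<epsilon>))\<^sup>2) / 2) = - xi (s - \<epsilon>)"
      using half[of "- xi (s - \<epsilon>)"] Rem by simp
    have "L 0 / 2 = Ln ((xi (s + \<epsilon>))\<^sup>2) / 2 - Ln ((xi (s - \<epsilon>))\<^sup>2) / 2 + integral arc (?K 0)"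
      by (simp add: L_def field_simps)
    then have "exp (L 0 / 2) = xi (s + \<epsilon>) / (- xi (s - \<epsilon>)) * (xi (s - \<epsilon>) / xi (s + \<epsilon>))"
      by (simp only: exp_add exp_diff half[OF Rep] e1 e2)
    also have "\<dots> = -1"
      using Rep Rem by (auto simp: field_simps)
    finally show ?thesis .
  qed
  ultimately have "L 0 = - 2 * pi * \<i>"
  proof -
    have "exp (- 4 * pi * \<i> / 2) = 1"
      using exp_two_pi_i by (simp add: exp_minus mult_ac)
    then have "L 0 \<noteq> - 4 * pi * \<i>"
      using \<open>exp (L 0 / 2) = -1\<close> by (metis one_neq_neg_one)
    moreover have "L 0 \<noteq> 0"
      using \<open>exp (L 0 / 2) = -1\<close> by auto
    ultimately show ?thesis using \<open>L 0 \<in> V\<close> by (simp add: V_def)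
  qed
  then show ?thesis
    by (simp add: L_def zp_def arc_def)
qed

text \<open>As \<epsilon> tends to 0 in \<open>principal_value_constant\<close>, the arguments of
  both logarithms tend to 0, because the secant quotient \<open>a\<close> tends to 1, and the
  integral over the long arc tends to the full integral of the continuous kernel. Divided by pi, the
  result is the contribution -1 of a curve to \<open>N 1\<close> at its own points.\<close>

lemma Im_kernel_mass:
  assumes s: "s \<in> {0..2*pi}"
  shows "integral {0..2*pi} (\<lambda>t. Im (g1 t / (g t - g s))) = - pi"
proof -
  define a where "a t = secant s t / g1 s" for t
  have a_cont: "continuous_on UNIV a"
  proof -
    have "continuous_on UNIV (\<lambda>t. (s, t))" by (intro continuous_intros)
    from continuous_on_compose2[OF secant_cont[of UNIV] this] have "continuous_on UNIV (secant s)" by simp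
    then show ?thesis unfolding a_def using nz by (intro continuous_intros) auto
  qed
  have a_s: "a s = 1" using nz by (simp add: a_def secant_diag)
  let ?U = "{t. 0 < Re (a t)} \<inter> {t. 0 < Re ((a t)\<^sup>2)}"
  have "open ?U"
    by (intro open_Int open_Collect_less continuous_intros a_cont)
  moreover have "s \<in> ?U" by (simp add: a_s)
  ultimately obtain e where e: "e > 0" "cball s e \<subseteq> ?U"
    using open_contains_cball by blast
  \<comment> \<open>The 1 keeps the radius below pi, as \<open>principal_value_constant\<close>
    requires.\<close>
  define e0 where "e0 = min e 1"
  have e0: "0 < e0" "e0 < pi" using e(1) pi_gt3 by (auto simp: e0_def)
  have Re_a: "0 < Re (a t)" "0 < Re ((a t)\<^sup>2)" if "\<bar>t - s\<bar> \<le> e0" for t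
    using that e(2) by (auto simp: e0_def dist_real_def abs_minus_commute subset_iff)
  define xi where "xi t = (g t - g s) / g1 s" for t
  have xi_a: "xi t = of_real (t - s) * a t" for t
    by (simp add: xi_def a_def secant_eq scaleR_conv_of_real)
  have xi2: "(xi t)\<^sup>2 = of_real ((t - s)\<^sup>2) * (a t)\<^sup>2" for t
    unfolding xi_a by (simp add: power_mult_distrib)
  \<comment> \<open>The factor (t - s)^2 is real and positive and so leaves the argument unchanged;
    only the regular factor \<open>a\<close> remains.\<close>
  have Im_Ln: "Im (Ln ((xi t)\<^sup>2)) = Im (Ln ((a t)\<^sup>2))" if "t \<noteq> s" "\<bar>t - s\<bar> \<le> e0" for t
  proof -
    have "(a t)\<^sup>2 \<noteq> 0" using Re_a(2)[OF that(2)] by auto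
    then show ?thesis
      unfolding xi2 using Ln_times_of_real[of "(t - s)\<^sup>2" "(a t)\<^sup>2"] that(1)
      by (simp del: of_real_power of_real_diff)
  qed
  have neumann_kernel_s_cont: "continuous_on UNIV (neumann_kernel s)"
  proof -
    have "continuous_on UNIV (\<lambda>t. (s, t))" by (intro continuous_intros)
    from continuous_on_compose2[OF neumann_kernel_cont this] show ?thesis by simp
  qed
  have neumann_kernel_int: "neumann_kernel s integrable_on {x..y}" for x y
    by (intro integrable_continuous_interval continuous_on_subset[OF neumann_kernel_s_cont]) auto
  have eq: "Im (Ln ((a (s + \<epsilon>))\<^sup>2)) - Im (Ln ((a (s - \<epsilon>))\<^sup>2)) + 2 * integral {s + \<epsilon>..s - \<epsilon> + 2*pi} (neumann_kernel s) = - 2 * pi"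
    if \<epsilon>: "0 < \<epsilon>" "\<epsilon> \<le> e0" for \<epsilon>
  proof -
    have av: "g t \<noteq> g s" if "t \<in> {s + \<epsilon>..s - \<epsilon> + 2*pi}" for t
      using g_eq_near[of s t] that \<epsilon>(1) by auto
    have "Ln ((xi (s + \<epsilon>))\<^sup>2) - Ln ((xi (s - \<epsilon>))\<^sup>2)
      + 2 * integral {s + \<epsilon>..s - \<epsilon> + 2*pi} (\<lambda>t. g1 t / (g t - g s)) = - 2 * pi * \<i>"
    proof (rule principal_value_constant[OF \<epsilon>(1) _ xi_def])
      show "\<epsilon> < pi" using \<epsilon> e0 by simp
      show "0 < Re ((xi t)\<^sup>2)" if "\<bar>t - s\<bar> \<le> \<epsilon>" "t \<noteq> s" for t
        using that \<epsilon>(2) Re_a(2)[of t] unfolding xi2 by (simp del: of_real_power)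
      show "0 < Re (xi (s + \<epsilon>))" "Re (xi (s - \<epsilon>)) < 0"
        using \<epsilon> Re_a(1)[of "s + \<epsilon>"] Re_a(1)[of "s - \<epsilon>"] by (simp_all add: xi_a mult_neg_pos)
    qed
    from arg_cong[OF this, of Im]
    have "Im (Ln ((xi (s + \<epsilon>))\<^sup>2)) - Im (Ln ((xi (s - \<epsilon>))\<^sup>2))
      + 2 * Im (integral {s + \<epsilon>..s - \<epsilon> + 2*pi} (\<lambda>t. g1 t / (g t - g s))) = - 2 * pi"
      by simp
    moreover have "Im (integral {s + \<epsilon>..s - \<epsilon> + 2*pi} (\<lambda>t. g1 t / (g t - g s))) = integral {s + \<epsilon>..s - \<epsilon> + 2*pi} (neumann_kernel s)"
    proof -
      have "(\<lambda>t. g1 t / (g t - g s)) integrable_on {s + \<epsilon>..s - \<epsilon> + 2*pi}"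
        using av by (intro integrable_continuous_interval off_curve_integrand_continuous) force
      from integral_unique[OF has_integral_Im[OF integrable_integral[OF this]]]
      have "Im (integral {s + \<epsilon>..s - \<epsilon> + 2*pi} (\<lambda>t. g1 t / (g t - g s)))
          = integral {s + \<epsilon>..s - \<epsilon> + 2*pi} (\<lambda>t. Im (g1 t / (g t - g s)))" by simp
      also have "\<dots> = integral {s + \<epsilon>..s - \<epsilon> + 2*pi} (neumann_kernel s)"
        by (rule integral_cong) (use av in \<open>simp add: neumann_kernel_def eq_commute[of "g s"]\<close>)
      finally show ?thesis .
    qed
    ultimately show ?thesis
      using \<epsilon> by (simp add: Im_Ln)
  qed
  define d where "d n = e0 / real (Suc n)" for n
  have d: "0 < d n" "d n \<le> e0" for n
    using e0(1) by (auto simp: d_def field_simps)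
  have d_lim: "d \<longlonglongrightarrow> 0"
    unfolding d_def using LIMSEQ_Suc[OF lim_const_over_n[of e0]] by simp
  have lim_a: "(\<lambda>n. Im (Ln ((a (x n))\<^sup>2))) \<longlonglongrightarrow> 0" if "x \<longlonglongrightarrow> s" for x
  proof -
    have "(\<lambda>n. a (x n)) \<longlonglongrightarrow> a s"
      by (rule continuous_on_tendsto_compose[OF a_cont that]) auto
    then have "(\<lambda>n. Im (Ln ((a (x n))\<^sup>2))) \<longlonglongrightarrow> Im (Ln ((a s)\<^sup>2))"
      by (intro tendsto_intros) (auto simp: a_s complex_nonpos_Reals_iff)
    then show ?thesis by (simp add: a_s)
  qed
  let ?I = "\<lambda>x. integral {s..x} (neumann_kernel s)"
  have I_cont: "continuous_on {s..s + 2*pi} ?I"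
    by (rule indefinite_integral_continuous_1[OF neumann_kernel_int])
  have comb: "integral {s + \<epsilon>..s - \<epsilon> + 2*pi} (neumann_kernel s) = ?I (s - \<epsilon> + 2*pi) - ?I (s + \<epsilon>)" if "0 < \<epsilon>" "\<epsilon> \<le> e0" for \<epsilon>
    using Henstock_Kurzweil_Integration.integral_combine[OF _ _ neumann_kernel_int, of s "s + \<epsilon>" "s - \<epsilon> + 2*pi"] that e0 by simp
  have in_ivl: "s - d n + 2*pi \<in> {s..s + 2*pi}" "s + d n \<in> {s..s + 2*pi}" for n
    using d[of n] e0(2) by auto
  have "(\<lambda>n. ?I (s - d n + 2*pi) - ?I (s + d n)) \<longlonglongrightarrow> ?I (s - 0 + 2*pi) - ?I (s + 0)"
    by (intro tendsto_diff continuous_on_tendsto_compose[OF I_cont] tendsto_intros d_lim always_eventually allI in_ivl) auto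
  then have lim_I: "(\<lambda>n. integral {s + d n..s - d n + 2*pi} (neumann_kernel s)) \<longlonglongrightarrow> ?I (s + 2*pi)"
    by (simp add: comb d)
  have "(\<lambda>n. s + d n) \<longlonglongrightarrow> s + 0" "(\<lambda>n. s - d n) \<longlonglongrightarrow> s - 0"
    by (intro tendsto_intros d_lim)+
  then have "(\<lambda>n. Im (Ln ((a (s + d n))\<^sup>2)) - Im (Ln ((a (s - d n))\<^sup>2)) + 2 * integral {s + d n..s - d n + 2*pi} (neumann_kernel s))
      \<longlonglongrightarrow> 0 - 0 + 2 * ?I (s + 2*pi)"
    by (intro tendsto_add tendsto_diff tendsto_mult tendsto_const lim_a lim_I) auto
  then have "(\<lambda>n. - 2 * pi) \<longlonglongrightarrow> 2 * ?I (s + 2*pi)"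
    by (simp only: eq[OF d]) simp
  then have "?I (s + 2*pi) = - pi"
    using LIMSEQ_unique[OF _ tendsto_const, of "- 2 * pi"] by (simp add: LIMSEQ_const_iff)
  moreover have "neumann_kernel s (t + 2*pi) = neumann_kernel s t" for t
    by (simp add: neumann_kernel_def per g1_per)
  ultimately have "integral {0..2*pi} (neumann_kernel s) = - pi"
    using periodic_integral_shift[OF neumann_kernel_s_cont, of "2*pi" s] by simp
  moreover have "integral {0..2*pi} (\<lambda>t. Im (g1 t / (g t - g s))) = integral {0..2*pi} (neumann_kernel s)"
  proof (rule integral_spike[of "{s, 0, 2*pi}"])
    fix t assume t: "t \<in> {0..2*pi} - {s, 0, 2*pi}"
    then have "\<bar>t - s\<bar> < 2*pi" using s by (simp add: abs_less_iff)
    then have "g s \<noteq> g t" using g_eq_near[of s t] t by auto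
    then show "neumann_kernel s t = Im (g1 t / (g t - g s))" by (simp add: neumann_kernel_def)
  qed simp
  ultimately show ?thesis by simp
qed

end

section \<open>Hoelder regularity along the boundary\<close>

definition holder_on_J :: "(real \<Rightarrow> real) \<Rightarrow> bool" where
  "holder_on_J f \<longleftrightarrow> (\<exists>\<alpha> C. 0 < \<alpha> \<and> \<alpha> \<le> 1 \<and>
     (\<forall>s\<in>{0..2*pi}. \<forall>t\<in>{0..2*pi}. \<bar>f s - f t\<bar> \<le> C * \<bar>s - t\<bar> powr \<alpha>))"

text \<open>Brings Hoelder conditions with different exponents on a bounded interval to a common
  exponent, so that they can be added.\<close>

lemma holder_exponent_decrease:
  fixes x L \<alpha> \<beta> :: real
  assumes "0 < \<beta>" "\<beta> \<le> \<alpha>" "0 \<le> x" "x \<le> L"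
  shows "x powr \<alpha> \<le> L powr (\<alpha> - \<beta>) * x powr \<beta>"
proof -
  have "x powr \<alpha> = x powr (\<alpha> - \<beta>) * x powr \<beta>"
    by (simp flip: powr_add)
  also have "\<dots> \<le> L powr (\<alpha> - \<beta>) * x powr \<beta>"
    using assms by (intro mult_right_mono powr_mono2) auto
  finally show ?thesis .
qed

lemma holder_on_J_add:
  assumes "holder_on_J f" "holder_on_J g"
  shows "holder_on_J (\<lambda>t. f t + g t)"
proof -
  obtain a C b D where f: "0 < a" "a \<le> 1" "\<And>s t. s \<in> {0..2*pi} \<Longrightarrow> t \<in> {0..2*pi} \<Longrightarrow> \<bar>f s - f t\<bar> \<le> C * \<bar>s - t\<bar> powr a"
    and g: "0 < b" "b \<le> 1" "\<And>s t. s \<in> {0..2*pi} \<Longrightarrow> t \<in> {0..2*pi} \<Longrightarrow> \<bar>g s - g t\<bar> \<le> D * \<bar>s - t\<bar> powr b"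
    using assms unfolding holder_on_J_def by metis
  define c where "c = min a b"
  have c: "0 < c" "c \<le> a" "c \<le> b" using f g by (auto simp: c_def)
  have "\<bar>(f s + g s) - (f t + g t)\<bar> \<le> (\<bar>C\<bar> * (2*pi) powr (a - c) + \<bar>D\<bar> * (2*pi) powr (b - c)) * \<bar>s - t\<bar> powr c"
    if st: "s \<in> {0..2*pi}" "t \<in> {0..2*pi}" for s t
  proof -
    have x: "0 \<le> \<bar>s - t\<bar>" "\<bar>s - t\<bar> \<le> 2*pi" using st by auto
    have "\<bar>f s - f t\<bar> \<le> \<bar>C\<bar> * \<bar>s - t\<bar> powr a"
      using f(3)[OF st] by (rule order_trans) (simp add: mult_right_mono)
    also have "\<dots> \<le> \<bar>C\<bar> * ((2*pi) powr (a - c) * \<bar>s - t\<bar> powr c)"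
      by (intro mult_left_mono holder_exponent_decrease c x) auto
    finally have 1: "\<bar>f s - f t\<bar> \<le> \<bar>C\<bar> * ((2*pi) powr (a - c) * \<bar>s - t\<bar> powr c)" .
    have "\<bar>g s - g t\<bar> \<le> \<bar>D\<bar> * \<bar>s - t\<bar> powr b"
      using g(3)[OF st] by (rule order_trans) (simp add: mult_right_mono)
    also have "\<dots> \<le> \<bar>D\<bar> * ((2*pi) powr (b - c) * \<bar>s - t\<bar> powr c)"
      by (intro mult_left_mono holder_exponent_decrease c x) auto
    finally have 2: "\<bar>g s - g t\<bar> \<le> \<bar>D\<bar> * ((2*pi) powr (b - c) * \<bar>s - t\<bar> powr c)" .
    have "\<bar>(f s + g s) - (f t + g t)\<bar> \<le> \<bar>f s - f t\<bar> + \<bar>g s - g t\<bar>" by linarith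
    then show ?thesis using 1 2 by (simp add: distrib_right mult.assoc)
  qed
  then show ?thesis
    unfolding holder_on_J_def using c f(2) by (meson order.trans)
qed

lemma holder_on_J_const: "holder_on_J (\<lambda>_. c)"
  unfolding holder_on_J_def by (intro exI[of _ 1] exI[of _ 0]) auto

lemma holder_on_J_cmult:
  assumes "holder_on_J f"
  shows "holder_on_J (\<lambda>t. c * f t)"
proof -
  obtain a C where f: "0 < a" "a \<le> 1" "\<And>s t. s \<in> {0..2*pi} \<Longrightarrow> t \<in> {0..2*pi} \<Longrightarrow> \<bar>f s - f t\<bar> \<le> C * \<bar>s - t\<bar> powr a"
    using assms unfolding holder_on_J_def by metis
  have "\<bar>c * f s - c * f t\<bar> \<le> (\<bar>c\<bar> * C) * \<bar>s - t\<bar> powr a" if "s \<in> {0..2*pi}" "t \<in> {0..2*pi}" for s t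
  proof -
    have "\<bar>c * f s - c * f t\<bar> = \<bar>c\<bar> * \<bar>f s - f t\<bar>"
      by (simp flip: abs_mult right_diff_distrib)
    also have "\<dots> \<le> \<bar>c\<bar> * (C * \<bar>s - t\<bar> powr a)"
      using f(3)[OF that] by (intro mult_left_mono) auto
    finally show ?thesis by (simp add: mult.assoc)
  qed
  then show ?thesis unfolding holder_on_J_def using f(1,2) by blast
qed

lemma holder_on_J_sum:
  "finite K \<Longrightarrow> (\<And>k. k \<in> K \<Longrightarrow> holder_on_J (f k)) \<Longrightarrow> holder_on_J (\<lambda>t. \<Sum>k\<in>K. f k t)"
  by (induction K rule: finite_induct) (auto intro: holder_on_J_const holder_on_J_add)

context smooth_loop
begin

lemma g_lipschitz:
  obtains L where "L > 0" "\<And>s t. s \<in> {0..2*pi} \<Longrightarrow> t \<in> {0..2*pi} \<Longrightarrow> norm (g s - g t) \<le> L * \<bar>s - t\<bar>"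
proof -
  obtain K where K: "K > 0" "\<And>t. t \<in> {0..2*pi} \<Longrightarrow> norm (g1 t) \<le> K"
    using g1_bounded by blast
  have "norm (g s - g t) \<le> K * \<bar>s - t\<bar>" if "s \<in> {0..2*pi}" "t \<in> {0..2*pi}" for s t
  proof -
    have "norm (g s - g t) \<le> K * norm (s - t)"
    proof (rule differentiable_bound[of "{0..2*pi}" g "\<lambda>x h. h *\<^sub>R g1 x"])
      show "(g has_derivative (\<lambda>h. h *\<^sub>R g1 x)) (at x within {0..2*pi})" for x
        using d1[of x] has_derivative_at_withinI by (auto simp: has_vector_derivative_def)
      show "onorm (\<lambda>h. h *\<^sub>R g1 x) \<le> K" if "x \<in> {0..2*pi}" for x
        using K(2)[OF that] by (intro onorm_le) (simp add: mult.commute[of K] mult_left_mono)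
    qed (use that in auto)
    then show ?thesis by simp
  qed
  then show ?thesis using that K(1) by blast
qed

lemma holder_along_curve:
  assumes "0 < \<beta>" "\<beta> \<le> 1" "0 \<le> C"
    and u: "\<And>s t. s \<in> {0..2*pi} \<Longrightarrow> t \<in> {0..2*pi} \<Longrightarrow> \<bar>u s - u t\<bar> \<le> C * norm (g s - g t) powr \<beta>"
  shows "holder_on_J u"
proof -
  obtain L where L: "L > 0" "\<And>s t. s \<in> {0..2*pi} \<Longrightarrow> t \<in> {0..2*pi} \<Longrightarrow> norm (g s - g t) \<le> L * \<bar>s - t\<bar>"
    using g_lipschitz by blast
  have "\<bar>u s - u t\<bar> \<le> (C * L powr \<beta>) * \<bar>s - t\<bar> powr \<beta>" if st: "s \<in> {0..2*pi}" "t \<in> {0..2*pi}" for s t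
  proof -
    have "norm (g s - g t) powr \<beta> \<le> (L * \<bar>s - t\<bar>) powr \<beta>"
      using L(2)[OF st] assms by (intro powr_mono2) auto
    also have "\<dots> = L powr \<beta> * \<bar>s - t\<bar> powr \<beta>"
      using L(1) by (simp add: powr_mult)
    finally have "C * norm (g s - g t) powr \<beta> \<le> C * (L powr \<beta> * \<bar>s - t\<bar> powr \<beta>)"
      using assms by (intro mult_left_mono)
    then show ?thesis using u[OF st] by (simp add: mult.assoc)
  qed
  then show ?thesis unfolding holder_on_J_def using assms by blast
qed

lemma finite_preimage: "finite {t \<in> {0..2*pi}. g t = z}"
proof -
  have "finite (g -` {z} \<inter> {0..<2*pi})"
    by (rule finite_vimage_IntI[OF _ inj]) simp
  moreover have "{t \<in> {0..2*pi}. g t = z} \<subseteq> insert (2*pi) (g -` {z} \<inter> {0..<2*pi})" by auto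
  ultimately show ?thesis by (meson finite_insert finite_subset)
qed

text \<open>Interpolation between the bound on the kernel and the bound on the difference of two Cauchy kernels
  leaves an integrable singularity.\<close>

lemma Im_kernel_interpolate:
  assumes t: "norm (g1 t) \<le> K" "K > 0" and ne: "g t \<noteq> z" "g t \<noteq> w"
    and C: "C > 0" "\<bar>Im (g1 t / (g t - z))\<bar> \<le> C" "\<bar>Im (g1 t / (g t - w))\<bar> \<le> C"
  shows "\<bar>Im (g1 t / (g t - z)) - Im (g1 t / (g t - w))\<bar>
    \<le> (2 * C) powr (3/4) * K powr (1/4) * norm (z - w) powr (1/4)
        * (norm (g t - z) powr (-(1/2)) + norm (g t - w) powr (-(1/2)))"
proof -
  define x where "x = \<bar>Im (g1 t / (g t - z)) - Im (g1 t / (g t - w))\<bar>"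
  define a b where "a = norm (g t - z)" and "b = norm (g t - w)"
  have ab: "a > 0" "b > 0" using ne by (auto simp: a_def b_def)
  have "x \<le> norm (g1 t / (g t - z) - g1 t / (g t - w))"
    unfolding x_def using abs_Im_le_cmod[of "g1 t / (g t - z) - g1 t / (g t - w)"] by simp
  also have "g1 t / (g t - z) - g1 t / (g t - w) = g1 t * (z - w) / ((g t - z) * (g t - w))"
    using ne by (simp add: field_simps)
  also have "norm \<dots> = norm (g1 t) * norm (z - w) / (a * b)"
    by (simp add: norm_mult norm_divide a_def b_def)
  also have "\<dots> \<le> K * norm (z - w) / (a * b)"
    using t ab by (intro divide_right_mono mult_right_mono) auto
  finally have x1: "x \<le> K * norm (z - w) / (a * b)" .
  have x2: "x \<le> 2 * C" using C unfolding x_def by linarith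
  have x0: "0 \<le> x" by (simp add: x_def)
  have ab_le: "(1 / (a * b)) powr (1/4) \<le> a powr (-(1/2)) + b powr (-(1/2))"
  proof -
    define c where "c = min a b"
    have c: "0 < c" "c \<le> a" "c \<le> b" using ab by (auto simp: c_def)
    have "(1 / (a * b)) powr (1/4) \<le> (1 / (c * c)) powr (1/4)"
      using c by (intro powr_mono2 divide_left_mono mult_mono) auto
    also have "\<dots> = c powr (-(1/2))"
    proof -
      have "1 / (c * c) = c powr (-2)"
        using c by (simp add: powr_minus powr_numeral power2_eq_square field_simps)
      then show ?thesis by (simp add: powr_powr)
    qed
    also have "\<dots> \<le> a powr (-(1/2)) + b powr (-(1/2))"
      by (auto simp: c_def min_def)
    finally show ?thesis .
  qed
  \<comment> \<open>The weight 1/4 on the singular bound leaves (a * b) powr (-1/4), which is at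
    most min a b powr (-1/2) and hence integrable. Some power of |z - w| survives, and that is all
    that is wanted.\<close>
  have "x = x powr (3/4) * x powr (1/4)"
    using x0 by (cases "x = 0") (auto simp flip: powr_add)
  also have "\<dots> \<le> (2 * C) powr (3/4) * (K * norm (z - w) / (a * b)) powr (1/4)"
    using x0 x1 x2 by (intro mult_mono powr_mono2) auto
  also have "\<dots> = (2 * C) powr (3/4) * (K powr (1/4) * norm (z - w) powr (1/4) * (1 / (a * b)) powr (1/4))"
    using t ab powr_mult[of "K * norm (z - w)" "1 / (a * b)" "1/4"] powr_mult[of K "norm (z - w)" "1/4"] by simp
  also have "\<dots> \<le> (2 * C) powr (3/4) * (K powr (1/4) * norm (z - w) powr (1/4) * (a powr (-(1/2)) + b powr (-(1/2))))"
    by (intro mult_left_mono ab_le) auto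
  finally show ?thesis unfolding x_def a_def b_def by (simp add: mult.assoc)
qed

text \<open>Integrating the interpolated bound against a bounded density gives a Hoelder function of
  the singular point. This smoothing lifts continuous solutions into \<open>H\<close>. The set
  \<open>Z\<close> is where the kernel is uniformly bounded; it will be one of the curves.\<close>

lemma Im_potential_holder:
  assumes f: "f \<in> borel_measurable (lebesgue_on {0..2*pi})" "\<And>t. t \<in> {0..2*pi} \<Longrightarrow> \<bar>f t\<bar> \<le> Q"
    and C: "C > 0" "\<And>z t. z \<in> Z \<Longrightarrow> t \<in> {0..2*pi} \<Longrightarrow> \<bar>Im (g1 t / (g t - z))\<bar> \<le> C"
  shows "\<exists>D\<ge>0. \<forall>z\<in>Z. \<forall>w\<in>Z.
    \<bar>integral {0..2*pi} (\<lambda>t. Im (g1 t / (g t - z)) * f t) - integral {0..2*pi} (\<lambda>t. Im (g1 t / (g t - w)) * f t)\<bar>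
      \<le> D * norm (z - w) powr (1/4)"
proof -
  obtain K where K: "K > 0" "\<And>t. t \<in> {0..2*pi} \<Longrightarrow> norm (g1 t) \<le> K"
    using g1_bounded by blast
  let ?r = "\<lambda>z t. norm (g t - z) powr (-(1/2))"
  obtain W where W: "W > 0" "\<And>z. ?r z integrable_on {0..2*pi}" "\<And>z. integral {0..2*pi} (?r z) \<le> W"
    using riesz_potential_bounded[of "1/2"] by auto
  define k where "k = (2 * C) powr (3/4) * K powr (1/4) * \<bar>Q\<bar>"
  have k: "k \<ge> 0" by (simp add: k_def)
  have int: "(\<lambda>t. Im (g1 t / (g t - z)) * f t) integrable_on {0..2*pi}" if "z \<in> Z" for z
  proof (rule measurable_bounded_by_integrable_imp_integrable)
    show "(\<lambda>t. Im (g1 t / (g t - z)) * f t) \<in> borel_measurable (lebesgue_on {0..2*pi})"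
      by (intro borel_measurable_times Im_kernel_measurable f)
    show "(\<lambda>t. C * \<bar>Q\<bar>) integrable_on {0..2*pi}" by (rule integrable_const_ivl)
    show "norm (Im (g1 t / (g t - z)) * f t) \<le> C * \<bar>Q\<bar>" if "t \<in> {0..2*pi}" for t
      unfolding real_norm_def abs_mult using C(1) C(2)[OF \<open>z \<in> Z\<close> that] f(2)[OF that]
      by (intro mult_mono) auto
  qed simp
  have "\<bar>integral {0..2*pi} (\<lambda>t. Im (g1 t / (g t - z)) * f t) - integral {0..2*pi} (\<lambda>t. Im (g1 t / (g t - w)) * f t)\<bar>
      \<le> (k * (W + W)) * norm (z - w) powr (1/4)" if zw: "z \<in> Z" "w \<in> Z" for z w
  proof -
    \<comment> \<open>The interpolated bound fails where a denominator vanishes. By injectivity this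
      happens for finitely many \<open>t\<close>, and the integrand may be replaced by 0
      there.\<close>
    define E where "E = {t \<in> {0..2*pi}. g t = z} \<union> {t \<in> {0..2*pi}. g t = w}"
    have E: "finite E" unfolding E_def by (intro finite_UnI finite_preimage)
    define dif where "dif t = Im (g1 t / (g t - z)) * f t - Im (g1 t / (g t - w)) * f t" for t
    define dif' where "dif' t = (if t \<in> E then 0 else dif t)" for t
    let ?d = "k * norm (z - w) powr (1/4)"
    have dif_int: "dif integrable_on {0..2*pi}"
      unfolding dif_def by (intro integrable_diff int zw)
    have dif'_int: "dif' integrable_on {0..2*pi}"
      by (rule integrable_spike_finite[OF E _ dif_int]) (simp add: dif'_def)
    have "integral {0..2*pi} dif = integral {0..2*pi} dif'"
      by (rule integral_spike[OF negligible_finite[OF E]]) (simp add: dif'_def)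
    moreover have "integral {0..2*pi} dif = integral {0..2*pi} (\<lambda>t. Im (g1 t / (g t - z)) * f t) - integral {0..2*pi} (\<lambda>t. Im (g1 t / (g t - w)) * f t)"
      unfolding dif_def by (rule integral_diff[OF int[OF zw(1)] int[OF zw(2)]])
    moreover have "norm (integral {0..2*pi} dif') \<le> integral {0..2*pi} (\<lambda>t. ?d * (?r z t + ?r w t))"
    proof (rule integral_norm_bound_integral[OF dif'_int])
      show "(\<lambda>t. ?d * (?r z t + ?r w t)) integrable_on {0..2*pi}"
        by (intro integrable_on_cmult_left[where 'b = real, simplified] integrable_add W)
      fix t assume t: "t \<in> {0..2*pi}"
      show "norm (dif' t) \<le> ?d * (?r z t + ?r w t)"
      proof (cases "t \<in> E")
        case True
        then show ?thesis using k by (simp add: dif'_def)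
      next
        case False
        then have ne: "g t \<noteq> z" "g t \<noteq> w" using t by (auto simp: E_def)
        have "norm (dif' t) = \<bar>Im (g1 t / (g t - z)) - Im (g1 t / (g t - w))\<bar> * \<bar>f t\<bar>"
          using False by (simp add: dif'_def dif_def flip: abs_mult left_diff_distrib)
        also have "\<dots> \<le> ((2 * C) powr (3/4) * K powr (1/4) * norm (z - w) powr (1/4) * (?r z t + ?r w t)) * \<bar>Q\<bar>"
          using f(2)[OF t] C(1)
          by (intro mult_mono Im_kernel_interpolate K(2)[OF t] K(1) ne C zw t) auto
        finally show ?thesis by (simp add: k_def mult_ac)
      qed
    qed
    moreover have "integral {0..2*pi} (\<lambda>t. ?d * (?r z t + ?r w t)) \<le> ?d * (W + W)"
      unfolding integral_mult_right integral_add[OF W(2) W(2)]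
      by (rule mult_left_mono[OF add_mono[OF W(3) W(3)]]) (use k in simp)
    moreover have "?d * (W + W) = (k * (W + W)) * norm (z - w) powr (1/4)"
      by simp
    ultimately show ?thesis
      unfolding real_norm_def by linarith
  qed
  then show ?thesis using k W(1) by (intro exI[of _ "k * (W + W)"]) auto
qed

section \<open>Cauchy integrals off the curve and at infinity\<close>

lemma cauchy_integral_holomorphic:
  assumes h: "continuous_on {0..2*pi} h" and U: "open U" "U \<inter> g ` {0..2*pi} = {}"
  shows "(\<lambda>z. integral {0..2*pi} (\<lambda>t. h t * g1 t / (g t - z))) holomorphic_on U"
  unfolding holomorphic_on_def
proof
  fix x assume "x \<in> U"
  then obtain e where e: "e > 0" "ball x e \<subseteq> U"
    using U(1) open_contains_ball by blast
  have ne: "g t - z \<noteq> 0" if "z \<in> ball x e" "t \<in> {0..2*pi}" for z t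
    using that e(2) U(2) by force
  \<comment> \<open>On a ball, which is convex, one may differentiate under the integral
    sign.\<close>
  have "(\<lambda>z. integral (cbox 0 (2*pi)) (\<lambda>t. h t * g1 t / (g t - z))) holomorphic_on ball x e"
  proof (rule leibniz_rule_holomorphic[where fx = "\<lambda>z t. h t * g1 t / (g t - z)\<^sup>2"])
    show "((\<lambda>z. h t * g1 t / (g t - z)) has_field_derivative h t * g1 t / (g t - z)\<^sup>2) (at z within ball x e)"
      if "z \<in> ball x e" "t \<in> cbox 0 (2*pi)" for z t
      using ne[OF that(1), of t] that(2)
      by (auto intro!: derivative_eq_intros simp: power2_eq_square)
    show "(\<lambda>t. h t * g1 t / (g t - z)) integrable_on cbox 0 (2*pi)" if "z \<in> ball x e" for z
      using ne[OF that] by (intro integrable_continuous continuous_intros g_cont g1_cont) (auto simp: h)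
    have "continuous_on (ball x e \<times> {0..2*pi}) (\<lambda>p. h (snd p))"
      by (rule continuous_on_compose2[OF h]) (auto intro: continuous_intros)
    moreover have "continuous_on (ball x e \<times> {0..2*pi}) (\<lambda>p. g (snd p))" "continuous_on (ball x e \<times> {0..2*pi}) (\<lambda>p. g1 (snd p))"
      by (rule continuous_on_compose2[OF g_cont[of UNIV]] continuous_on_compose2[OF g1_cont[of UNIV]];
          auto intro: continuous_intros)+
    ultimately show "continuous_on (ball x e \<times> cbox 0 (2*pi)) (\<lambda>(z, t). h t * g1 t / (g t - z)\<^sup>2)"
      unfolding split_beta using ne by (intro continuous_intros) auto
  qed simp
  then have "(\<lambda>z. integral {0..2*pi} (\<lambda>t. h t * g1 t / (g t - z))) field_differentiable at x"
    using e(1) by (simp add: holomorphic_on_imp_differentiable_at)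
  then show "(\<lambda>z. integral {0..2*pi} (\<lambda>t. h t * g1 t / (g t - z))) field_differentiable at x within U"
    by (rule field_differentiable_at_within)
qed

lemma cauchy_integral_at_infinity:
  assumes h: "continuous_on {0..2*pi} h"
  shows "((\<lambda>z. integral {0..2*pi} (\<lambda>t. h t * g1 t / (g t - z))) \<longlongrightarrow> 0) at_infinity"
proof -
  have "bounded ((\<lambda>t. h t * g1 t) ` {0..2*pi})"
    by (intro compact_imp_bounded compact_continuous_image continuous_intros h g1_cont compact_Icc)
  then obtain H where H: "H > 0" "\<And>t. t \<in> {0..2*pi} \<Longrightarrow> norm (h t * g1 t) \<le> H"
    unfolding bounded_pos by blast
  have "bounded (g ` {0..2*pi})"
    by (intro compact_imp_bounded compact_continuous_image g_cont compact_Icc)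
  then obtain R where R: "R > 0" "\<And>t. t \<in> {0..2*pi} \<Longrightarrow> norm (g t) \<le> R"
    unfolding bounded_pos by blast
  show ?thesis
  proof (rule Lim_null_comparison)
    have "norm (integral {0..2*pi} (\<lambda>t. h t * g1 t / (g t - z))) \<le> H / (norm z - R) * (2*pi - 0)"
      if z: "R + 1 \<le> norm z" for z
    proof (rule integral_bound)
      have ge: "norm z - R \<le> norm (g t - z)" if "t \<in> {0..2*pi}" for t
        using norm_triangle_ineq2[of z "g t"] R(2)[OF that] by (simp add: norm_minus_commute)
      have pos: "0 < norm z - R" using z by simp
      have ne: "g t - z \<noteq> 0" if "t \<in> {0..2*pi}" for t
        using ge[OF that] pos by auto
      then show "continuous_on {0..2*pi} (\<lambda>t. h t * g1 t / (g t - z))"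
        by (intro continuous_intros h g_cont g1_cont) auto
      show "norm (h t * g1 t / (g t - z)) \<le> H / (norm z - R)" if "t \<in> {0..2*pi}" for t
        unfolding norm_divide using H(1) H(2)[OF that] ge[OF that] pos by (intro frac_le) auto
    qed simp
    then show "\<forall>\<^sub>F z in at_infinity. norm (integral {0..2*pi} (\<lambda>t. h t * g1 t / (g t - z))) \<le> H / (norm z - R) * (2*pi - 0)"
      by (auto simp: eventually_at_infinity)
    have "filterlim (\<lambda>z::complex. - R + norm z) at_top at_infinity"
      by (rule filterlim_tendsto_add_at_top[OF tendsto_const filterlim_norm_at_top])
    then have "((\<lambda>z::complex. H / (- R + norm z)) \<longlongrightarrow> 0) at_infinity"
      by (rule real_tendsto_divide_at_top[OF tendsto_const])
    from tendsto_mult_left_zero[OF this, of "2*pi - 0"]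
    show "((\<lambda>z::complex. H / (norm z - R) * (2*pi - 0)) \<longlongrightarrow> 0) at_infinity"
      by simp
  qed
qed

end

section \<open>The exterior domain\<close>

locale exterior_domain =
  fixes G :: "complex set" and m :: nat and eta :: "nat \<Rightarrow> real \<Rightarrow> complex"
  assumes adm: "admissible_domain G m eta"
begin

definition eta1 :: "nat \<Rightarrow> real \<Rightarrow> complex" where
  "eta1 k t = vector_derivative (eta k) (at t)"

definition eta2 :: "nat \<Rightarrow> real \<Rightarrow> complex" where
  "eta2 k t = vector_derivative (eta1 k) (at t)"

abbreviation Gam :: "nat \<Rightarrow> complex set" where
  "Gam k \<equiv> eta k ` {0..2*pi}"

lemma m_ge: "m \<ge> 1" and G_open: "open G" and G_conn: "connected G" and G_bdd: "bounded (- G)"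
  and G_frontier: "frontier G = bdry eta m"
  using adm by (simp_all add: admissible_domain_def)

lemma Gam_disjoint: "k \<in> {1..m} \<Longrightarrow> l \<in> {1..m} \<Longrightarrow> k \<noteq> l \<Longrightarrow> Gam k \<inter> Gam l = {}"
  using adm unfolding admissible_domain_def by blast

lemma path_image_curve: "path_image (curve_path eta k) = Gam k"
proof -
  have "(\<lambda>s. 2 * pi * s) ` {0..1} = {0..2*pi}"
    by (simp add: image_mult_atLeastAtMost)
  then show ?thesis
    unfolding path_image_def curve_path_def by (metis image_image)
qed

lemma loop:
  assumes k: "k \<in> {1..m}"
  shows "clockwise_loop (eta k) (eta1 k) (eta2 k)"
proof -
  have "C2_curve (eta k)" using adm k unfolding admissible_domain_def by blast
  then obtain a b where a: "\<And>t. (eta k has_vector_derivative a t) (at t)"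
    and b: "\<And>t. (a has_vector_derivative b t) (at t)" and c: "continuous_on UNIV b"
    unfolding C2_curve_def by blast
  have a_eq: "eta1 k = a" using a by (auto simp: eta1_def fun_eq_iff intro: vector_derivative_at)
  have b_eq: "eta2 k = b" using b by (auto simp: eta2_def a_eq fun_eq_iff intro: vector_derivative_at)
  have nz: "eta1 k t \<noteq> 0" for t
    using adm k unfolding admissible_domain_def eta1_def by blast
  show ?thesis
  proof
    show "winding_number (\<lambda>s. eta k (2 * pi * s)) z = 0 \<or> winding_number (\<lambda>s. eta k (2 * pi * s)) z = -1"
      if "z \<notin> Gam k" for z
      using adm k that path_image_curve[of k] unfolding admissible_domain_def curve_path_def by blast
  qed (use a b c nz adm k in \<open>auto simp: a_eq b_eq admissible_domain_def\<close>)
qed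

abbreviation cauchy_diffs :: "nat \<Rightarrow> (complex \<Rightarrow> real) \<Rightarrow> complex \<Rightarrow> complex" where
  "cauchy_diffs k \<equiv> smooth_loop.cauchy_diff (eta k) (eta1 k)"

lemma sloop: "k \<in> {1..m} \<Longrightarrow> smooth_loop (eta k) (eta1 k) (eta2 k)"
  using loop by (simp add: clockwise_loop_def)

lemma closed_Gam: "k \<in> {1..m} \<Longrightarrow> closed (Gam k)"
  by (intro compact_imp_closed compact_continuous_image smooth_loop.g_cont[OF sloop]) auto

lemma curve_simple:
  assumes k: "k \<in> {1..m}"
  shows "simple_path (curve_path eta k)" "pathfinish (curve_path eta k) = pathstart (curve_path eta k)"
proof -
  interpret smooth_loop "eta k" "eta1 k" "eta2 k" by (rule sloop[OF k])
  have ends: "eta k (2*pi) = eta k 0" using per[of 0] by simp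
  show "pathfinish (curve_path eta k) = pathstart (curve_path eta k)"
    using ends by (simp add: pathfinish_def pathstart_def curve_path_def)
  have "path (curve_path eta k)"
    unfolding path_def curve_path_def
    by (intro continuous_on_compose2[OF g_cont[of UNIV]] continuous_intros) auto
  moreover have "x = y \<or> x = 0 \<and> y = 1 \<or> x = 1 \<and> y = 0"
    if "x \<in> {0..1}" "y \<in> {0..1}" "curve_path eta k x = curve_path eta k y" for x y
  proof (cases "\<bar>2 * pi * y - 2 * pi * x\<bar> < 2 * pi")
    case True
    then show ?thesis
      using g_eq_near[of "2 * pi * x" "2 * pi * y"] that(3) by (auto simp: curve_path_def)
  next
    case False
    then have "2 * pi * \<bar>y - x\<bar> \<ge> 2 * pi * 1"
      by (simp add: abs_mult flip: right_diff_distrib)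
    then have "\<bar>y - x\<bar> \<ge> 1"
      by (simp only: mult_le_cancel_left_pos pi_gt_zero zero_less_numeral mult_pos_pos)
    then show ?thesis using that by auto
  qed
  ultimately show "simple_path (curve_path eta k)"
    unfolding simple_path_def loop_free_def by blast
qed

section \<open>Position of the curves relative to each other and to \<open>G\<close>\<close>

lemma Gam_sub_bdry: "k \<in> {1..m} \<Longrightarrow> Gam k \<subseteq> bdry eta m"
  by (auto simp: bdry_def)

lemma G_bdry_disjoint: "G \<inter> bdry eta m = {}"
  using G_open G_frontier by (metis frontier_disjoint_eq inf_commute)

lemma closure_G: "closure G = G \<union> bdry eta m"
  using G_frontier closure_Un_frontier by metis

text \<open>\<open>G\<close> is connected, avoids the curve, and is unbounded because its complement
  is bounded; so it lies in an unbounded component of the complement of the curve.\<close>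

lemma G_sub_outside:
  assumes k: "k \<in> {1..m}"
  shows "G \<subseteq> outside (Gam k)"
proof
  fix z assume z: "z \<in> G"
  have sub: "G \<subseteq> - Gam k" using G_bdry_disjoint Gam_sub_bdry[OF k] by blast
  have "G \<subseteq> connected_component_set (- Gam k) z"
    using connected_component_maximal[OF z G_conn sub] .
  moreover have "\<not> bounded G"
  proof
    assume "bounded G"
    then have "bounded (G \<union> - G)" using G_bdd by (simp only: bounded_Un)
    then show False using not_bounded_UNIV[where 'a = complex] by (simp add: Compl_partition)
  qed
  ultimately have "\<not> bounded (connected_component_set (- Gam k) z)"
    by (meson bounded_subset)
  then show "z \<in> outside (Gam k)"
    using z sub by (auto simp: outside_def)
qed

text \<open>Every boundary curve lies in the closure of \<open>G\<close>, hence in the closure of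
  the outside of every other curve. So no curve encloses another one.\<close>

lemma Gam_sub_outside:
  assumes k: "k \<in> {1..m}" "l \<in> {1..m}" "k \<noteq> l"
  shows "Gam l \<subseteq> outside (Gam k)"
proof -
  have "Gam l \<subseteq> closure G" using Gam_sub_bdry[OF k(2)] closure_G by blast
  also have "\<dots> \<subseteq> closure (outside (Gam k))" by (intro closure_mono G_sub_outside k)
  also have "\<dots> \<subseteq> outside (Gam k) \<union> Gam k"
    using frontier_outside_subset[OF closed_Gam[OF k(1)]] closure_Un_frontier by blast
  finally show ?thesis using Gam_disjoint[OF k] by blast
qed

lemma inside_Gam:
  assumes k: "k \<in> {1..m}"
  shows "open (inside (Gam k))" "connected (inside (Gam k))" "bounded (inside (Gam k))"
    "inside (Gam k) \<noteq> {}" "frontier (inside (Gam k)) = Gam k"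
  using Jordan_inside_outside[OF curve_simple[OF k]] by (auto simp: path_image_curve)

text \<open>The inside of curve \<open>k\<close> is connected and avoids curve \<open>l\<close>, so
  one common point with the outside of \<open>l\<close> suffices. Such a point exists near
  \<open>eta k 0\<close>, which lies in that open outside and is a boundary point of the
  inside.\<close>

lemma inside_sub_outside:
  assumes k: "k \<in> {1..m}" "l \<in> {1..m}" "k \<noteq> l"
  shows "inside (Gam k) \<subseteq> outside (Gam l)"
proof
  fix z assume z: "z \<in> inside (Gam k)"
  have dis: "inside (Gam k) \<subseteq> - Gam l"
    using Gam_sub_outside[OF k] inside_Int_outside[of "Gam k"] by blast
  have "eta k 0 \<in> Gam k" by auto
  then have "eta k 0 \<in> outside (Gam l)" "eta k 0 \<in> closure (inside (Gam k))"
    using Gam_sub_outside[OF k(2,1)] k(3) inside_Gam(5)[OF k(1)] by (auto simp: frontier_def)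
  then obtain w where w: "w \<in> inside (Gam k)" "w \<in> outside (Gam l)"
    using open_outside[OF closed_Gam[OF k(2)]] open_Int_closure_eq_empty[of "outside (Gam l)" "inside (Gam k)"]
    by blast
  have "connected_component (- Gam l) w z"
    unfolding connected_component_def using inside_Gam(2)[OF k(1)] dis w(1) z by blast
  then show "z \<in> outside (Gam l)"
    using outside_same_component w(2) by blast
qed

lemma outside_mass_zero:
  assumes k: "k \<in> {1..m}" and z: "z \<in> outside (Gam k)"
  shows "integral {0..2*pi} (\<lambda>t. eta1 k t / (eta k t - z)) = 0"
proof -
  interpret smooth_loop "eta k" "eta1 k" "eta2 k" by (rule sloop[OF k])
  have "z \<notin> Gam k" using z outside_no_overlap by blast
  moreover have "winding_number (curve_path eta k) z = 0"
    using z curve_simple[OF k] by (intro winding_number_zero_in_outside) (auto simp: path_image_curve simple_path_imp_path)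
  ultimately show ?thesis
    using winding_number_integral[of z] by (simp add: curve_path_def)
qed

text \<open>A simple closed curve has winding number 1 or -1 around its inside; the orientation
  hypothesis leaves -1.\<close>

lemma inside_mass:
  assumes k: "k \<in> {1..m}" and z: "z \<in> inside (Gam k)"
  shows "integral {0..2*pi} (\<lambda>t. eta1 k t / (eta k t - z)) = - 2 * pi * \<i>"
proof -
  interpret clockwise_loop "eta k" "eta1 k" "eta2 k" by (rule loop[OF k])
  have zn: "z \<notin> Gam k" using z inside_no_overlap by blast
  have "winding_number (curve_path eta k) z \<noteq> 0"
    using simple_closed_path_winding_number_inside[OF curve_simple(1)[OF k]] z
    by (metis path_image_curve zero_neq_neg_one zero_neq_one)
  then have "winding_number (\<lambda>s. eta k (2 * pi * s)) z = -1"
    using wind[OF zn] by (simp add: curve_path_def)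
  then show ?thesis
    using winding_number_integral[OF zn] by simp
qed

section \<open>Jump relations on the system of curves\<close>

definition holder_rep :: "(nat \<Rightarrow> real \<Rightarrow> real) \<Rightarrow> (nat \<Rightarrow> complex \<Rightarrow> real) \<Rightarrow> (nat \<Rightarrow> real) \<Rightarrow> bool" where
  "holder_rep \<phi> \<Psi> \<alpha> \<longleftrightarrow> (\<forall>k\<in>{1..m}. holder_fun (\<alpha> k) (\<Psi> k) \<and> (\<forall>t\<in>{0..2*pi}. \<Psi> k (eta k t) = \<phi> k t))"

text \<open>The Hoelder condition in the parameter becomes one in the chord length, where equal end
  values enter, and is then extended to the plane. The exponent may differ from curve to
  curve.\<close>

lemma Hspace_holder_rep:
  assumes "\<phi> \<in> Hspace m"
  obtains \<Psi> \<alpha> where "holder_rep \<phi> \<Psi> \<alpha>"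
proof -
  have "\<exists>\<alpha> \<psi>. holder_fun \<alpha> \<psi> \<and> (\<forall>t\<in>{0..2*pi}. \<psi> (eta k t) = \<phi> k t)" if k: "k \<in> {1..m}" for k
  proof -
    interpret smooth_loop "eta k" "eta1 k" "eta2 k" by (rule sloop[OF k])
    obtain \<alpha> C where \<alpha>: "0 < \<alpha>" "\<alpha> \<le> 1" and per: "\<phi> k 0 = \<phi> k (2*pi)"
      and C: "\<And>s t. s \<in> {0..2*pi} \<Longrightarrow> t \<in> {0..2*pi} \<Longrightarrow> \<bar>\<phi> k s - \<phi> k t\<bar> \<le> C * \<bar>s - t\<bar> powr \<alpha>"
      using assms k unfolding Hspace_def by blast
    obtain C' where C': "0 \<le> C'" "\<And>s t. s \<in> {0..2*pi} \<Longrightarrow> t \<in> {0..2*pi} \<Longrightarrow> \<bar>\<phi> k s - \<phi> k t\<bar> \<le> C' * norm (eta k s - eta k t) powr \<alpha>"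
      using holder_on_curve[of \<alpha> "\<phi> k" C, OF \<alpha> per C] by blast
    obtain \<psi> where \<psi>: "\<And>t. t \<in> {0..2*pi} \<Longrightarrow> \<psi> (eta k t) = \<phi> k t"
      "\<And>z w. \<bar>\<psi> z - \<psi> w\<bar> \<le> C' * norm (z - w) powr \<alpha>"
      using holder_extension[of \<alpha> C' "{0..2*pi}" "\<phi> k" "eta k", OF \<alpha> C'(1) _ C'(2)] by auto
    show ?thesis
      unfolding holder_fun_def using \<alpha> C'(1) \<psi> by blast
  qed
  then obtain \<alpha> \<Psi> where "\<forall>k\<in>{1..m}. holder_fun (\<alpha> k) (\<Psi> k) \<and> (\<forall>t\<in>{0..2*pi}. \<Psi> k (eta k t) = \<phi> k t)"
    by metis
  then show ?thesis using that unfolding holder_rep_def by blast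
qed

lemma holder_rep_continuous:
  assumes rep: "holder_rep \<phi> \<Psi> \<alpha>" and k: "k \<in> {1..m}"
  shows "continuous_on {0..2*pi} (\<phi> k)"
proof -
  have h: "holder_fun (\<alpha> k) (\<Psi> k)" "\<And>t. t \<in> {0..2*pi} \<Longrightarrow> \<Psi> k (eta k t) = \<phi> k t"
    using rep k by (auto simp: holder_rep_def)
  have "continuous_on {0..2*pi} (\<lambda>t. \<Psi> k (eta k t))"
    by (rule continuous_on_compose2[OF holder_fun_continuous[OF h(1), of UNIV] smooth_loop.g_cont[OF sloop[OF k]]]) auto
  then show ?thesis by (rule continuous_on_eq) (use h(2) in auto)
qed

text \<open>This sum is continuous on the whole plane, while \<open>cauchy_sum\<close> is
  holomorphic off the boundary. They agree on \<open>G\<close> and differ by a multiple of the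
  extension inside a curve, so the pair encodes both one-sided boundary values.\<close>

definition cauchy_total :: "(nat \<Rightarrow> complex \<Rightarrow> real) \<Rightarrow> complex \<Rightarrow> complex" where
  "cauchy_total \<Psi> z = (\<Sum>k\<in>{1..m}. cauchy_diffs k (\<Psi> k) z)"

definition cauchy_sum :: "(nat \<Rightarrow> real \<Rightarrow> real) \<Rightarrow> complex \<Rightarrow> complex" where
  "cauchy_sum \<phi> z = (\<Sum>k\<in>{1..m}. integral {0..2*pi} (\<lambda>t. of_real (\<phi> k t) * eta1 k t / (eta k t - z)))"

lemma cauchy_diffs_off:
  assumes rep: "holder_rep \<phi> \<Psi> \<alpha>" and k: "k \<in> {1..m}" and z: "z \<notin> Gam k"
  shows "cauchy_diffs k (\<Psi> k) z = integral {0..2*pi} (\<lambda>t. of_real (\<phi> k t) * eta1 k t / (eta k t - z))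
      - of_real (\<Psi> k z) * integral {0..2*pi} (\<lambda>t. eta1 k t / (eta k t - z))"
proof -
  interpret smooth_loop "eta k" "eta1 k" "eta2 k" by (rule sloop[OF k])
  have h: "holder_fun (\<alpha> k) (\<Psi> k)" "\<And>t. t \<in> {0..2*pi} \<Longrightarrow> \<Psi> k (eta k t) = \<phi> k t"
    using rep k by (auto simp: holder_rep_def)
  have "integral {0..2*pi} (\<lambda>t. of_real (\<Psi> k (eta k t)) * eta1 k t / (eta k t - z))
      = integral {0..2*pi} (\<lambda>t. of_real (\<phi> k t) * eta1 k t / (eta k t - z))"
    by (rule integral_cong) (simp add: h(2))
  then show ?thesis using cauchy_diff_off_curve[OF h(1) z] by simp
qed

lemma cauchy_diffs_outside:
  assumes rep: "holder_rep \<phi> \<Psi> \<alpha>" and k: "k \<in> {1..m}" and z: "z \<in> outside (Gam k)"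
  shows "cauchy_diffs k (\<Psi> k) z = integral {0..2*pi} (\<lambda>t. of_real (\<phi> k t) * eta1 k t / (eta k t - z))"
proof -
  have "z \<notin> Gam k" using z outside_no_overlap by blast
  from cauchy_diffs_off[OF rep k this] show ?thesis
    unfolding outside_mass_zero[OF k z] by simp
qed

lemma kerMN_scaleR: "kerMN eta j s k t = (1 / pi) *\<^sub>R (eta1 k t / (eta k t - eta j s))"
  by (simp add: kerMN_def eta1_def scaleR_conv_of_real)

lemma cauchy_total_on_G:
  assumes rep: "holder_rep \<phi> \<Psi> \<alpha>" and z: "z \<in> G"
  shows "cauchy_total \<Psi> z = cauchy_sum \<phi> z"
  unfolding cauchy_total_def cauchy_sum_def
proof (rule sum.cong)
  fix k assume k: "k \<in> {1..m}"
  have "z \<in> outside (Gam k)" using G_sub_outside[OF k] z by blast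
  then show "cauchy_diffs k (\<Psi> k) z = integral {0..2*pi} (\<lambda>t. of_real (\<phi> k t) * eta1 k t / (eta k t - z))"
    by (rule cauchy_diffs_outside[OF rep k])
qed simp

lemma cauchy_total_inside:
  assumes rep: "holder_rep \<phi> \<Psi> \<alpha>" and j: "j \<in> {1..m}" and z: "z \<in> inside (Gam j)"
  shows "cauchy_total \<Psi> z = cauchy_sum \<phi> z + 2 * pi * \<i> * of_real (\<Psi> j z)"
proof -
  let ?I = "\<lambda>k. integral {0..2*pi} (\<lambda>t. of_real (\<phi> k t) * eta1 k t / (eta k t - z))"
  have "cauchy_diffs k (\<Psi> k) z = ?I k + (if k = j then 2 * pi * \<i> * of_real (\<Psi> j z) else 0)" if k: "k \<in> {1..m}" for k
  proof (cases "k = j")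
    case True
    have "z \<notin> Gam k" using z True inside_no_overlap by blast
    then show ?thesis
      using cauchy_diffs_off[OF rep k, of z] inside_mass[OF k] z True by simp
  next
    case False
    then have "z \<in> outside (Gam k)" using inside_sub_outside[OF j k] z by blast
    then show ?thesis
      using cauchy_diffs_outside[OF rep k] False by simp
  qed
  then have "cauchy_total \<Psi> z = (\<Sum>k\<in>{1..m}. ?I k + (if k = j then 2 * pi * \<i> * of_real (\<Psi> j z) else 0))"
    unfolding cauchy_total_def by (rule sum.cong[OF refl])
  also have "\<dots> = cauchy_sum \<phi> z + 2 * pi * \<i> * of_real (\<Psi> j z)"
    unfolding cauchy_sum_def sum.distrib using j by simp
  finally show ?thesis .
qed

lemma pv_set_same: "k \<in> {1..m} \<Longrightarrow> pv_set k s k \<epsilon> = smooth_loop.pv_dom s \<epsilon>"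
  using smooth_loop.pv_dom_def[OF sloop] by (simp add: pv_set_def)

text \<open>The Plemelj formula in terms of \<open>M\<close> and \<open>N\<close>. The term with
  \<phi> itself appears because subtracting the value at \<open>eta j s\<close> removes that value
  times the mass -pi of the kernel on its own curve; the other curves contribute no mass.\<close>

lemma cauchy_total_on_curve:
  assumes rep: "holder_rep \<phi> \<Psi> \<alpha>" and j: "j \<in> {1..m}" and s: "s \<in> {0..2*pi}"
  shows "cauchy_total \<Psi> (eta j s) = of_real (pi * Mop eta m \<phi> j s) + \<i> * of_real (pi * (Nop eta m \<phi> j s + \<phi> j s))"
proof -
  have h: "holder_fun (\<alpha> k) (\<Psi> k)" "\<And>t. t \<in> {0..2*pi} \<Longrightarrow> \<Psi> k (eta k t) = \<phi> k t" if "k \<in> {1..m}" for k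
    using rep that by (auto simp: holder_rep_def)
  let ?K = "\<lambda>k t. eta1 k t / (eta k t - eta j s)"
  have kM: "kerM eta j s k t * \<phi> k t = 1 / pi * (Re (?K k t) * \<phi> k t)"
    and kN: "kerN eta j s k t * \<phi> k t = 1 / pi * (Im (?K k t) * \<phi> k t)" for k t
    by (simp_all add: kerM_def kerN_def kerMN_scaleR)
  have off: "cauchy_diffs k (\<Psi> k) (eta j s) = integral {0..2*pi} (\<lambda>t. of_real (\<phi> k t) * eta1 k t / (eta k t - eta j s))"
      "(\<lambda>t. of_real (\<phi> k t) * eta1 k t / (eta k t - eta j s)) integrable_on {0..2*pi}"
    if k: "k \<in> {1..m}" "k \<noteq> j" for k
  proof -
    interpret smooth_loop "eta k" "eta1 k" "eta2 k" by (rule sloop[OF k(1)])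
    have out: "eta j s \<in> outside (Gam k)" using Gam_sub_outside[OF k(1) j k(2)] s by blast
    then have nin: "eta j s \<notin> Gam k" using outside_no_overlap by blast
    then show "cauchy_diffs k (\<Psi> k) (eta j s) = integral {0..2*pi} (\<lambda>t. of_real (\<phi> k t) * eta1 k t / (eta k t - eta j s))"
      by (intro cauchy_diffs_outside[OF rep k(1) out])
    have ne: "eta k t - eta j s \<noteq> 0" if "t \<in> {0..2*pi}" for t
      using nin that by force
    show "(\<lambda>t. of_real (\<phi> k t) * eta1 k t / (eta k t - eta j s)) integrable_on {0..2*pi}"
      by (intro integrable_continuous_interval continuous_intros g_cont g1_cont holder_rep_continuous[OF rep k(1)]) (use ne in auto)
  qed
  have ReK: "Re (of_real (\<phi> k t) * eta1 k t / (eta k t - eta j s)) = Re (?K k t) * \<phi> k t"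
    and ImK: "Im (of_real (\<phi> k t) * eta1 k t / (eta k t - eta j s)) = Im (?K k t) * \<phi> k t" for k t
  proof -
    have "of_real (\<phi> k t) * eta1 k t / (eta k t - eta j s) = of_real (\<phi> k t) * ?K k t" by simp
    then show "Re (of_real (\<phi> k t) * eta1 k t / (eta k t - eta j s)) = Re (?K k t) * \<phi> k t"
      and "Im (of_real (\<phi> k t) * eta1 k t / (eta k t - eta j s)) = Im (?K k t) * \<phi> k t"
      by (simp_all only: scaleR_conv_of_real[symmetric] scaleR_complex.sel mult.commute)
  qed
  have "((\<lambda>\<epsilon>. integral (pv_set j s k \<epsilon>) (\<lambda>t. kerM eta j s k t * \<phi> k t)) \<longlongrightarrow> 1 / pi * Re (cauchy_diffs k (\<Psi> k) (eta j s))) (at_right 0)"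
    if k: "k \<in> {1..m}" for k
  proof (cases "k = j")
    case True
    interpret smooth_loop "eta k" "eta1 k" "eta2 k" by (rule sloop[OF k])
    have "integral (pv_set j s k \<epsilon>) (\<lambda>t. kerM eta j s k t * \<phi> k t)
        = 1 / pi * integral (pv_dom s \<epsilon>) (\<lambda>t. Re (eta1 k t / (eta k t - eta k s)) * \<Psi> k (eta k t))" for \<epsilon>
    proof -
      have "integral (pv_dom s \<epsilon>) (\<lambda>t. Re (eta1 k t / (eta k t - eta k s)) * \<Psi> k (eta k t))
          = integral (pv_dom s \<epsilon>) (\<lambda>t. Re (?K k t) * \<phi> k t)"
        by (rule integral_cong) (auto simp: pv_dom_def h(2)[OF j] True)
      then show ?thesis
        unfolding kM integral_mult_right using pv_set_same[OF k] True by simp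
    qed
    then show ?thesis
      using tendsto_mult_left[OF Re_cauchy_diff_on_curve[OF h(1)[OF k] s], of "1 / pi"] True by simp
  next
    case False
    have "integral {0..2*pi} (\<lambda>t. Re (?K k t) * \<phi> k t) = Re (cauchy_diffs k (\<Psi> k) (eta j s))"
      unfolding off(1)[OF k False]
      using integral_unique[OF has_integral_Re[OF integrable_integral[OF off(2)[OF k False]]]]
      unfolding ReK .
    then have "integral (pv_set j s k \<epsilon>) (\<lambda>t. kerM eta j s k t * \<phi> k t) = 1 / pi * Re (cauchy_diffs k (\<Psi> k) (eta j s))" for \<epsilon>
      unfolding kM integral_mult_right using False by (simp add: pv_set_def)
    then show ?thesis by simp
  qed
  then have "((\<lambda>\<epsilon>. \<Sum>k\<in>{1..m}. integral (pv_set j s k \<epsilon>) (\<lambda>t. kerM eta j s k t * \<phi> k t))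
      \<longlongrightarrow> (\<Sum>k\<in>{1..m}. 1 / pi * Re (cauchy_diffs k (\<Psi> k) (eta j s)))) (at_right 0)"
    by (intro tendsto_sum) auto
  then have "Mop eta m \<phi> j s = (\<Sum>k\<in>{1..m}. 1 / pi * Re (cauchy_diffs k (\<Psi> k) (eta j s)))"
    unfolding Mop_def by (intro tendsto_Lim) auto
  also have "\<dots> = 1 / pi * Re (cauchy_total \<Psi> (eta j s))"
    unfolding cauchy_total_def Re_sum by (simp add: sum_distrib_left)
  finally have Re: "Re (cauchy_total \<Psi> (eta j s)) = pi * Mop eta m \<phi> j s" by simp
  have "integral {0..2*pi} (\<lambda>t. kerN eta j s k t * \<phi> k t)
      = 1 / pi * Im (cauchy_diffs k (\<Psi> k) (eta j s)) - (if k = j then \<phi> j s else 0)" if k: "k \<in> {1..m}" for k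
  proof (cases "k = j")
    case True
    interpret clockwise_loop "eta k" "eta1 k" "eta2 k" by (rule loop[OF k])
    have "integral {0..2*pi} (\<lambda>t. Im (?K k t) * \<phi> k t)
        = integral {0..2*pi} (\<lambda>t. Im (eta1 k t / (eta k t - eta k s)) * \<Psi> k (eta k t))"
      by (rule integral_cong) (auto simp: h(2)[OF j] True)
    also have "\<dots> = Im (cauchy_diffs k (\<Psi> k) (eta k s)) + \<Psi> k (eta k s) * (- pi)"
      using Im_cauchy_diff_on_curve[OF h(1)[OF k] s] unfolding Im_kernel_mass[OF s] .
    finally have "integral {0..2*pi} (\<lambda>t. Im (?K k t) * \<phi> k t) = Im (cauchy_diffs k (\<Psi> k) (eta j s)) - pi * \<phi> j s"
      using h(2)[OF k s] True by simp
    then show ?thesis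
      unfolding kN integral_mult_right using True by (simp add: right_diff_distrib)
  next
    case False
    have "integral {0..2*pi} (\<lambda>t. Im (?K k t) * \<phi> k t) = Im (cauchy_diffs k (\<Psi> k) (eta j s))"
      unfolding off(1)[OF k False]
      using integral_unique[OF has_integral_Im[OF integrable_integral[OF off(2)[OF k False]]]]
      unfolding ImK .
    then show ?thesis unfolding kN integral_mult_right using False by simp
  qed
  then have "Nop eta m \<phi> j s = (\<Sum>k\<in>{1..m}. 1 / pi * Im (cauchy_diffs k (\<Psi> k) (eta j s)) - (if k = j then \<phi> j s else 0))"
    unfolding Nop_def by (rule sum.cong[OF refl])
  also have "\<dots> = 1 / pi * Im (cauchy_total \<Psi> (eta j s)) - \<phi> j s"
    unfolding cauchy_total_def Im_sum sum_subtractf using j by (simp add: sum_distrib_left)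
  finally have Im: "Im (cauchy_total \<Psi> (eta j s)) = pi * (Nop eta m \<phi> j s + \<phi> j s)"
    by (simp add: field_simps)
  show ?thesis
    using Re Im by (simp add: complex_eq_iff)
qed

lemma cauchy_total_continuous:
  assumes "holder_rep \<phi> \<Psi> \<alpha>"
  shows "continuous_on S (cauchy_total \<Psi>)"
  unfolding cauchy_total_def
  using assms by (intro continuous_on_sum smooth_loop.cauchy_diff_continuous[OF sloop]) (auto simp: holder_rep_def)

lemma cauchy_sum_holomorphic:
  assumes rep: "holder_rep \<phi> \<Psi> \<alpha>" and U: "open U" "U \<inter> bdry eta m = {}"
  shows "cauchy_sum \<phi> holomorphic_on U"
proof -
  have "(\<lambda>z. integral {0..2*pi} (\<lambda>t. of_real (\<phi> k t) * eta1 k t / (eta k t - z))) holomorphic_on U"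
    if k: "k \<in> {1..m}" for k
  proof -
    have "continuous_on {0..2*pi} (\<lambda>t. complex_of_real (\<phi> k t))"
      by (intro continuous_intros holder_rep_continuous[OF rep k])
    moreover have "U \<inter> Gam k = {}" using U(2) Gam_sub_bdry[OF k] by blast
    ultimately show ?thesis
      using smooth_loop.cauchy_integral_holomorphic[OF sloop[OF k] _ U(1)] by blast
  qed
  then have "(\<lambda>z. \<Sum>k\<in>{1..m}. integral {0..2*pi} (\<lambda>t. of_real (\<phi> k t) * eta1 k t / (eta k t - z))) holomorphic_on U"
    by (intro holomorphic_on_sum)
  then show ?thesis unfolding cauchy_sum_def .
qed

lemma cauchy_sum_at_infinity:
  assumes rep: "holder_rep \<phi> \<Psi> \<alpha>"
  shows "(cauchy_sum \<phi> \<longlongrightarrow> 0) at_infinity"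
proof -
  have "((\<lambda>z. \<Sum>k\<in>{1..m}. integral {0..2*pi} (\<lambda>t. of_real (\<phi> k t) * eta1 k t / (eta k t - z)))
      \<longlongrightarrow> (\<Sum>k\<in>{1..m}. 0)) at_infinity"
    by (intro tendsto_sum smooth_loop.cauchy_integral_at_infinity[OF sloop] continuous_intros
        holder_rep_continuous[OF rep]) auto
  then show ?thesis unfolding cauchy_sum_def by simp
qed

end

lemma holder_on_J_cong:
  "(\<And>t. t \<in> {0..2*pi} \<Longrightarrow> f t = g t) \<Longrightarrow> holder_on_J f \<longleftrightarrow> holder_on_J g"
  unfolding holder_on_J_def by simp

context exterior_domain
begin

section \<open>From a density to the boundary value problem\<close>

lemma eventually_in_G: "\<forall>\<^sub>F z in at_infinity. z \<in> G"
proof -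
  obtain R where "\<And>z. z \<in> - G \<Longrightarrow> norm z \<le> R"
    using G_bdd by (auto simp: bounded_iff)
  then have "z \<in> G" if "R + 1 \<le> norm z" for z
    using that by force
  then show ?thesis by (auto simp: eventually_at_infinity)
qed

lemma density_solution:
  assumes \<gamma>: "gamma \<in> Hspace m" and \<mu>: "mu \<in> Hspace m"
    and eq: "\<And>j s. j \<in> {1..m} \<Longrightarrow> s \<in> {0..2*pi} \<Longrightarrow> mu j s - Nop eta m mu j s = - Mop eta m gamma j s"
  shows "\<exists>h f. (\<forall>j\<in>{1..m}. \<forall>s\<in>{0..2*pi}. h j = (Mop eta m mu j s - (gamma j s - Nop eta m gamma j s)) / 2) \<and>
    ext_problem G m eta (\<lambda>j s. gamma j s + h j) f \<and>
    (\<forall>j\<in>{1..m}. \<forall>s\<in>{0..2*pi}. f (eta j s) = of_real (gamma j s + h j) + \<i> * of_real (mu j s))"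
proof -
  obtain \<Psi> \<alpha> where rep: "holder_rep gamma \<Psi> \<alpha>" using Hspace_holder_rep[OF \<gamma>] .
  obtain \<Psi>' \<alpha>' where rep': "holder_rep mu \<Psi>' \<alpha>'" using Hspace_holder_rep[OF \<mu>] .
  \<comment> \<open>\<open>f\<close> is continuous on the plane and supplies the boundary values;
    \<open>f0\<close> is the genuine Cauchy integral and supplies holomorphy. They agree on
    \<open>G\<close>.\<close>
  define f where "f z = (cauchy_total \<Psi> z + \<i> * cauchy_total \<Psi>' z) / (2 * pi * \<i>)" for z
  define f0 where "f0 z = (cauchy_sum gamma z + \<i> * cauchy_sum mu z) / (2 * pi * \<i>)" for z
  define H where "H j s = (Mop eta m mu j s - (gamma j s - Nop eta m gamma j s)) / 2" for j s
  have f_bd: "f (eta j s) = of_real (gamma j s + H j s) + \<i> * of_real (mu j s)"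
    if j: "j \<in> {1..m}" and s: "s \<in> {0..2*pi}" for j s
  proof -
    \<comment> \<open>The integral equation enters here: without it the imaginary part would be (mu
      + N mu - M gamma) / 2, and the equation makes this \<open>mu\<close>. The real part is gamma +
      H by the definition of \<open>H\<close>.\<close>
    have M: "Mop eta m gamma j s = Nop eta m mu j s - mu j s" using eq[OF j s] by simp
    have "cauchy_total \<Psi> (eta j s) + \<i> * cauchy_total \<Psi>' (eta j s) = (of_real (gamma j s + H j s) + \<i> * of_real (mu j s)) * (2 * pi * \<i>)"
      unfolding cauchy_total_on_curve[OF rep j s] cauchy_total_on_curve[OF rep' j s] H_def M
      by (simp add: complex_eq_iff field_simps)
    then show ?thesis unfolding f_def by simp
  qed
  have f0_hol: "f0 holomorphic_on U" if "open U" "U \<inter> bdry eta m = {}" for U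
    unfolding f0_def by (intro holomorphic_intros cauchy_sum_holomorphic[OF rep that] cauchy_sum_holomorphic[OF rep' that]) simp
  have f_G: "f z = f0 z" if "z \<in> G" for z
    unfolding f_def f0_def cauchy_total_on_G[OF rep that] cauchy_total_on_G[OF rep' that] ..
  have f_cont: "continuous_on S f" for S
    unfolding f_def by (intro continuous_intros cauchy_total_continuous[OF rep] cauchy_total_continuous[OF rep']) simp
  have H_const: "H j s = H j 0" if j: "j \<in> {1..m}" and s: "s \<in> {0..2*pi}" for j s
  proof -
    let ?D = "inside (Gam j)"
    \<comment> \<open>Subtracting the jump turns \<open>f\<close> into the boundary function seen
      from the inside. It is holomorphic there, continuous up to the curve, and has the real
      boundary values \<open>H j\<close>.\<close>
    define k where "k z = f z - (of_real (\<Psi> j z) + \<i> * of_real (\<Psi>' j z))" for z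
    have k_D: "k z = f0 z" if "z \<in> ?D" for z
      unfolding k_def f_def f0_def cauchy_total_inside[OF rep j that] cauchy_total_inside[OF rep' j that]
      by (simp add: field_simps)
    have "?D \<inter> bdry eta m = {}"
    proof -
      have "?D \<inter> Gam l = {}" if "l \<in> {1..m}" for l
        using inside_no_overlap[of "Gam j"] inside_sub_outside[OF j that] outside_no_overlap[of "Gam l"]
        by (cases "l = j") blast+
      then show ?thesis unfolding bdry_def by blast
    qed
    then have k_hol: "k holomorphic_on ?D"
      using f0_hol[OF inside_Gam(1)[OF j]] k_D by (simp cong: holomorphic_cong)
    have hf: "holder_fun (\<alpha> j) (\<Psi> j)" "holder_fun (\<alpha>' j) (\<Psi>' j)"
      using rep rep' j by (auto simp: holder_rep_def)
    have k_cont: "continuous_on (closure ?D) k"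
      unfolding k_def by (intro continuous_intros f_cont holder_fun_continuous[OF hf(1)] holder_fun_continuous[OF hf(2)])
    have k_bd: "k (eta j t) = of_real (H j t)" if t: "t \<in> {0..2*pi}" for t
      unfolding k_def f_bd[OF j t] using rep rep' j t by (simp add: holder_rep_def)
    have Im0: "Im (k z) = 0" if "z \<in> frontier ?D" for z
      using that k_bd unfolding inside_Gam(5)[OF j] by auto
    obtain c :: real where c: "\<And>z. z \<in> closure ?D \<Longrightarrow> k z = of_real c"
      using real_boundary_imp_constant[OF k_hol inside_Gam(1-4)[OF j] k_cont Im0] by blast
    have "H j t = c" if t: "t \<in> {0..2*pi}" for t
    proof -
      have "eta j t \<in> closure ?D"
        using inside_Gam(5)[OF j] t by (auto simp: frontier_def)
      then show ?thesis using c k_bd[OF t] by simp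
    qed
    then show ?thesis using s by simp
  qed
  show ?thesis
  proof (intro exI[of _ "\<lambda>j. H j 0"] exI[of _ f] conjI ballI)
    show "H j 0 = (Mop eta m mu j s - (gamma j s - Nop eta m gamma j s)) / 2" if "j \<in> {1..m}" "s \<in> {0..2*pi}" for j s
      using H_const[OF that] by (simp add: H_def)
    show bd: "f (eta j s) = of_real (gamma j s + H j 0) + \<i> * of_real (mu j s)" if "j \<in> {1..m}" "s \<in> {0..2*pi}" for j s
      using f_bd[OF that] H_const[OF that] by simp
    show "ext_problem G m eta (\<lambda>j s. gamma j s + H j 0) f"
      unfolding ext_problem_def
    proof (intro conjI ballI f_cont)
      show "f holomorphic_on G"
        using f0_hol[OF G_open G_bdry_disjoint] f_G by (simp cong: holomorphic_cong)
      have "(f0 \<longlongrightarrow> (0 + \<i> * 0) / (2 * pi * \<i>)) at_infinity"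
        unfolding f0_def by (intro tendsto_intros cauchy_sum_at_infinity[OF rep] cauchy_sum_at_infinity[OF rep']) simp
      then have "(f0 \<longlongrightarrow> 0) at_infinity" by simp
      then show "(f \<longlongrightarrow> 0) at_infinity"
        by (rule Lim_transform_eventually) (use eventually_in_G f_G in \<open>auto elim: eventually_mono\<close>)
      show "Re (f (eta k t)) = gamma k t + H k 0" if "k \<in> {1..m}" "t \<in> {0..2*pi}" for k t
        using bd[OF that] by simp
    qed
  qed
qed

text \<open>With d = 0 this is uniqueness for fixed data. Constant differences are allowed because
  two densities bring along their own constants \<open>h\<close>.\<close>

lemma ext_problem_unique:
  assumes f: "ext_problem G m eta \<psi> f" and g: "ext_problem G m eta \<theta> g"
    and d: "\<And>j s. j \<in> {1..m} \<Longrightarrow> s \<in> {0..2*pi} \<Longrightarrow> \<psi> j s - \<theta> j s = d j"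
    and z: "z \<in> G \<union> bdry eta m"
  shows "f z = g z"
proof -
  have "f z - g z = 0"
  proof (rule boundary_in_lines_imp_zero[where f = "\<lambda>z. f z - g z" and z = z and G = G and S = "d ` {1..m}"])
    show "(\<lambda>z. f z - g z) holomorphic_on G" "continuous_on (closure G) (\<lambda>z. f z - g z)"
      using f g unfolding ext_problem_def closure_G by (auto intro: holomorphic_intros continuous_intros)
    show "((\<lambda>z. f z - g z) \<longlongrightarrow> 0) at_infinity"
      using f g tendsto_diff[of f 0 at_infinity g 0] by (simp add: ext_problem_def)
    show "Re (f w - g w) \<in> d ` {1..m}" if w: "w \<in> frontier G" for w
    proof -
      obtain k t where kt: "k \<in> {1..m}" "t \<in> {0..2*pi}" "w = eta k t"
        using w unfolding G_frontier bdry_def by blast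
      then have "Re (f w - g w) = d k"
        using f g d[OF kt(1,2)] by (simp add: ext_problem_def)
      then show ?thesis using kt(1) by blast
    qed
    show "z \<in> closure G" using z closure_G by simp
  qed (use G_open G_conn G_bdd in auto)
  then show ?thesis by simp
qed

text \<open>Two solutions of the equation yield two functions in \<open>G\<close> whose real
  boundary values differ by constants. The functions therefore agree, and their imaginary parts on
  the boundary are the densities.\<close>

lemma density_unique:
  assumes "gamma \<in> Hspace m" "mu1 \<in> Hspace m" "mu2 \<in> Hspace m"
    and "\<And>j s. j \<in> {1..m} \<Longrightarrow> s \<in> {0..2*pi} \<Longrightarrow> mu1 j s - Nop eta m mu1 j s = - Mop eta m gamma j s"
    and "\<And>j s. j \<in> {1..m} \<Longrightarrow> s \<in> {0..2*pi} \<Longrightarrow> mu2 j s - Nop eta m mu2 j s = - Mop eta m gamma j s"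
    and j: "j \<in> {1..m}" and s: "s \<in> {0..2*pi}"
  shows "mu1 j s = mu2 j s"
proof -
  obtain h1 f1 where 1: "ext_problem G m eta (\<lambda>j s. gamma j s + h1 j) f1"
    "\<forall>j\<in>{1..m}. \<forall>s\<in>{0..2*pi}. f1 (eta j s) = of_real (gamma j s + h1 j) + \<i> * of_real (mu1 j s)"
    using density_solution[OF assms(1,2,4)] by auto
  obtain h2 f2 where 2: "ext_problem G m eta (\<lambda>j s. gamma j s + h2 j) f2"
    "\<forall>j\<in>{1..m}. \<forall>s\<in>{0..2*pi}. f2 (eta j s) = of_real (gamma j s + h2 j) + \<i> * of_real (mu2 j s)"
    using density_solution[OF assms(1,3,5)] by auto
  have "eta j s \<in> G \<union> bdry eta m" using Gam_sub_bdry[OF j] s by blast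
  then have "f1 (eta j s) = f2 (eta j s)"
    by (rule ext_problem_unique[OF 1(1) 2(1), where d = "\<lambda>j. h1 j - h2 j", rotated]) simp
  then show ?thesis
    using 1(2) 2(2) j s by (simp add: complex_eq_iff)
qed

section \<open>Existence of the density\<close>

lemma zero_Hspace: "(\<lambda>k t. 0) \<in> Hspace m"
  unfolding Hspace_def by (intro CollectI ballI conjI exI[of _ "1::real"]) auto

lemma Mop_zero: "Mop eta m (\<lambda>k t. 0) j s = 0"
  unfolding Mop_def by (intro tendsto_Lim) auto

lemma Nop_zero: "Nop eta m (\<lambda>k t. 0) j s = 0"
  unfolding Nop_def by simp

text \<open>The kernel \<open>N\<close> on all of \<open>J\<close>, made continuous across its
  diagonal. The literal quotient in \<open>kerN\<close> has the value 0 there, by division by zero,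
  and this need not be the limit.\<close>

definition neumann_kernel_J :: "(nat \<times> real) \<times> (nat \<times> real) \<Rightarrow> real" where
  "neumann_kernel_J p = 1 / pi * (if fst (fst p) = fst (snd p)
     then smooth_loop.neumann_kernel (eta (fst (fst p))) (eta1 (fst (fst p))) (eta2 (fst (fst p))) (snd (fst p)) (snd (snd p))
     else Im (eta1 (fst (snd p)) (snd (snd p)) / (eta (fst (snd p)) (snd (snd p)) - eta (fst (fst p)) (snd (fst p)))))"

text \<open>\<open>J_set m \<times> J_set m\<close> is a finite union of closed rectangles, one for
  each pair of curves. On mixed pairs the denominator has no zero because the curves are
  disjoint.\<close>

lemma neumann_kernel_J_cont: "continuous_on (J_set m \<times> J_set m) neumann_kernel_J"
proof -
  let ?P = "\<lambda>i. ({fst i} \<times> {0..2*pi}) \<times> ({snd i} \<times> {0..2*pi}) :: ((nat \<times> real) \<times> (nat \<times> real)) set"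
  have "continuous_on (?P i) neumann_kernel_J" if i: "i \<in> {1..m} \<times> {1..m}" for i
  proof -
    obtain j k where jk: "i = (j, k)" "j \<in> {1..m}" "k \<in> {1..m}" using i by auto
    have proj: "continuous_on (?P i) (\<lambda>p. snd (fst p))" "continuous_on (?P i) (\<lambda>p. snd (snd p))"
      by (intro continuous_intros)+
    show ?thesis
    proof (cases "j = k")
      case True
      interpret smooth_loop "eta j" "eta1 j" "eta2 j" by (rule sloop[OF jk(2)])
      have "continuous_on (?P i) (\<lambda>p. (snd (fst p), snd (snd p)))"
        by (intro continuous_on_Pair proj)
      from continuous_on_compose2[OF neumann_kernel_cont this]
      have "continuous_on (?P i) (\<lambda>p. neumann_kernel (snd (fst p)) (snd (snd p)))" by simp
      then have "continuous_on (?P i) (\<lambda>p. 1 / pi * neumann_kernel (snd (fst p)) (snd (snd p)))"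
        by (intro continuous_intros)
      then show ?thesis
        by (rule continuous_on_eq) (use jk True in \<open>auto simp: neumann_kernel_J_def\<close>)
    next
      case False
      interpret j: smooth_loop "eta j" "eta1 j" "eta2 j" by (rule sloop[OF jk(2)])
      interpret k: smooth_loop "eta k" "eta1 k" "eta2 k" by (rule sloop[OF jk(3)])
      have "continuous_on (?P i) (\<lambda>p. eta j (snd (fst p)))" "continuous_on (?P i) (\<lambda>p. eta k (snd (snd p)))"
          "continuous_on (?P i) (\<lambda>p. eta1 k (snd (snd p)))"
        by (rule continuous_on_compose2[OF j.g_cont[of UNIV] proj(1)] continuous_on_compose2[OF k.g_cont[of UNIV] proj(2)]
            continuous_on_compose2[OF k.g1_cont[of UNIV] proj(2)]; simp)+
      moreover have "eta k (snd (snd p)) - eta j (snd (fst p)) \<noteq> 0" if "p \<in> ?P i" for p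
        using Gam_disjoint[OF jk(2,3) False] that jk(1) by force
      ultimately have "continuous_on (?P i) (\<lambda>p. 1 / pi * Im (eta1 k (snd (snd p)) / (eta k (snd (snd p)) - eta j (snd (fst p)))))"
        by (intro continuous_intros) auto
      then show ?thesis
        by (rule continuous_on_eq) (use jk False in \<open>auto simp: neumann_kernel_J_def\<close>)
    qed
  qed
  then have "continuous_on (\<Union>i\<in>{1..m} \<times> {1..m}. ?P i) neumann_kernel_J"
    by (intro continuous_on_closed_Union) (auto intro!: closed_Times)
  moreover have "(\<Union>i\<in>{1..m} \<times> {1..m}. ?P i) = J_set m \<times> J_set m"
    by (auto simp: J_set_def)
  ultimately show ?thesis by simp
qed

lemma neumann_kernel_J_eq:
  assumes "eta k t \<noteq> eta j s" "j \<in> {1..m}"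
  shows "neumann_kernel_J ((j, s), (k, t)) = 1 / pi * Im (eta1 k t / (eta k t - eta j s))"
  using assms smooth_loop.neumann_kernel_def[OF sloop[OF assms(2)]] by (auto simp: neumann_kernel_J_def)

text \<open>For a fixed point the two kernels differ for at most finitely many \<open>t\<close> on
  each curve, so the integrals agree.\<close>

lemma J_integral_neumann_kernel:
  assumes j: "j \<in> {1..m}" and s: "s \<in> {0..2*pi}"
  shows "J_integral m (\<lambda>y. neumann_kernel_J ((j, s), y) * \<phi> y) = Nop eta m (\<lambda>k t. \<phi> (k, t)) j s"
  unfolding J_integral_def Nop_def
proof (rule sum.cong)
  fix k assume k: "k \<in> {1..m}"
  show "integral {0..2*pi} (\<lambda>t. neumann_kernel_J ((j, s), k, t) * \<phi> (k, t)) = integral {0..2*pi} (\<lambda>t. kerN eta j s k t * \<phi> (k, t))"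
  proof (rule integral_spike[OF negligible_finite[OF smooth_loop.finite_preimage[OF sloop[OF k]]]])
    fix t assume "t \<in> {0..2*pi} - {t \<in> {0..2*pi}. eta k t = eta j s}"
    then have "eta k t \<noteq> eta j s" by auto
    from neumann_kernel_J_eq[OF this j] show "kerN eta j s k t * \<phi> (k, t) = neumann_kernel_J ((j, s), k, t) * \<phi> (k, t)"
      by (simp add: kerN_def kerMN_scaleR)
  qed
qed simp

lemma Im_kernel_bound:
  obtains C where "C > 0" "\<And>j k s t. j \<in> {1..m} \<Longrightarrow> k \<in> {1..m} \<Longrightarrow> s \<in> {0..2*pi} \<Longrightarrow> t \<in> {0..2*pi} \<Longrightarrow>
    \<bar>Im (eta1 k t / (eta k t - eta j s))\<bar> \<le> C"
proof -
  have "bounded (neumann_kernel_J ` (J_set m \<times> J_set m))"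
    by (intro compact_imp_bounded compact_continuous_image neumann_kernel_J_cont compact_Times compact_J_set)
  then obtain C where C: "C > 0" "\<And>p. p \<in> J_set m \<times> J_set m \<Longrightarrow> \<bar>neumann_kernel_J p\<bar> \<le> C"
    unfolding bounded_pos by auto
  have "\<bar>Im (eta1 k t / (eta k t - eta j s))\<bar> \<le> pi * C"
    if "j \<in> {1..m}" "k \<in> {1..m}" "s \<in> {0..2*pi}" "t \<in> {0..2*pi}" for j k s t
  proof (cases "eta k t = eta j s")
    case False
    have "\<bar>neumann_kernel_J ((j, s), (k, t))\<bar> \<le> C" using that by (intro C(2)) (auto simp: J_set_def)
    then have "\<bar>Im (eta1 k t / (eta k t - eta j s))\<bar> / pi \<le> C"
      unfolding neumann_kernel_J_eq[OF False that(1)] by (simp add: abs_mult)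
    then show ?thesis by (simp add: pos_divide_le_eq mult.commute)
  qed (use C in simp)
  then show ?thesis using that[of "pi * C"] C(1) by simp
qed

lemma Nop_holder:
  assumes cont: "\<And>k. k \<in> {1..m} \<Longrightarrow> continuous_on {0..2*pi} (mu k)" and j: "j \<in> {1..m}"
  shows "holder_on_J (Nop eta m mu j)"
proof -
  obtain C where C: "C > 0" "\<And>j k s t. j \<in> {1..m} \<Longrightarrow> k \<in> {1..m} \<Longrightarrow> s \<in> {0..2*pi} \<Longrightarrow> t \<in> {0..2*pi} \<Longrightarrow>
    \<bar>Im (eta1 k t / (eta k t - eta j s))\<bar> \<le> C"
    using Im_kernel_bound by blast
  have "holder_on_J (\<lambda>s. integral {0..2*pi} (\<lambda>t. kerN eta j s k t * mu k t))" if k: "k \<in> {1..m}" for k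
  proof -
    interpret smooth_loop "eta k" "eta1 k" "eta2 k" by (rule sloop[OF k])
    let ?I = "\<lambda>z. integral {0..2*pi} (\<lambda>t. Im (eta1 k t / (eta k t - z)) * mu k t)"
    have "mu k \<in> borel_measurable (lebesgue_on {0..2*pi})"
      by (intro continuous_imp_measurable_on_sets_lebesgue cont k) simp
    moreover have "bounded (mu k ` {0..2*pi})"
      by (intro compact_imp_bounded compact_continuous_image cont k) simp
    then obtain Q where "\<And>t. t \<in> {0..2*pi} \<Longrightarrow> \<bar>mu k t\<bar> \<le> Q"
      unfolding bounded_iff by fastforce
    moreover have "\<And>z t. z \<in> Gam j \<Longrightarrow> t \<in> {0..2*pi} \<Longrightarrow> \<bar>Im (eta1 k t / (eta k t - z))\<bar> \<le> C"
      using C(2)[OF j k] by auto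
    ultimately obtain D where D: "D \<ge> 0" "\<forall>z\<in>Gam j. \<forall>w\<in>Gam j. \<bar>?I z - ?I w\<bar> \<le> D * norm (z - w) powr (1/4)"
      using Im_potential_holder[of "mu k" Q C "Gam j"] C(1) by blast
    have "holder_on_J (\<lambda>s. ?I (eta j s))"
      by (rule smooth_loop.holder_along_curve[OF sloop[OF j], of "1/4" D]) (use D in auto)
    then have "holder_on_J (\<lambda>s. 1 / pi * ?I (eta j s))" by (rule holder_on_J_cmult)
    moreover have "1 / pi * ?I (eta j s) = integral {0..2*pi} (\<lambda>t. kerN eta j s k t * mu k t)" for s
      unfolding integral_mult_right[symmetric] by (simp add: kerN_def kerMN_scaleR)
    ultimately show ?thesis by simp
  qed
  then have "holder_on_J (\<lambda>s. \<Sum>k\<in>{1..m}. integral {0..2*pi} (\<lambda>t. kerN eta j s k t * mu k t))"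
    by (intro holder_on_J_sum) auto
  then show ?thesis unfolding Nop_def[abs_def] .
qed

lemma Mop_eq_Re_cauchy_total:
  assumes "holder_rep \<phi> \<Psi> \<alpha>" "j \<in> {1..m}" "s \<in> {0..2*pi}"
  shows "Mop eta m \<phi> j s = 1 / pi * Re (cauchy_total \<Psi> (eta j s))"
  unfolding cauchy_total_on_curve[OF assms] by simp

text \<open>Privalov's theorem: on the curves \<open>M\<close> is the real part of the globally
  Hoelder continuous functions \<open>cauchy_diffs\<close>, up to the factor 1 / pi.\<close>

lemma Mop_holder:
  assumes rep: "holder_rep \<phi> \<Psi> \<alpha>" and j: "j \<in> {1..m}"
  shows "holder_on_J (Mop eta m \<phi> j)"
proof -
  have "holder_on_J (\<lambda>s. Re (cauchy_diffs k (\<Psi> k) (eta j s)))" if k: "k \<in> {1..m}" for k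
  proof -
    have hf: "holder_fun (\<alpha> k) (\<Psi> k)" using rep k by (auto simp: holder_rep_def)
    then have \<alpha>: "0 < \<alpha> k" "\<alpha> k \<le> 1" by (auto simp: holder_fun_def)
    obtain C where C: "C \<ge> 0" "\<And>z w. norm (cauchy_diffs k (\<Psi> k) z - cauchy_diffs k (\<Psi> k) w) \<le> C * norm (z - w) powr (\<alpha> k / 2)"
      using smooth_loop.cauchy_diff_holder[OF sloop[OF k] hf] by blast
    have "\<bar>Re (cauchy_diffs k (\<Psi> k) z) - Re (cauchy_diffs k (\<Psi> k) w)\<bar> \<le> C * norm (z - w) powr (\<alpha> k / 2)" for z w
      using abs_Re_le_cmod[of "cauchy_diffs k (\<Psi> k) z - cauchy_diffs k (\<Psi> k) w"] C(2)[of z w] by simp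
    then show ?thesis
      using \<alpha> C(1) by (intro smooth_loop.holder_along_curve[OF sloop[OF j], of "\<alpha> k / 2" C]) auto
  qed
  then have "holder_on_J (\<lambda>s. 1 / pi * (\<Sum>k\<in>{1..m}. Re (cauchy_diffs k (\<Psi> k) (eta j s))))"
    by (intro holder_on_J_cmult holder_on_J_sum) auto
  then show ?thesis
    by (rule holder_on_J_cong[THEN iffD1, rotated])
       (simp add: Mop_eq_Re_cauchy_total[OF rep j] cauchy_total_def)
qed

lemma eta_ends: "j \<in> {1..m} \<Longrightarrow> eta j 0 = eta j (2*pi)"
  using smooth_loop.per[OF sloop, of j 0] by simp

lemma Nop_ends: "j \<in> {1..m} \<Longrightarrow> Nop eta m mu j 0 = Nop eta m mu j (2*pi)"
  unfolding Nop_def kerN_def kerMN_def using eta_ends by simp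

lemma Mop_ends: "holder_rep \<phi> \<Psi> \<alpha> \<Longrightarrow> j \<in> {1..m} \<Longrightarrow> Mop eta m \<phi> j 0 = Mop eta m \<phi> j (2*pi)"
  using Mop_eq_Re_cauchy_total[of \<phi> \<Psi> \<alpha> j 0] Mop_eq_Re_cauchy_total[of \<phi> \<Psi> \<alpha> j "2*pi"] eta_ends by simp

text \<open>Read the equation as mu = N mu - M \<phi>. The right-hand side is Hoelder continuous and
  has equal end values as soon as \<open>mu\<close> is continuous.\<close>

lemma solution_in_Hspace:
  assumes cont: "\<And>k. k \<in> {1..m} \<Longrightarrow> continuous_on {0..2*pi} (mu k)" and rep: "holder_rep \<phi> \<Psi> \<alpha>"
    and eq: "\<And>j s. j \<in> {1..m} \<Longrightarrow> s \<in> {0..2*pi} \<Longrightarrow> mu j s - Nop eta m mu j s = - Mop eta m \<phi> j s"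
  shows "mu \<in> Hspace m"
proof -
  have mu: "mu j s = Nop eta m mu j s + (-1) * Mop eta m \<phi> j s" if "j \<in> {1..m}" "s \<in> {0..2*pi}" for j s
    using eq[OF that] by simp
  have "holder_on_J (mu j) \<and> mu j 0 = mu j (2*pi)" if j: "j \<in> {1..m}" for j
  proof
    have "holder_on_J (\<lambda>s. Nop eta m mu j s + (-1) * Mop eta m \<phi> j s)"
      by (intro holder_on_J_add holder_on_J_cmult Nop_holder Mop_holder[OF rep] cont j)
    then show "holder_on_J (mu j)"
      by (rule holder_on_J_cong[THEN iffD1, rotated]) (rule mu[OF j, symmetric])
    show "mu j 0 = mu j (2*pi)"
      using mu[OF j, of 0] mu[OF j, of "2*pi"] Nop_ends[OF j] Mop_ends[OF rep j] by simp
  qed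
  then show ?thesis unfolding Hspace_def holder_on_J_def by blast
qed

lemma continuous_on_J_slice:
  assumes "continuous_on (J_set m) \<phi>" "k \<in> {1..m}"
  shows "continuous_on {0..2*pi} (\<lambda>t. \<phi> (k, t))"
  by (rule continuous_on_compose2[OF assms(1)]) (use assms(2) in \<open>auto intro: continuous_intros simp: J_set_def\<close>)

lemma Mop_cont_J:
  assumes rep: "holder_rep \<phi> \<Psi> \<alpha>"
  shows "continuous_on (J_set m) (\<lambda>x. - Mop eta m \<phi> (fst x) (snd x))"
proof -
  have "continuous_on ({j} \<times> {0..2*pi}) (\<lambda>x. - Mop eta m \<phi> (fst x) (snd x))" if j: "j \<in> {1..m}" for j
  proof -
    have "continuous_on ({j} \<times> {0..2*pi}) (\<lambda>x. eta j (snd x))"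
      by (rule continuous_on_compose2[OF smooth_loop.g_cont[OF sloop[OF j], of UNIV]]) (auto intro: continuous_intros)
    then have "continuous_on ({j} \<times> {0..2*pi}) (\<lambda>x. cauchy_total \<Psi> (eta j (snd x)))"
      by (rule continuous_on_compose2[OF cauchy_total_continuous[OF rep, of UNIV]]) simp
    then have "continuous_on ({j} \<times> {0..2*pi}) (\<lambda>x. - (1 / pi * Re (cauchy_total \<Psi> (eta j (snd x)))))"
      by (intro continuous_intros)
    then show ?thesis
      by (rule continuous_on_eq) (use Mop_eq_Re_cauchy_total[OF rep j] in auto)
  qed
  then have "continuous_on (\<Union>j\<in>{1..m}. {j} \<times> {0..2*pi}) (\<lambda>x. - Mop eta m \<phi> (fst x) (snd x))"
    by (intro continuous_on_closed_Union) (auto intro!: closed_Times)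
  moreover have "(\<Union>j\<in>{1..m}. {j} \<times> {0..2*pi}) = J_set m" by (auto simp: J_set_def)
  ultimately show ?thesis by simp
qed

lemma density_exists:
  assumes \<gamma>: "gamma \<in> Hspace m"
  obtains mu where "mu \<in> Hspace m"
    "\<And>j s. j \<in> {1..m} \<Longrightarrow> s \<in> {0..2*pi} \<Longrightarrow> mu j s - Nop eta m mu j s = - Mop eta m gamma j s"
proof -
  obtain \<Psi> \<alpha> where rep: "holder_rep gamma \<Psi> \<alpha>" using Hspace_holder_rep[OF \<gamma>] .
  obtain \<Psi>0 \<alpha>0 where rep0: "holder_rep (\<lambda>k t. 0) \<Psi>0 \<alpha>0" using Hspace_holder_rep[OF zero_Hspace] .
  have "\<exists>\<phi>. continuous_on (J_set m) \<phi> \<and>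
      (\<forall>x\<in>J_set m. \<phi> x - J_integral m (\<lambda>y. neumann_kernel_J (x, y) * \<phi> y) = - Mop eta m gamma (fst x) (snd x))"
  proof (rule fredholm_alternative_J[OF m_ge neumann_kernel_J_cont _ Mop_cont_J[OF rep]])
    fix \<phi> x assume \<phi>: "continuous_on (J_set m) \<phi>" and x: "x \<in> J_set m"
      and fix_eq: "\<And>x. x \<in> J_set m \<Longrightarrow> \<phi> x = J_integral m (\<lambda>y. neumann_kernel_J (x, y) * \<phi> y)"
    \<comment> \<open>A continuous fixed function solves the equation with right-hand side 0. It
      lies in \<open>H\<close> by regularity, and uniqueness in \<open>H\<close> compares it with
      the zero function.\<close>
    define mu where "mu k t = \<phi> (k, t)" for k t
    have eq: "mu j s - Nop eta m mu j s = - Mop eta m (\<lambda>k t. 0) j s" if "j \<in> {1..m}" "s \<in> {0..2*pi}" for j s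
      using fix_eq[of "(j, s)"] J_integral_neumann_kernel[OF that, of \<phi>] that
      by (simp add: J_set_def mu_def[abs_def] Mop_zero)
    have "continuous_on {0..2*pi} (mu k)" if "k \<in> {1..m}" for k
      unfolding mu_def[abs_def] by (rule continuous_on_J_slice[OF \<phi> that])
    then have "mu \<in> Hspace m"
      by (rule solution_in_Hspace[OF _ rep0 eq])
    then have "mu (fst x) (snd x) = 0"
      using density_unique[OF zero_Hspace _ zero_Hspace eq, of "fst x" "snd x"] x
      by (auto simp: Mop_zero Nop_zero J_set_def)
    then show "\<phi> x = 0" by (simp add: mu_def)
  qed
  then obtain \<phi> where \<phi>: "continuous_on (J_set m) \<phi>"
    "\<And>x. x \<in> J_set m \<Longrightarrow> \<phi> x - J_integral m (\<lambda>y. neumann_kernel_J (x, y) * \<phi> y) = - Mop eta m gamma (fst x) (snd x)"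
    by blast
  define mu where "mu k t = \<phi> (k, t)" for k t
  have eq: "mu j s - Nop eta m mu j s = - Mop eta m gamma j s" if "j \<in> {1..m}" "s \<in> {0..2*pi}" for j s
    using \<phi>(2)[of "(j, s)"] J_integral_neumann_kernel[OF that, of \<phi>] that by (simp add: J_set_def mu_def[abs_def])
  have "mu \<in> Hspace m"
    by (rule solution_in_Hspace[OF _ rep eq])
       (auto simp: mu_def[abs_def] intro: continuous_on_J_slice[OF \<phi>(1)])
  then show ?thesis using that eq by blast
qed

end

theorem theorem5p1:
  fixes G :: "complex set" and m :: nat and eta :: "nat \<Rightarrow> real \<Rightarrow> complex"
    and gamma :: "nat \<Rightarrow> real \<Rightarrow> real"
  assumes "admissible_domain G m eta"
    and "gamma \<in> Hspace m"
  shows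
    "(\<exists>mu\<in>Hspace m. \<forall>j\<in>{1..m}. \<forall>s\<in>{0..2*pi}.
         mu j s - Nop eta m mu j s = - Mop eta m gamma j s)
   \<and> (\<forall>mu1\<in>Hspace m. \<forall>mu2\<in>Hspace m.
        (\<forall>j\<in>{1..m}. \<forall>s\<in>{0..2*pi}. mu1 j s - Nop eta m mu1 j s = - Mop eta m gamma j s) \<longrightarrow>
        (\<forall>j\<in>{1..m}. \<forall>s\<in>{0..2*pi}. mu2 j s - Nop eta m mu2 j s = - Mop eta m gamma j s) \<longrightarrow>
        (\<forall>j\<in>{1..m}. \<forall>s\<in>{0..2*pi}. mu1 j s = mu2 j s))
   \<and> (\<forall>mu\<in>Hspace m.
        (\<forall>j\<in>{1..m}. \<forall>s\<in>{0..2*pi}. mu j s - Nop eta m mu j s = - Mop eta m gamma j s) \<longrightarrow>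
        (\<exists>h :: nat \<Rightarrow> real.
           (\<forall>j\<in>{1..m}. \<forall>s\<in>{0..2*pi}.
              h j = (Mop eta m mu j s - (gamma j s - Nop eta m gamma j s)) / 2)
         \<and> (\<exists>f. ext_problem G m eta (\<lambda>j s. gamma j s + h j) f)
         \<and> (\<forall>f g. ext_problem G m eta (\<lambda>j s. gamma j s + h j) f \<longrightarrow>
                  ext_problem G m eta (\<lambda>j s. gamma j s + h j) g \<longrightarrow>
                  (\<forall>z\<in>G \<union> bdry eta m. f z = g z))
         \<and> (\<forall>f. ext_problem G m eta (\<lambda>j s. gamma j s + h j) f \<longrightarrow>
                (\<forall>j\<in>{1..m}. \<forall>s\<in>{0..2*pi}.
                   f (eta j s) = complex_of_real (gamma j s + h j) + \<i> * complex_of_real (mu j s)))))"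
proof -
  interpret exterior_domain G m eta by unfold_locales (rule assms(1))
  show ?thesis
  proof (intro conjI ballI impI)
    obtain mu where "mu \<in> Hspace m"
      "\<And>j s. j \<in> {1..m} \<Longrightarrow> s \<in> {0..2*pi} \<Longrightarrow> mu j s - Nop eta m mu j s = - Mop eta m gamma j s"
      using density_exists[OF assms(2)] by blast
    then show "\<exists>mu\<in>Hspace m. \<forall>j\<in>{1..m}. \<forall>s\<in>{0..2*pi}. mu j s - Nop eta m mu j s = - Mop eta m gamma j s"
      by blast
  next
    fix mu1 mu2 j s
    assume "mu1 \<in> Hspace m" "mu2 \<in> Hspace m"
      "\<forall>j\<in>{1..m}. \<forall>s\<in>{0..2*pi}. mu1 j s - Nop eta m mu1 j s = - Mop eta m gamma j s"
      "\<forall>j\<in>{1..m}. \<forall>s\<in>{0..2*pi}. mu2 j s - Nop eta m mu2 j s = - Mop eta m gamma j s"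
      "j \<in> {1..m}" "s \<in> {0..2*pi}"
    then show "mu1 j s = mu2 j s"
      using density_unique[OF assms(2), of mu1 mu2 j s] by blast
  next
    fix mu
    assume mu: "mu \<in> Hspace m"
      "\<forall>j\<in>{1..m}. \<forall>s\<in>{0..2*pi}. mu j s - Nop eta m mu j s = - Mop eta m gamma j s"
    obtain h f where h: "\<And>j s. j \<in> {1..m} \<Longrightarrow> s \<in> {0..2*pi} \<Longrightarrow> h j = (Mop eta m mu j s - (gamma j s - Nop eta m gamma j s)) / 2"
      and f: "ext_problem G m eta (\<lambda>j s. gamma j s + h j) f"
      and bd: "\<And>j s. j \<in> {1..m} \<Longrightarrow> s \<in> {0..2*pi} \<Longrightarrow> f (eta j s) = of_real (gamma j s + h j) + \<i> * of_real (mu j s)"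
      using density_solution[OF assms(2) mu(1)] mu(2) by blast
    have uniq: "f1 z = f2 z"
      if "ext_problem G m eta (\<lambda>j s. gamma j s + h j) f1" "ext_problem G m eta (\<lambda>j s. gamma j s + h j) f2"
        "z \<in> G \<union> bdry eta m" for f1 f2 z
      by (rule ext_problem_unique[OF that(1,2) _ that(3), where d = "\<lambda>_. 0"]) simp
    have "eta j s \<in> G \<union> bdry eta m" if "j \<in> {1..m}" "s \<in> {0..2*pi}" for j s
      using Gam_sub_bdry[OF that(1)] that(2) by blast
    \<comment> \<open>Uniqueness holds up to the boundary, so every solution inherits the boundary
      values of the one constructed from \<open>mu\<close>.\<close>
    then have bd': "f1 (eta j s) = of_real (gamma j s + h j) + \<i> * of_real (mu j s)"
      if "ext_problem G m eta (\<lambda>j s. gamma j s + h j) f1" "j \<in> {1..m}" "s \<in> {0..2*pi}" for f1 j s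
      using uniq[OF that(1) f] bd[OF that(2,3)] that(2,3) by simp
    show "\<exists>h. (\<forall>j\<in>{1..m}. \<forall>s\<in>{0..2*pi}. h j = (Mop eta m mu j s - (gamma j s - Nop eta m gamma j s)) / 2)
         \<and> (\<exists>f. ext_problem G m eta (\<lambda>j s. gamma j s + h j) f)
         \<and> (\<forall>f g. ext_problem G m eta (\<lambda>j s. gamma j s + h j) f \<longrightarrow>
                  ext_problem G m eta (\<lambda>j s. gamma j s + h j) g \<longrightarrow>
                  (\<forall>z\<in>G \<union> bdry eta m. f z = g z))
         \<and> (\<forall>f. ext_problem G m eta (\<lambda>j s. gamma j s + h j) f \<longrightarrow>
                (\<forall>j\<in>{1..m}. \<forall>s\<in>{0..2*pi}.
                   f (eta j s) = complex_of_real (gamma j s + h j) + \<i> * complex_of_real (mu j s)))"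
    proof (intro exI[of _ h] conjI)
      show "\<forall>j\<in>{1..m}. \<forall>s\<in>{0..2*pi}. h j = (Mop eta m mu j s - (gamma j s - Nop eta m gamma j s)) / 2"
        using h by blast
      show "\<exists>f. ext_problem G m eta (\<lambda>j s. gamma j s + h j) f"
        using f by blast
    qed (use uniq bd' in blast)+
  qed
qed

end
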